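(* Suppose that $H>1/2$, that $b$ is of class $\mathcal{C}^2$ and of linear growth with $b'\in\mathcal{C}_b^1$, that $\eta$ admits a Lipschitz continuous density (with respect to Lebesgue measure on $[0,\tau]$), and that $x_0$ is of class $\mathcal{C}^2$. Let $X$ solve the stochastic delay differential equation described in the context, let $X^n$ be its Euler–Maruyama scheme with step $\Delta_n=\tau/n$, and let $U^n=X-X^n$. Then for every $T>0$ and $p\ge1$ there is a constant $C>0$, independent of $n$, such that $$\sup_{0\le t\le T}\mathbb{E}(|U^n_t|^p)^{1/p}\le C\Delta_n^{H+1/2}.$$
   Context: Setting. $(\Omega,\mathcal F,\mathbb P)$ is a complete probability space carrying a two-sided Wiener process $W$. For $H\in(0,1)$, $B_t=\int_{-\infty}^t[(t-s)_+^{H-1/2}-(-s)_+^{H-1/2}]\,\mathrm dW_s$, where $(x)_+^p:=x^p\mathbf 1_{x>0}$; this is a fractional Brownian motion (up to normalization) of index $H$. $\tau>0$, and $\eta$ is a finite deterministic signed measure on $[0,\tau]$. $x_0$ is a continuous deterministic function on $[-\tau,0]$, extended by $0$ outside $[-\tau,0]$. $b:\mathbb R\to\mathbb R$ is always at least $\mathcal C^1$ and of linear growth. $\mathcal C_b^k$ denotes bounded $\mathcal C^k$ functions with bounded derivatives up to order $k$. $X$ is the unique solution of $$X_t=x_0(0)+\int_0^t\int_{[0,\tau]}b(X_{s-r})\,\eta(\mathrm dr)\,\mathrm ds+B_t,\ t\ge0;\qquad X_t=x_0(t),\ -\tau\le t<0.$$ For $n\in\mathbb N$ put $\Delta_n=\tau/n$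 and $\mathcal T(s)=[s/\Delta_n]\Delta_n$, $s\ge0$ ($[\cdot]$ is the integer part). The Euler–Maruyama scheme is $$X^n_t=x_0(0)+\int_0^t\int_{[0,\tau]}b(X^n_{\mathcal T(s)-\mathcal T(r)})\,\eta(\mathrm dr)\,\mathrm ds+B_t,\ t\ge0;\qquad X^n_t=x_0(t),\ -\tau\le t<0.$$ *)

theory Defs
  imports "HOL-Probability.Probability"
begin

section \<open>Smoothness classes\<close>

text \<open>On a compact interval the derivatives at the end points are one-sided.\<close>

fun Ck_on :: "nat \<Rightarrow> real set \<Rightarrow> (real \<Rightarrow> real) \<Rightarrow> bool" where
  "Ck_on 0 S f \<longleftrightarrow> continuous_on S f"
| "Ck_on (Suc k) S f \<longleftrightarrow>
     (\<exists>f'. (\<forall>x\<in>S. (f has_real_derivative f' x) (at x within S)) \<and> Ck_on k S f')"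

fun Cbk :: "nat \<Rightarrow> (real \<Rightarrow> real) \<Rightarrow> bool" where
  "Cbk 0 f \<longleftrightarrow> continuous_on UNIV f \<and> bounded (range f)"
| "Cbk (Suc k) f \<longleftrightarrow> bounded (range f) \<and>
     (\<exists>f'. (\<forall>x. (f has_real_derivative f' x) (at x)) \<and> Cbk k f')"

definition linear_growth :: "(real \<Rightarrow> real) \<Rightarrow> bool" where
  "linear_growth b \<longleftrightarrow> (\<exists>K. \<forall>x. \<bar>b x\<bar> \<le> K * (1 + \<bar>x\<bar>))"

section \<open>Finite signed measures\<close>

definition finite_signed_measure :: "'b measure \<Rightarrow> ('b set \<Rightarrow> real) \<Rightarrow> bool" where
  "finite_signed_measure N \<eta> \<longleftrightarrow>
     (\<forall>A. range A \<subseteq> sets N \<longrightarrow> disjoint_family A \<longrightarrow>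
          (\<lambda>i::nat. \<eta> (A i)) sums \<eta> (\<Union>i. A i))"

text \<open>
  The positive part \<open>\<eta>\<^sup>+(A) = sup {\<eta>(B) | B \<subseteq> A}\<close> of the Jordan decomposition; the negative
  part of \<open>\<eta>\<close> is the positive part of \<open>-\<eta>\<close>. The supremum includes \<open>B = {}\<close>, so it is harmless
  that \<open>ennreal\<close> sends negative reals to \<open>0\<close>. Only the \<open>\<sigma>\<close>-algebra of \<open>N\<close> is used.
\<close>

definition positive_part :: "'b measure \<Rightarrow> ('b set \<Rightarrow> real) \<Rightarrow> 'b measure" where
  "positive_part N \<eta> =
     measure_of (space N) (sets N) (\<lambda>A. SUP B\<in>{B \<in> sets N. B \<subseteq> A}. ennreal (\<eta> B))"

definition signed_integral :: "'b measure \<Rightarrow> ('b set \<Rightarrow> real) \<Rightarrow> ('b \<Rightarrow> real) \<Rightarrow> real" where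
  "signed_integral N \<eta> f =
     (\<integral>r. f r \<partial>positive_part N \<eta>) - (\<integral>r. f r \<partial>positive_part N (\<lambda>A. - \<eta> A))"

abbreviation delay_space :: "real \<Rightarrow> real measure" where
  "delay_space \<tau> \<equiv> restrict_space borel {0..\<tau>}"

definition has_lipschitz_density :: "real \<Rightarrow> (real set \<Rightarrow> real) \<Rightarrow> bool" where
  "has_lipschitz_density \<tau> \<eta> \<longleftrightarrow>
     (\<exists>g L. L-lipschitz_on {0..\<tau>} g \<and>
        (\<forall>A\<in>sets (delay_space \<tau>). \<eta> A = (LINT r:A|lborel. g r)))"

section \<open>Wiener process, Wiener integral and fractional Brownian motion\<close>

definition two_sided_wiener :: "'a measure \<Rightarrow> (real \<Rightarrow> 'a \<Rightarrow> real) \<Rightarrow> bool" where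
  "two_sided_wiener M W \<longleftrightarrow>
     (\<forall>t. W t \<in> borel_measurable M) \<and>
     (AE \<omega> in M. W 0 \<omega> = 0) \<and>
     (AE \<omega> in M. continuous_on UNIV (\<lambda>t. W t \<omega>)) \<and>
     (\<forall>s t. s < t \<longrightarrow>
        distributed M lborel (\<lambda>\<omega>. W t \<omega> - W s \<omega>) (normal_density 0 (sqrt (t - s)))) \<and>
     (\<forall>(t::nat \<Rightarrow> real) k. strict_mono t \<longrightarrow>
        prob_space.indep_vars M (\<lambda>_. borel) (\<lambda>i \<omega>. W (t (Suc i)) \<omega> - W (t i) \<omega>) {..<k})"

text \<open>A list of triples \<open>(c, u, v)\<close> with \<open>u \<le> v\<close> encodes the step function \<open>\<Sum> c 1\<^bsub>(u,v]\<^esub>\<close>.\<close>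

type_synonym step_list = "(real \<times> real \<times> real) list"

definition step_ok :: "step_list \<Rightarrow> bool" where
  "step_ok l \<longleftrightarrow> (\<forall>(c, u, v)\<in>set l. u \<le> v)"

definition step_fun :: "step_list \<Rightarrow> real \<Rightarrow> real" where
  "step_fun l s = (\<Sum>(c, u, v)\<leftarrow>l. c * indicator {u<..v} s)"

definition step_integral :: "(real \<Rightarrow> 'a \<Rightarrow> real) \<Rightarrow> step_list \<Rightarrow> 'a \<Rightarrow> real" where
  "step_integral W l \<omega> = (\<Sum>(c, u, v)\<leftarrow>l. c * (W v \<omega> - W u \<omega>))"

text \<open>
  \<open>Y\<close> is a version of \<open>\<integral> f dW\<close>, i.e. the value at \<open>f\<close> of the \<open>L\<^sup>2\<close>-isometric extension of the
  integral of step functions.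
\<close>

definition has_wiener_integral ::
  "'a measure \<Rightarrow> (real \<Rightarrow> 'a \<Rightarrow> real) \<Rightarrow> (real \<Rightarrow> real) \<Rightarrow> ('a \<Rightarrow> real) \<Rightarrow> bool" where
  "has_wiener_integral M W f Y \<longleftrightarrow>
     f \<in> borel_measurable lborel \<and> Y \<in> borel_measurable M \<and>
     (\<exists>l :: nat \<Rightarrow> step_list. (\<forall>k. step_ok (l k)) \<and>
        (\<lambda>k. \<integral>\<^sup>+s. ennreal ((step_fun (l k) s - f s)\<^sup>2) \<partial>lborel) \<longlonglongrightarrow> 0 \<and>
        (\<lambda>k. \<integral>\<^sup>+\<omega>. ennreal ((step_integral W (l k) \<omega> - Y \<omega>)\<^sup>2) \<partial>M) \<longlonglongrightarrow> 0)"

definition pos_powr :: "real \<Rightarrow> real \<Rightarrow> real" where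
  "pos_powr x p = (if x > 0 then x powr p else 0)"

text \<open>
  The integral determines each \<open>B t\<close> only up to a null set; as usual, \<open>B\<close> is taken to be a
  version with almost surely continuous paths.
\<close>

definition fractional_BM ::
  "'a measure \<Rightarrow> (real \<Rightarrow> 'a \<Rightarrow> real) \<Rightarrow> real \<Rightarrow> (real \<Rightarrow> 'a \<Rightarrow> real) \<Rightarrow> bool" where
  "fractional_BM M W H B \<longleftrightarrow>
     (\<forall>t\<ge>0. has_wiener_integral M W
        (\<lambda>s. indicator {..t} s * (pos_powr (t - s) (H - 1/2) - pos_powr (- s) (H - 1/2))) (B t)) \<and>
     (AE \<omega> in M. continuous_on {0..} (\<lambda>t. B t \<omega>))"

section \<open>The delay equation and its Euler--Maruyama scheme\<close>

definition sdde_solution ::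
  "'a measure \<Rightarrow> real \<Rightarrow> (real \<Rightarrow> real) \<Rightarrow> (real set \<Rightarrow> real) \<Rightarrow> (real \<Rightarrow> real) \<Rightarrow>
   (real \<Rightarrow> 'a \<Rightarrow> real) \<Rightarrow> (real \<Rightarrow> 'a \<Rightarrow> real) \<Rightarrow> bool" where
  "sdde_solution M \<tau> b \<eta> x\<^sub>0 B X \<longleftrightarrow>
     (\<forall>t\<ge>-\<tau>. X t \<in> borel_measurable M) \<and>
     (AE \<omega> in M. continuous_on {0..} (\<lambda>t. X t \<omega>) \<and>
        (\<forall>t. -\<tau> \<le> t \<and> t < 0 \<longrightarrow> X t \<omega> = x\<^sub>0 t) \<and>
        (\<forall>t\<ge>0. X t \<omega> = x\<^sub>0 0 +
           (LINT s:{0..t}|lborel. signed_integral (delay_space \<tau>) \<eta> (\<lambda>r. b (X (s - r) \<omega>))) +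
           B t \<omega>))"

definition grid_floor :: "real \<Rightarrow> real \<Rightarrow> real" where
  "grid_floor \<Delta> s = of_int \<lfloor>s / \<Delta>\<rfloor> * \<Delta>"

text \<open>
  No path continuity is required here: for \<open>\<Delta> > 0\<close> both integrands below take finitely many
  values on bounded intervals, so the equation is an explicit recursion along the grid.
\<close>

definition euler_maruyama ::
  "'a measure \<Rightarrow> real \<Rightarrow> (real \<Rightarrow> real) \<Rightarrow> (real set \<Rightarrow> real) \<Rightarrow> (real \<Rightarrow> real) \<Rightarrow>
   (real \<Rightarrow> 'a \<Rightarrow> real) \<Rightarrow> real \<Rightarrow> (real \<Rightarrow> 'a \<Rightarrow> real) \<Rightarrow> bool" where
  "euler_maruyama M \<tau> b \<eta> x\<^sub>0 B \<Delta> Y \<longleftrightarrow>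
     (\<forall>t\<ge>-\<tau>. Y t \<in> borel_measurable M) \<and>
     (AE \<omega> in M.
        (\<forall>t. -\<tau> \<le> t \<and> t < 0 \<longrightarrow> Y t \<omega> = x\<^sub>0 t) \<and>
        (\<forall>t\<ge>0. Y t \<omega> = x\<^sub>0 0 +
           (LINT s:{0..t}|lborel. signed_integral (delay_space \<tau>) \<eta>
              (\<lambda>r. b (Y (grid_floor \<Delta> s - grid_floor \<Delta> r) \<omega>))) +
           B t \<omega>))"

section \<open>Moments\<close>

text \<open>\<open>E(|Y|^p)^(1/p)\<close> with value \<open>\<infinity>\<close> if the moment is infinite.\<close>

definition Lp_norm :: "'a measure \<Rightarrow> real \<Rightarrow> ('a \<Rightarrow> real) \<Rightarrow> ennreal" where
  "Lp_norm M p Y =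
     (let m = \<integral>\<^sup>+\<omega>. ennreal (\<bar>Y \<omega>\<bar> powr p) \<partial>M
      in if m = \<infinity> then \<infinity> else ennreal (enn2real m powr (1 / p)))"

end

theory Submission
  imports Defs
begin

text \<open>
  With \<open>d = \<tau>/n\<close> and \<open>T\<close> the grid projection, the error of the scheme is the path error
  \<open>\<integral>\<integral> (b(X(s - r)) - b(X(T s - T r))) g(r) dr ds\<close> plus a term that Gronwall's lemma absorbs. Writing
  \<open>s = kd + x\<close> and \<open>r = jd + y\<close> and freezing \<open>g\<close> at \<open>jd\<close> (which costs \<open>d\<^bsup>1+H\<^esup>\<close>), the integrand depends on
  \<open>(x, y)\<close> through \<open>x - y\<close> only, so reflecting both variables turns it into second differences of \<open>b(X)\<close>
  of width \<open>|x - y|\<close> around the grid points \<open>(k - j)d\<close>. By Taylor expansion these are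
  \<open>b'(X)\<close> times second differences of the noise, up to terms of order \<open>d\<^bsup>2H\<^esup>\<close>.
  The second differences of the kernel of \<open>B\<close> are uniformly bounded, summable along the grid and
  integrable, hence \<open>N\<close> consecutive ones of \<open>B\<close> sum up to \<open>O(d\<^bsup>H\<^esup> N\<^bsup>1/2\<^esup>)\<close>; since \<open>b'(X)\<close> is \<open>H\<close>-Hoelder
  in every moment and \<open>H + 1/2 > 1\<close>, a discrete sewing (Young) estimate gives the same bound for the
  weighted sums. For each fixed \<open>j\<close> the sum over \<open>k\<close> is therefore \<open>O(d\<^bsup>H-1/2\<^esup>)\<close>, and summing over
  \<open>j\<close> and integrating over the cell yields \<open>O(d\<^bsup>H+1/2\<^esup>)\<close>.
\<close>

section \<open>Moment bounds\<close>

text \<open>Two obstacles shape the argument. Finiteness of the moments is not known in advance, so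
  every estimate is a statement \<open>Lq M q Y c\<close> about a nonnegative integral, which
  carries no integrability side condition, and both Gronwall arguments produce finiteness along with
  the bound: one works path by path, the other proceeds along the grid. The powers are natural
  numbers, so that convexity reduces to polynomial tangent lines; a real p is recovered at the very
  end from some q \<ge> p. Products double the power, which is harmless because the noise estimates
  are available for every q. The second obstacle is that Hoelder continuity of the integrand alone
  yields only the order d^H. After symmetrisation there remain about T/d second differences, and
  their sum has to grow like the square root of their number. The condition H > 1/2 enters twice: as
  H + 1/2 > 1 in the sewing estimate, and as 2H - 1 \<ge> H - 1/2, which makes T/d remainders of
  order d^(2H) admissible.\<close>

definition Lq :: "'a measure \<Rightarrow> nat \<Rightarrow> ('a \<Rightarrow> real) \<Rightarrow> real \<Rightarrow> bool" where
  "Lq M q Y c \<longleftrightarrow> Y \<in> borel_measurable M \<and> 0 \<le> c \<and>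
     (\<integral>\<^sup>+\<omega>. ennreal (\<bar>Y \<omega>\<bar> ^ q) \<partial>M) \<le> ennreal (c ^ q)"

lemma Lq_nonneg: "Lq M q Y c \<Longrightarrow> 0 \<le> c"
  by (simp add: Lq_def)

lemma Lq_mono_AE:
  assumes "Lq M q Z c" "Y \<in> borel_measurable M" "AE \<omega> in M. \<bar>Y \<omega>\<bar> \<le> \<bar>Z \<omega>\<bar>" "c \<le> d"
  shows "Lq M q Y d"
proof -
  have "(\<integral>\<^sup>+\<omega>. ennreal (\<bar>Y \<omega>\<bar> ^ q) \<partial>M) \<le> (\<integral>\<^sup>+\<omega>. ennreal (\<bar>Z \<omega>\<bar> ^ q) \<partial>M)"
    using assms(3) by (intro nn_integral_mono_AE) (auto elim!: eventually_mono intro!: ennreal_leI power_mono)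
  also have "\<dots> \<le> ennreal (c ^ q)" using assms(1) by (simp add: Lq_def)
  also have "\<dots> \<le> ennreal (d ^ q)" using assms(1,4) by (auto simp: Lq_def intro!: ennreal_leI power_mono)
  finally show ?thesis using assms by (auto simp: Lq_def)
qed

lemma Lq_mono: "Lq M q Y c \<Longrightarrow> c \<le> d \<Longrightarrow> Lq M q Y d"
  by (rule Lq_mono_AE[of M q Y c]) (auto simp: Lq_def)

lemma Lq_cong_AE:
  assumes "Lq M q Z c" "Y \<in> borel_measurable M" "AE \<omega> in M. Y \<omega> = Z \<omega>"
  shows "Lq M q Y c"
  by (rule Lq_mono_AE[OF assms(1,2)]) (use assms(3) in auto)

lemma Lq_minus: "Lq M q Y c \<Longrightarrow> Lq M q (\<lambda>\<omega>. - Y \<omega>) c"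
  by (auto simp: Lq_def)

lemma Lq_abs: "Lq M q Y c \<Longrightarrow> Lq M q (\<lambda>\<omega>. \<bar>Y \<omega>\<bar>) c"
  by (auto simp: Lq_def)

lemma Lq_cmult:
  assumes "Lq M q Y c" shows "Lq M q (\<lambda>\<omega>. k * Y \<omega>) (\<bar>k\<bar> * c)"
proof -
  have "Y \<in> borel_measurable M" using assms by (simp add: Lq_def)
  moreover have "(\<integral>\<^sup>+\<omega>. ennreal (\<bar>k * Y \<omega>\<bar> ^ q) \<partial>M) = ennreal (\<bar>k\<bar>^q) * (\<integral>\<^sup>+\<omega>. ennreal (\<bar>Y \<omega>\<bar> ^ q) \<partial>M)"
    using calculation by (subst nn_integral_cmult[symmetric]) (auto simp: abs_mult power_mult_distrib ennreal_mult)
  ultimately show ?thesis using assms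
    by (auto simp: Lq_def power_mult_distrib ennreal_mult intro!: mult_left_mono)
qed

lemma Lq_cmult_le:
  assumes "Lq M q Y c" "\<bar>k\<bar> \<le> l" shows "Lq M q (\<lambda>\<omega>. k * Y \<omega>) (l * c)"
  using Lq_mono[OF Lq_cmult[OF assms(1)]] assms by (metis Lq_nonneg mult_right_mono)

lemma (in prob_space) Lq_bounded:
  assumes "Y \<in> borel_measurable M" "AE \<omega> in M. \<bar>Y \<omega>\<bar> \<le> c" "0 \<le> c"
  shows "Lq M q Y c"
proof -
  have "(\<integral>\<^sup>+\<omega>. ennreal (\<bar>Y \<omega>\<bar> ^ q) \<partial>M) \<le> (\<integral>\<^sup>+\<omega>. ennreal (c ^ q) \<partial>M)"
    using assms(2) by (intro nn_integral_mono_AE) (auto elim!: eventually_mono intro!: ennreal_leI power_mono)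
  then show ?thesis using assms by (auto simp: Lq_def emeasure_space_1)
qed

text \<open>Settles the degenerate cases of the sum and product rules, whose proofs otherwise divide
  by the bounds.\<close>

lemma Lq_0_AE:
  assumes "Lq M q Y 0" "q \<ge> 1" shows "AE \<omega> in M. Y \<omega> = 0"
proof -
  have "(\<integral>\<^sup>+\<omega>. ennreal (\<bar>Y \<omega>\<bar> ^ q) \<partial>M) = 0" using assms by (auto simp: Lq_def zero_power)
  then have "AE \<omega> in M. ennreal (\<bar>Y \<omega>\<bar> ^ q) = 0"
    using assms(1) by (subst (asm) nn_integral_0_iff_AE) (auto simp: Lq_def)
  then show ?thesis using assms(2) by (auto elim!: eventually_mono simp: ennreal_eq_0_iff)
      (metis abs_ge_zero abs_le_zero_iff antisym zero_le_power power_eq_0_iff)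
qed

text \<open>Convexity of the power on the half-line. In the induction, multiplying the hypothesis by
  x leaves exactly the nonnegative gap q a^(q-1) (x - a)^2.\<close>

lemma power_tangent:
  fixes x a :: real assumes "0 \<le> x" "0 \<le> a" "q \<ge> 1"
  shows "a ^ q + q * a ^ (q - 1) * (x - a) \<le> x ^ q"
  using assms(3)
proof (induction q rule: nat_induct_at_least)
  case base then show ?case by simp
next
  case (Suc q)
  obtain m where m: "q = Suc m" using Suc.hyps by (cases q) auto
  have "x ^ Suc q \<ge> x * (a ^ q + q * a ^ (q - 1) * (x - a))"
    using Suc.IH assms by (simp add: mult_left_mono)
  moreover have "x * (a ^ q + q * a ^ (q - 1) * (x - a)) - (a ^ Suc q + Suc q * a ^ q * (x - a))
      = q * a ^ (q - 1) * (x - a)^2"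
    unfolding m by (simp add: algebra_simps power2_eq_square)
  moreover have "q * a ^ (q - 1) * (x - a)^2 \<ge> 0" using assms by simp
  ultimately show ?case by simp
qed

text \<open>Jensen's inequality for the points x/a and y/c with weights a and c. Both tangents are
  taken at the weighted mean t, so the linear terms cancel.\<close>

lemma power_add_convex:
  fixes x y a c :: real assumes "0 < a" "0 < c" "0 \<le> x" "0 \<le> y" "q \<ge> 1"
  shows "(x + y) ^ q \<le> (a + c) ^ (q - 1) * (a * (x / a) ^ q + c * (y / c) ^ q)"
proof -
  define t where "t = (x + y) / (a + c)"
  have t0: "0 \<le> t" using assms by (simp add: t_def)
  have "a * (t ^ q + q * t ^ (q-1) * (x/a - t)) + c * (t ^ q + q * t ^ (q-1) * (y/c - t))
     \<le> a * (x / a) ^ q + c * (y / c) ^ q"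
    using assms t0 by (intro add_mono mult_left_mono power_tangent) auto
  also have "a * (t ^ q + q * t ^ (q-1) * (x/a - t)) + c * (t ^ q + q * t ^ (q-1) * (y/c - t))
     = (a + c) * t ^ q + q * t ^ (q-1) * (x + y - (a + c) * t)"
    using assms by (simp add: field_simps)
  also have "\<dots> = (a + c) * t ^ q" using assms by (simp add: t_def)
  finally have "(a + c) ^ (q - 1) * ((a + c) * t ^ q) \<le> (a + c) ^ (q - 1) * (a * (x / a) ^ q + c * (y / c) ^ q)"
    using assms by (intro mult_left_mono) auto
  moreover have "(a + c) ^ (q - 1) * ((a + c) * t ^ q) = ((a + c) * t) ^ q"
    using assms(5) by (cases q) (auto simp: power_mult_distrib)
  moreover have "(a + c) * t = x + y" using assms by (simp add: t_def)
  ultimately show ?thesis by simp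
qed

text \<open>Minkowski's inequality. The weights in the pointwise Jensen inequality are the two
  bounds themselves; after integration each normalised term contributes its own weight, and the
  constant is exactly a + c.\<close>

lemma Lq_add:
  assumes Y: "Lq M q Y a" and Z: "Lq M q Z c" and q: "q \<ge> 1"
  shows "Lq M q (\<lambda>\<omega>. Y \<omega> + Z \<omega>) (a + c)"
proof -
  have [measurable]: "Y \<in> borel_measurable M" "Z \<in> borel_measurable M" using Y Z by (auto simp: Lq_def)
  have a0: "0 \<le> a" "0 \<le> c" using Y Z by (auto simp: Lq_def)
  consider "a = 0" | "c = 0" | "0 < a" "0 < c" using a0 by linarith
  then show ?thesis
  proof cases
    case 1
    with Lq_0_AE[of M q Y] Y q have "AE \<omega> in M. Y \<omega> = 0" by auto
    then show ?thesis using 1 by (intro Lq_cong_AE[OF Z[THEN Lq_mono]]) auto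
  next
    case 2
    with Lq_0_AE[of M q Z] Z q have "AE \<omega> in M. Z \<omega> = 0" by auto
    then show ?thesis using 2 by (intro Lq_cong_AE[OF Y[THEN Lq_mono]]) auto
  next
    case 3
    have "(\<integral>\<^sup>+\<omega>. ennreal (\<bar>Y \<omega> + Z \<omega>\<bar> ^ q) \<partial>M)
      \<le> (\<integral>\<^sup>+\<omega>. ennreal ((a + c) ^ (q - 1)) * (ennreal (a * (1/a)^q) * ennreal (\<bar>Y \<omega>\<bar> ^ q)
            + ennreal (c * (1/c)^q) * ennreal (\<bar>Z \<omega>\<bar> ^ q)) \<partial>M)"
    proof (intro nn_integral_mono)
      fix \<omega>
      have "\<bar>Y \<omega> + Z \<omega>\<bar> ^ q \<le> (\<bar>Y \<omega>\<bar> + \<bar>Z \<omega>\<bar>) ^ q" by (intro power_mono) auto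
      also have "\<dots> \<le> (a + c) ^ (q - 1) * (a * (\<bar>Y \<omega>\<bar> / a) ^ q + c * (\<bar>Z \<omega>\<bar> / c) ^ q)"
        using 3 q by (intro power_add_convex) auto
      also have "\<dots> = (a + c) ^ (q - 1) * (a * (1/a)^q * \<bar>Y \<omega>\<bar> ^ q + c * (1/c)^q * \<bar>Z \<omega>\<bar> ^ q)"
        by (simp add: power_divide)
      finally show "ennreal (\<bar>Y \<omega> + Z \<omega>\<bar> ^ q) \<le> ennreal ((a + c) ^ (q - 1)) * (ennreal (a * (1/a)^q) * ennreal (\<bar>Y \<omega>\<bar> ^ q)
            + ennreal (c * (1/c)^q) * ennreal (\<bar>Z \<omega>\<bar> ^ q))"
        using 3 by (simp flip: ennreal_mult' ennreal_plus add: ennreal_leI)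
    qed
    also have "\<dots> = ennreal ((a + c) ^ (q - 1)) * (ennreal (a * (1/a)^q) * (\<integral>\<^sup>+\<omega>. ennreal (\<bar>Y \<omega>\<bar> ^ q) \<partial>M)
            + ennreal (c * (1/c)^q) * (\<integral>\<^sup>+\<omega>. ennreal (\<bar>Z \<omega>\<bar> ^ q) \<partial>M))"
      by (simp add: nn_integral_cmult nn_integral_add)
    also have "\<dots> \<le> ennreal ((a + c) ^ (q - 1)) * (ennreal (a * (1/a)^q) * ennreal (a ^ q)
            + ennreal (c * (1/c)^q) * ennreal (c ^ q))"
      using Y Z by (intro mult_left_mono add_mono) (auto simp: Lq_def)
    also have "\<dots> = ennreal ((a + c) ^ (q - 1) * (a * (1/a)^q * a ^ q + c * (1/c)^q * c ^ q))"
      using 3 by (simp flip: ennreal_mult' ennreal_plus)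
    also have "a * (1/a)^q * a ^ q + c * (1/c)^q * c ^ q = a + c"
      using 3 by (simp add: power_divide)
    also have "(a + c) ^ (q - 1) * (a + c) = (a + c) ^ q" using q by (cases q) auto
    finally show ?thesis using a0 by (auto simp: Lq_def)
  qed
qed

lemma Lq_zero: "q \<ge> 1 \<Longrightarrow> 0 \<le> c \<Longrightarrow> Lq M q (\<lambda>_. 0) c"
  by (auto simp: Lq_def zero_power)

lemma Lq_sum:
  assumes "finite I" "\<And>i. i \<in> I \<Longrightarrow> Lq M q (Y i) (c i)" "q \<ge> 1"
  shows "Lq M q (\<lambda>\<omega>. \<Sum>i\<in>I. Y i \<omega>) (\<Sum>i\<in>I. c i)"
  using assms by (induction I rule: finite_induct) (auto simp: Lq_zero intro!: Lq_add)

text \<open>Cauchy-Schwarz for moments: pointwise this is (E y - A z)^2 \<ge> 0 for the q-th powers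
  y, z of the factors, weighted with the q-th powers A, E of the bounds so that the two halves
  integrate to equal amounts.\<close>

lemma Lq_mult:
  assumes Y: "Lq M (2 * q) Y a" and Z: "Lq M (2 * q) Z c" and q: "q \<ge> 1"
  shows "Lq M q (\<lambda>\<omega>. Y \<omega> * Z \<omega>) (a * c)"
proof -
  have [measurable]: "Y \<in> borel_measurable M" "Z \<in> borel_measurable M" using Y Z by (auto simp: Lq_def)
  have a0: "0 \<le> a" "0 \<le> c" using Y Z by (auto simp: Lq_def)
  consider "a = 0" | "c = 0" | "0 < a" "0 < c" using a0 by linarith
  then show ?thesis
  proof cases
    case 1
    with Lq_0_AE[of M "2 * q" Y] Y q have "AE \<omega> in M. Y \<omega> = 0" by auto
    then show ?thesis using 1 q by (intro Lq_cong_AE[OF Lq_zero]) auto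
  next
    case 2
    with Lq_0_AE[of M "2 * q" Z] Z q have "AE \<omega> in M. Z \<omega> = 0" by auto
    then show ?thesis using 2 q by (intro Lq_cong_AE[OF Lq_zero]) auto
  next
    case 3
    have "(\<integral>\<^sup>+\<omega>. ennreal (\<bar>Y \<omega> * Z \<omega>\<bar> ^ q) \<partial>M)
      \<le> (\<integral>\<^sup>+\<omega>. ennreal (c^q / (2 * a^q)) * ennreal (\<bar>Y \<omega>\<bar> ^ (2*q)) + ennreal (a^q / (2 * c^q)) * ennreal (\<bar>Z \<omega>\<bar> ^ (2*q)) \<partial>M)"
    proof (intro nn_integral_mono)
      fix \<omega>
      define y z where "y = \<bar>Y \<omega>\<bar> ^ q" and "z = \<bar>Z \<omega>\<bar> ^ q"
      define A E where "A = a ^ q" and "E = c ^ q"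
      have p: "0 < A" "0 < E" using 3 by (auto simp: A_def E_def)
      have "0 \<le> (E * y - A * z)\<^sup>2 / (2 * A * E)" using p by simp
      also have "\<dots> = E / (2 * A) * y\<^sup>2 + A / (2 * E) * z\<^sup>2 - y * z"
        using p by (simp add: field_simps power2_eq_square)
      finally have "y * z \<le> E / (2 * A) * y\<^sup>2 + A / (2 * E) * z\<^sup>2" by simp
      moreover have "\<bar>Y \<omega> * Z \<omega>\<bar> ^ q = y * z" by (simp add: y_def z_def abs_mult power_mult_distrib)
      moreover have "\<bar>Y \<omega>\<bar> ^ (2*q) = y\<^sup>2" "\<bar>Z \<omega>\<bar> ^ (2*q) = z\<^sup>2"
        by (simp_all only: y_def z_def power_mult[symmetric] mult.commute)
      ultimately show "ennreal (\<bar>Y \<omega> * Z \<omega>\<bar> ^ q) \<le> ennreal (c^q / (2 * a^q)) * ennreal (\<bar>Y \<omega>\<bar> ^ (2*q)) + ennreal (a^q / (2 * c^q)) * ennreal (\<bar>Z \<omega>\<bar> ^ (2*q))"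
        using p by (simp flip: ennreal_mult' ennreal_plus A_def E_def add: ennreal_leI)
    qed
    also have "\<dots> = ennreal (c^q / (2 * a^q)) * (\<integral>\<^sup>+\<omega>. ennreal (\<bar>Y \<omega>\<bar> ^ (2*q)) \<partial>M) + ennreal (a^q / (2 * c^q)) * (\<integral>\<^sup>+\<omega>. ennreal (\<bar>Z \<omega>\<bar> ^ (2*q)) \<partial>M)"
      by (simp add: nn_integral_cmult nn_integral_add)
    also have "\<dots> \<le> ennreal (c^q / (2 * a^q)) * ennreal (a ^ (2*q)) + ennreal (a^q / (2 * c^q)) * ennreal (c ^ (2*q))"
      using Y Z by (intro mult_left_mono add_mono) (auto simp: Lq_def)
    also have "\<dots> = ennreal ((a * c) ^ q)"
      using 3 by (simp flip: ennreal_mult' ennreal_plus add: power_even_eq power_mult_distrib)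
        (simp add: field_simps power2_eq_square)
    finally show ?thesis using a0 by (auto simp: Lq_def)
  qed
qed

text \<open>Minkowski's integral inequality, the continuous form of \<open>Lq_add\<close>: Jensen's
  inequality with weight c(s) holds for every outcome, and Tonelli then integrates the moments
  first. Strict positivity of c permits the division by c(s).\<close>

lemma Lq_integral:
  fixes F :: "'b \<Rightarrow> 'a \<Rightarrow> real"
  assumes M: "sigma_finite_measure M" and N: "sigma_finite_measure N"
    and F [measurable]: "(\<lambda>(s, \<omega>). F s \<omega>) \<in> borel_measurable (N \<Otimes>\<^sub>M M)"
    and c: "integrable N c" and pos: "\<And>s. s \<in> space N \<Longrightarrow> 0 < c s"
    and bd: "AE s in N. Lq M q (F s) (c s)" and q: "q \<ge> 1"
  shows "Lq M q (\<lambda>\<omega>. \<integral>s. F s \<omega> \<partial>N) (\<integral>s. c s \<partial>N)"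
proof -
  interpret M: sigma_finite_measure M by fact
  interpret N: sigma_finite_measure N by fact
  interpret pair_sigma_finite N M ..
  have [measurable]: "c \<in> borel_measurable N" using c by auto
  have meas: "(\<lambda>\<omega>. \<integral>s. F s \<omega> \<partial>N) \<in> borel_measurable M" by measurable
  define C where "C = (\<integral>s. c s \<partial>N)"
  have C0: "0 \<le> C" unfolding C_def using pos by (intro integral_nonneg_AE) (auto intro!: AE_I2 less_imp_le)
  show ?thesis
  proof (cases "C = 0")
    case True
    \<comment> \<open>A positive weight with integral zero forces \<open>N\<close> to be the null
      measure, so the integral over \<open>N\<close> vanishes as well.\<close>
    then have "AE s in N. c s = 0"
      using integral_nonneg_eq_0_iff_AE[OF c AE_I2[OF less_imp_le[OF pos]]] unfolding C_def by simp
    moreover have "AE s in N. 0 < c s" using pos by auto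
    ultimately have "AE s in N. False" by eventually_elim auto
    then have "(\<lambda>\<omega>. \<integral>s. F s \<omega> \<partial>N) = (\<lambda>\<omega>. 0)"
      by (auto intro!: ext integral_eq_zero_AE elim!: eventually_mono)
    then show ?thesis using True q by (simp add: C_def[symmetric] Lq_zero)
  next
    case False
    with C0 have Cp: "0 < C" by simp
    have key: "ennreal (\<bar>\<integral>s. F s \<omega> \<partial>N\<bar> ^ q) \<le>
      ennreal (C ^ (q-1)) * (\<integral>\<^sup>+s. ennreal (c s * (1 / c s) ^ q) * ennreal (\<bar>F s \<omega>\<bar> ^ q) \<partial>N)"
      (is "_ \<le> _ * ?I") if w [measurable]: "\<omega> \<in> space M" for \<omega>
    proof (cases "integrable N (\<lambda>s. F s \<omega>)")
      case False
      \<comment> \<open>The integral of a non-integrable section is 0 by convention.\<close>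
      then show ?thesis using q by (simp add: not_integrable_integral_eq zero_power)
    next
      case intF: True
      have [measurable]: "(\<lambda>s. F s \<omega>) \<in> borel_measurable N" using intF by auto
      have Ieq: "?I = (\<integral>\<^sup>+s. ennreal (c s * (\<bar>F s \<omega>\<bar> / c s) ^ q) \<partial>N)"
      proof (intro nn_integral_cong)
        fix s assume "s \<in> space N"
        with pos have "0 < c s" by auto
        then show "ennreal (c s * (1 / c s) ^ q) * ennreal (\<bar>F s \<omega>\<bar> ^ q) = ennreal (c s * (\<bar>F s \<omega>\<bar> / c s) ^ q)"
          by (simp flip: ennreal_mult' add: power_divide)
      qed
      show ?thesis
      proof (cases "?I = \<infinity>")
        case True then show ?thesis using Cp by (simp add: ennreal_mult_top ennreal_top_mult)
      next
        case fin: False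
        let ?f = "\<lambda>s. c s * (\<bar>F s \<omega>\<bar> / c s) ^ q"
        have nn: "AE s in N. 0 \<le> ?f s" using pos by (intro AE_I2 mult_nonneg_nonneg zero_le_power divide_nonneg_pos) (auto simp: less_imp_le)
        have intf: "integrable N ?f"
          using nn fin unfolding Ieq by (intro integrableI_nonneg) (auto simp: top.not_eq_extremum)
        define J where "J = (\<integral>s. \<bar>F s \<omega>\<bar> \<partial>N)"
        have J0: "0 \<le> J" unfolding J_def by simp
        define t where "t = J / C"
        have t0: "0 \<le> t" using J0 Cp by (simp add: t_def)
        \<comment> \<open>The tangent inequality at t = J / C, the c-weighted mean of |F| / c; its
          linear part integrates to zero.\<close>
        have "(\<integral>s. c s * t ^ q + q * t ^ (q-1) * (\<bar>F s \<omega>\<bar> - c s * t) \<partial>N) \<le> (\<integral>s. ?f s \<partial>N)"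
        proof (intro integral_mono)
          show "integrable N (\<lambda>s. c s * t ^ q + q * t ^ (q-1) * (\<bar>F s \<omega>\<bar> - c s * t))"
            using intF c by (intro Bochner_Integration.integrable_add integrable_mult_right Bochner_Integration.integrable_diff integrable_abs integrable_mult_left)
          fix s assume "s \<in> space N"
          with pos have p: "0 < c s" by auto
          have "c s * (t ^ q + q * t ^ (q-1) * (\<bar>F s \<omega>\<bar> / c s - t)) \<le> ?f s"
            using p t0 q by (intro mult_left_mono power_tangent) auto
          moreover have "c s * (t ^ q + q * t ^ (q-1) * (\<bar>F s \<omega>\<bar> / c s - t)) = c s * t ^ q + q * t ^ (q-1) * (\<bar>F s \<omega>\<bar> - c s * t)"
            using p by (simp add: field_simps)
          ultimately show "c s * t ^ q + q * t ^ (q-1) * (\<bar>F s \<omega>\<bar> - c s * t) \<le> ?f s" by simp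
        qed (rule intf)
        also have "(\<integral>s. c s * t ^ q + q * t ^ (q-1) * (\<bar>F s \<omega>\<bar> - c s * t) \<partial>N)
           = C * t ^ q + q * t ^ (q-1) * (J - C * t)"
          using intF c unfolding C_def J_def
          by (subst Bochner_Integration.integral_add) (auto simp: Bochner_Integration.integral_diff)
        also have "\<dots> = C * t ^ q" using Cp by (simp add: t_def)
        finally have le: "C * t ^ q \<le> (\<integral>s. ?f s \<partial>N)" .
        have "\<bar>\<integral>s. F s \<omega> \<partial>N\<bar> ^ q \<le> J ^ q" unfolding J_def by (intro power_mono) auto
        also have "J ^ q = C ^ (q-1) * (C * t ^ q)"
          using Cp q by (cases q) (auto simp: t_def power_divide)
        also have "\<dots> \<le> C ^ (q-1) * (\<integral>s. ?f s \<partial>N)" using le Cp by (intro mult_left_mono) auto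
        finally have "ennreal (\<bar>\<integral>s. F s \<omega> \<partial>N\<bar> ^ q) \<le> ennreal (C ^ (q-1)) * ennreal (\<integral>s. ?f s \<partial>N)"
          using Cp by (simp flip: ennreal_mult' add: ennreal_leI)
        also have "ennreal (\<integral>s. ?f s \<partial>N) = ?I"
          unfolding Ieq using intf nn by (subst nn_integral_eq_integral) auto
        finally show ?thesis .
      qed
    qed
    have "(\<integral>\<^sup>+\<omega>. ennreal (\<bar>\<integral>s. F s \<omega> \<partial>N\<bar> ^ q) \<partial>M) \<le>
      (\<integral>\<^sup>+\<omega>. ennreal (C ^ (q-1)) * (\<integral>\<^sup>+s. ennreal (c s * (1 / c s) ^ q) * ennreal (\<bar>F s \<omega>\<bar> ^ q) \<partial>N) \<partial>M)"
      by (intro nn_integral_mono key)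
    also have "\<dots> = ennreal (C ^ (q-1)) * (\<integral>\<^sup>+\<omega>. \<integral>\<^sup>+s. ennreal (c s * (1 / c s) ^ q) * ennreal (\<bar>F s \<omega>\<bar> ^ q) \<partial>N \<partial>M)"
      by (intro nn_integral_cmult) measurable
    also have "(\<integral>\<^sup>+\<omega>. \<integral>\<^sup>+s. ennreal (c s * (1 / c s) ^ q) * ennreal (\<bar>F s \<omega>\<bar> ^ q) \<partial>N \<partial>M)
      = (\<integral>\<^sup>+s. \<integral>\<^sup>+\<omega>. ennreal (c s * (1 / c s) ^ q) * ennreal (\<bar>F s \<omega>\<bar> ^ q) \<partial>M \<partial>N)"
      by (intro Fubini') measurable
    also have "\<dots> \<le> (\<integral>\<^sup>+s. ennreal (c s) \<partial>N)"
    proof (intro nn_integral_mono_AE)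
      show "AE s in N. (\<integral>\<^sup>+\<omega>. ennreal (c s * (1 / c s) ^ q) * ennreal (\<bar>F s \<omega>\<bar> ^ q) \<partial>M) \<le> ennreal (c s)"
        using bd AE_space
      proof eventually_elim
        case (elim s)
        then have p: "0 < c s" and [measurable]: "F s \<in> borel_measurable M" using pos by (auto simp: Lq_def)
        have "(\<integral>\<^sup>+\<omega>. ennreal (c s * (1 / c s) ^ q) * ennreal (\<bar>F s \<omega>\<bar> ^ q) \<partial>M)
          = ennreal (c s * (1 / c s) ^ q) * (\<integral>\<^sup>+\<omega>. ennreal (\<bar>F s \<omega>\<bar> ^ q) \<partial>M)"
          by (intro nn_integral_cmult) measurable
        also have "\<dots> \<le> ennreal (c s * (1 / c s) ^ q) * ennreal (c s ^ q)"
          using elim by (intro mult_left_mono) (auto simp: Lq_def)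
        also have "\<dots> = ennreal (c s)" using p by (simp flip: ennreal_mult' add: power_divide)
        finally show ?case .
      qed
    qed
    also have "(\<integral>\<^sup>+s. ennreal (c s) \<partial>N) = ennreal C"
      unfolding C_def using pos by (intro nn_integral_eq_integral c) (auto intro!: AE_I2 less_imp_le)
    finally have "(\<integral>\<^sup>+\<omega>. ennreal (\<bar>\<integral>s. F s \<omega> \<partial>N\<bar> ^ q) \<partial>M) \<le> ennreal (C ^ (q-1)) * ennreal C"
      by (simp add: mult_left_mono)
    also have "\<dots> = ennreal (C ^ q)" using Cp q by (cases q) (auto simp flip: ennreal_mult' simp: mult.commute)
    finally show ?thesis using meas C0 by (simp add: Lq_def C_def[symmetric])
  qed
qed

text \<open>From y^p \<le> 1 + y^q for y = |Y| / c the p-th moment is at most 2 c^p, and the p-th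
  root of 2 is at most 2.\<close>

lemma Lq_Lp_norm:
  assumes "Lq M q Y c" "prob_space M" "0 < c" "1 \<le> p" "p \<le> real q"
  shows "Lp_norm M p Y \<le> ennreal (2 * c)"
proof -
  interpret prob_space M by fact
  have [measurable]: "Y \<in> borel_measurable M" using assms by (auto simp: Lq_def)
  have q: "q \<ge> 1" using assms by linarith
  define m where "m = (\<integral>\<^sup>+\<omega>. ennreal (\<bar>Y \<omega>\<bar> powr p) \<partial>M)"
  have "m \<le> (\<integral>\<^sup>+\<omega>. ennreal (c powr p) + ennreal (c powr p / c ^ q) * ennreal (\<bar>Y \<omega>\<bar> ^ q) \<partial>M)"
    unfolding m_def
  proof (intro nn_integral_mono)
    fix \<omega>
    define y where "y = \<bar>Y \<omega>\<bar> / c"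
    have y0: "0 \<le> y" using assms by (simp add: y_def)
    have "y powr p \<le> 1 + y ^ q"
    proof (cases "y \<le> 1")
      case True
      then have "y powr p \<le> 1 powr p" using y0 assms by (intro powr_mono2) auto
      then show ?thesis using y0 by (simp add: add_increasing2)
    next
      case False
      then have "y powr p \<le> y powr real q" using assms by (intro powr_mono) auto
      also have "\<dots> = y ^ q" using False by (intro powr_realpow) auto
      finally show ?thesis by simp
    qed
    then have "c powr p * y powr p \<le> c powr p * (1 + y ^ q)" by (intro mult_left_mono) auto
    moreover have "c powr p * y powr p = \<bar>Y \<omega>\<bar> powr p"
      using assms y0 by (simp flip: powr_mult add: y_def)
    moreover have "c powr p * (1 + y ^ q) = c powr p + c powr p / c ^ q * \<bar>Y \<omega>\<bar> ^ q"
      by (simp add: y_def power_divide algebra_simps)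
    ultimately have "\<bar>Y \<omega>\<bar> powr p \<le> c powr p + c powr p / c ^ q * \<bar>Y \<omega>\<bar> ^ q" by simp
    then show "ennreal (\<bar>Y \<omega>\<bar> powr p) \<le> ennreal (c powr p) + ennreal (c powr p / c ^ q) * ennreal (\<bar>Y \<omega>\<bar> ^ q)"
      using assms by (simp flip: ennreal_mult' ennreal_plus add: ennreal_leI)
  qed
  also have "\<dots> = ennreal (c powr p) + ennreal (c powr p / c ^ q) * (\<integral>\<^sup>+\<omega>. ennreal (\<bar>Y \<omega>\<bar> ^ q) \<partial>M)"
    by (simp add: nn_integral_add nn_integral_cmult emeasure_space_1)
  also have "\<dots> \<le> ennreal (c powr p) + ennreal (c powr p / c ^ q) * ennreal (c ^ q)"
    using assms(1) by (intro add_left_mono mult_left_mono) (auto simp: Lq_def)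
  also have "\<dots> = ennreal (2 * c powr p)"
    using assms by (simp flip: ennreal_mult' ennreal_plus)
  finally have m: "m \<le> ennreal (2 * c powr p)" .
  then have "m \<noteq> \<infinity>" by (auto simp: top_unique)
  have "enn2real m \<le> 2 * c powr p" using m by (simp add: enn2real_leI)
  then have "enn2real m powr (1/p) \<le> (2 * c powr p) powr (1/p)" using assms by (intro powr_mono2) auto
  also have "\<dots> = 2 powr (1/p) * c" using assms by (simp add: powr_mult powr_powr)
  also have "\<dots> \<le> 2 powr 1 * c" using assms by (intro mult_right_mono powr_mono) auto
  finally show ?thesis using \<open>m \<noteq> \<infinity>\<close> by (auto simp: Lp_norm_def m_def[symmetric] intro!: ennreal_leI)
qed

section \<open>Moments of Wiener integrals\<close>

text \<open>Independence in \<open>two_sided_wiener\<close> is stated for infinite strictly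
  increasing sequences of times, so a finite set of times has to be an initial segment of one. The
  new maximum b receives index k and the sequence continues from it in unit steps.\<close>

lemma finite_subset_strict_mono_range:
  assumes "finite (P :: real set)"
  shows "\<exists>(t :: nat \<Rightarrow> real) k. strict_mono t \<and> P = t ` {..<k}"
  using assms
proof (induction P rule: finite_linorder_max_induct)
  case empty
  have "strict_mono (\<lambda>i. real i)" by (simp add: strict_mono_def)
  then show ?case by (intro exI[of _ "\<lambda>i. real i"] exI[of _ 0]) auto
next
  case (insert b A)
  then obtain t :: "nat \<Rightarrow> real" and k where t: "strict_mono t" "A = t ` {..<k}" by auto
  define t' where "t' i = (if i < k then t i else b + real (i - k))" for i
  have "strict_mono t'"
  proof (rule strict_monoI)
    fix i j :: nat assume ij: "i < j"
    have "t i < b" if "i < k" using insert t that by auto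
    then show "t' i < t' j" using ij t(1) by (auto simp: t'_def strict_mono_def add_strict_increasing2)
  qed
  moreover have "insert b A = t' ` {..<Suc k}"
    using t by (auto simp: t'_def lessThan_Suc)
  ultimately show ?case by blast
qed

text \<open>Intervals of a step list may overlap; cutting them at all end points gives disjoint
  cells. The coefficients are chosen before W, \<omega> and s, so the same ones serve the step
  function and its integral. The last cell reaches beyond the given points, but every interval ends
  at an index below k, so its coefficient is 0.\<close>

lemma step_list_refinement:
  fixes t :: "nat \<Rightarrow> real"
  assumes t: "strict_mono t" and "step_ok l" "\<forall>(c, u, v)\<in>set l. u \<in> t ` {..<k} \<and> v \<in> t ` {..<k}"
  shows "\<exists>c. (\<forall>(W :: real \<Rightarrow> 'a \<Rightarrow> real) \<omega>. step_integral W l \<omega> = (\<Sum>i<k. c i * (W (t (Suc i)) \<omega> - W (t i) \<omega>))) \<and>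
     (\<forall>s. step_fun l s = (\<Sum>i<k. c i * indicator {t i<..t (Suc i)} s))"
  using assms(2,3)
proof (induction l)
  case Nil
  show ?case by (intro exI[of _ "\<lambda>_. 0"]) (auto simp: step_integral_def step_fun_def)
next
  case (Cons p l)
  obtain c u v where p: "p = (c, u, v)" by (cases p) auto
  have "step_ok l" "\<forall>(c, u, v)\<in>set l. u \<in> t ` {..<k} \<and> v \<in> t ` {..<k}"
    using Cons.prems by (auto simp: step_ok_def)
  from Cons.IH[OF this] obtain d where d: "\<And>(W :: real \<Rightarrow> 'a \<Rightarrow> real) \<omega>. step_integral W l \<omega> = (\<Sum>i<k. d i * (W (t (Suc i)) \<omega> - W (t i) \<omega>))"
    "\<And>s. step_fun l s = (\<Sum>i<k. d i * indicator {t i<..t (Suc i)} s)"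
    by blast
  from Cons.prems p obtain i j where ij: "u = t i" "v = t j" "i < k" "j < k" and "u \<le> v"
    by (auto simp: step_ok_def)
  then have le: "i \<le> j" using t by (simp add: strict_mono_less_eq)
  define e where "e m = (if m \<in> {i..<j} then c else 0)" for m
  have 1: "c * (W v \<omega> - W u \<omega>) = (\<Sum>m<k. e m * (W (t (Suc m)) \<omega> - W (t m) \<omega>))" for W :: "real \<Rightarrow> 'a \<Rightarrow> real" and \<omega>
  proof -
    have "(\<Sum>m<k. e m * (W (t (Suc m)) \<omega> - W (t m) \<omega>)) = (\<Sum>m\<in>{i..<j}. c * (W (t (Suc m)) \<omega> - W (t m) \<omega>))"
      by (rule sum.mono_neutral_cong_right) (use ij in \<open>auto simp: e_def\<close>)
    also have "\<dots> = c * (W (t j) \<omega> - W (t i) \<omega>)"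
      using le by (simp add: sum_distrib_left[symmetric] sum_Suc_diff'[where f="\<lambda>m. W (t m) \<omega>"])
    finally show ?thesis by (simp add: ij)
  qed
  have 2: "c * indicator {u<..v} s = (\<Sum>m<k. e m * indicator {t m<..t (Suc m)} s)" for s :: real
  proof -
    have "(\<Sum>m<k. e m * indicator {t m<..t (Suc m)} s) = (\<Sum>m\<in>{i..<j}. c * indicator {t m<..t (Suc m)} s)"
      by (rule sum.mono_neutral_cong_right) (use ij in \<open>auto simp: e_def\<close>)
    also have "\<dots> = c * (\<Sum>m\<in>{i..<j}. indicator {t m<..t (Suc m)} s)" by (simp add: sum_distrib_left)
    also have "(\<Sum>m\<in>{i..<j}. indicator {t m<..t (Suc m)} s) = (indicator {t i<..t j} s :: real)"
      using le
    proof (induction j rule: dec_induct)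
      case base then show ?case by simp
    next
      case (step n)
      have "t i \<le> t n" "t n < t (Suc n)" using t step by (auto simp: strict_mono_less_eq strict_mono_less)
      then show ?case using step by (auto simp: indicator_def)
    qed
    finally show ?thesis by (simp add: ij)
  qed
  show ?case
    by (rule exI[of _ "\<lambda>m. e m + d m"])
      (use 1 2 d in \<open>auto simp: p step_integral_def step_fun_def distrib_right sum.distrib\<close>)
qed

lemma step_list_partition:
  assumes "step_ok l"
  obtains t :: "nat \<Rightarrow> real" and k c where "strict_mono t"
    "\<And>(W :: real \<Rightarrow> 'a \<Rightarrow> real) \<omega>. step_integral W l \<omega> = (\<Sum>i<k. c i * (W (t (Suc i)) \<omega> - W (t i) \<omega>))"
    "\<And>s. step_fun l s = (\<Sum>i<k. c i * indicator {t i<..t (Suc i)} s)"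
proof -
  define P where "P = (\<Union>(c, u, v)\<in>set l. {u, v})"
  have "finite P" unfolding P_def by auto
  then obtain t :: "nat \<Rightarrow> real" and k where t: "strict_mono t" "P = t ` {..<k}"
    using finite_subset_strict_mono_range by blast
  have "\<forall>(c, u, v)\<in>set l. u \<in> t ` {..<k} \<and> v \<in> t ` {..<k}"
    unfolding t(2)[symmetric] by (auto simp: P_def)
  from step_list_refinement[OF t(1) assms this, where 'a='a] show ?thesis using that t(1) by blast
qed

text \<open>The cells are disjoint, so the square has no cross terms. The resulting sum is the
  variance of the corresponding step integral.\<close>

lemma nn_integral_partition_sq:
  fixes t :: "nat \<Rightarrow> real"
  assumes t: "strict_mono t"
  shows "(\<integral>\<^sup>+s. ennreal ((\<Sum>i<k. c i * indicator {t i<..t (Suc i)} s)\<^sup>2) \<partial>lborel)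
    = ennreal (\<Sum>i<k. (c i)\<^sup>2 * (t (Suc i) - t i))"
proof -
  have sq: "(\<Sum>i<k. c i * indicator {t i<..t (Suc i)} s)\<^sup>2 = (\<Sum>i<k. (c i)\<^sup>2 * indicator {t i<..t (Suc i)} s)" for s :: real
  proof (induction k)
    case (Suc k)
    have "(\<Sum>i<k. c i * indicator {t i<..t (Suc i)} s) * indicator {t k<..t (Suc k)} s = (0::real)"
    proof -
      have "c i * indicator {t i<..t (Suc i)} s * indicator {t k<..t (Suc k)} s = (0::real)" if "i < k" for i
      proof -
        have "t (Suc i) \<le> t k" using t that by (simp add: strict_mono_less_eq)
        then show ?thesis by (auto simp: indicator_def)
      qed
      then show ?thesis unfolding sum_distrib_right by (intro sum.neutral) auto
    qed
    moreover have "(indicator {t k<..t (Suc k)} s :: real)\<^sup>2 = indicator {t k<..t (Suc k)} s"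
      by (auto simp: indicator_def)
    ultimately show ?case using Suc
      by (simp add: power2_sum power_mult_distrib algebra_simps)
  qed simp
  have inc: "t i \<le> t (Suc i)" for i using t by (simp add: strict_mono_less_eq)
  have "(\<integral>\<^sup>+s. ennreal ((\<Sum>i<k. c i * indicator {t i<..t (Suc i)} s)\<^sup>2) \<partial>lborel)
    = (\<integral>\<^sup>+s. (\<Sum>i<k. ennreal ((c i)\<^sup>2) * indicator {t i<..t (Suc i)} s) \<partial>lborel)"
    unfolding sq by (intro nn_integral_cong, subst sum_ennreal[symmetric])
      (auto simp: ennreal_mult' ennreal_indicator intro!: sum.cong)
  also have "\<dots> = (\<Sum>i<k. ennreal ((c i)\<^sup>2) * ennreal (t (Suc i) - t i))"
    using inc by (subst nn_integral_sum) (auto simp: nn_integral_cmult_indicator)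
  also have "\<dots> = ennreal (\<Sum>i<k. (c i)\<^sup>2 * (t (Suc i) - t i))"
    using inc by (subst sum_ennreal[symmetric]) (auto simp: ennreal_mult' intro!: sum.cong)
  finally show ?thesis .
qed

text \<open>Completing the square turns the exponential tilt into a translation of the density to
  the mean c \<sigma>^2.\<close>

lemma nn_integral_exp_normal_density:
  assumes "0 < \<sigma>"
  shows "(\<integral>\<^sup>+x. ennreal (normal_density 0 \<sigma> x) * ennreal (exp (c * x)) \<partial>lborel) = ennreal (exp (c\<^sup>2 * \<sigma>\<^sup>2 / 2))"
proof -
  have "normal_density 0 \<sigma> x * exp (c * x) = exp (c\<^sup>2 * \<sigma>\<^sup>2 / 2) * normal_density (c * \<sigma>\<^sup>2) \<sigma> x" for x
  proof -
    have "-(x - 0)\<^sup>2 / (2 * \<sigma>\<^sup>2) + c * x = c\<^sup>2 * \<sigma>\<^sup>2 / 2 + (-(x - c * \<sigma>\<^sup>2)\<^sup>2 / (2 * \<sigma>\<^sup>2))"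
      using assms by (simp add: field_simps power2_eq_square)
    then have "exp (-(x - 0)\<^sup>2 / (2 * \<sigma>\<^sup>2)) * exp (c * x) = exp (c\<^sup>2 * \<sigma>\<^sup>2 / 2) * exp (-(x - c * \<sigma>\<^sup>2)\<^sup>2 / (2 * \<sigma>\<^sup>2))"
      by (simp only: exp_add[symmetric])
    then show ?thesis by (simp add: normal_density_def)
  qed
  then have "(\<integral>\<^sup>+x. ennreal (normal_density 0 \<sigma> x) * ennreal (exp (c * x)) \<partial>lborel)
    = (\<integral>\<^sup>+x. ennreal (exp (c\<^sup>2 * \<sigma>\<^sup>2 / 2)) * ennreal (normal_density (c * \<sigma>\<^sup>2) \<sigma> x) \<partial>lborel)"
    by (simp flip: ennreal_mult')
  also have "\<dots> = ennreal (exp (c\<^sup>2 * \<sigma>\<^sup>2 / 2)) * (\<integral>\<^sup>+x. ennreal (normal_density (c * \<sigma>\<^sup>2) \<sigma> x) \<partial>lborel)"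
    by (intro nn_integral_cmult) auto
  also have "(\<integral>\<^sup>+x. ennreal (normal_density (c * \<sigma>\<^sup>2) \<sigma> x) \<partial>lborel) = 1"
    using assms by (subst nn_integral_eq_integral) auto
  finally show ?thesis by simp
qed

section \<open>Sub-Gaussian moments of step integrals\<close>

lemma step_integral_measurable:
  assumes "two_sided_wiener M W" shows "step_integral W l \<in> borel_measurable M"
proof -
  have [measurable]: "W t \<in> borel_measurable M" for t using assms by (auto simp: two_sided_wiener_def)
  have "(\<lambda>\<omega>. \<Sum>(c, u, v)\<leftarrow>l. c * (W v \<omega> - W u \<omega>)) \<in> borel_measurable M"
    by (induction l) auto
  then show ?thesis by (simp add: step_integral_def[abs_def])
qed

text \<open>Independent increments factorise the exponential, and the exponents of the factors add
  up to x^2 / 2 times the squared L2 norm of the step function.\<close>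

lemma step_integral_mgf:
  assumes "prob_space M" and W: "two_sided_wiener M W" and "step_ok l"
    and v: "(\<integral>\<^sup>+s. ennreal ((step_fun l s)\<^sup>2) \<partial>lborel) \<le> ennreal v" and "0 \<le> v"
  shows "(\<integral>\<^sup>+\<omega>. ennreal (exp (x * step_integral W l \<omega>)) \<partial>M) \<le> ennreal (exp (x\<^sup>2 * v / 2))"
proof -
  interpret prob_space M by fact
  obtain t :: "nat \<Rightarrow> real" and k c where t: "strict_mono t"
    and I: "\<And>\<omega>. step_integral W l \<omega> = (\<Sum>i<k. c i * (W (t (Suc i)) \<omega> - W (t i) \<omega>))"
    and f: "\<And>s. step_fun l s = (\<Sum>i<k. c i * indicator {t i<..t (Suc i)} s)"
    by (rule step_list_partition[OF assms(3), where 'a='a]) blast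
  have [measurable]: "W t \<in> borel_measurable M" for t using W by (auto simp: two_sided_wiener_def)
  have ind: "indep_vars (\<lambda>_. borel) (\<lambda>i \<omega>. W (t (Suc i)) \<omega> - W (t i) \<omega>) {..<k}"
    using W t by (auto simp: two_sided_wiener_def)
  have vv: "(\<Sum>i<k. (c i)\<^sup>2 * (t (Suc i) - t i)) \<le> v"
    using v \<open>0 \<le> v\<close> unfolding f nn_integral_partition_sq[OF t] by simp
  have "(\<integral>\<^sup>+\<omega>. ennreal (exp (x * step_integral W l \<omega>)) \<partial>M)
    = (\<integral>\<^sup>+\<omega>. (\<Prod>i<k. ennreal (exp (x * c i * (W (t (Suc i)) \<omega> - W (t i) \<omega>)))) \<partial>M)"
    by (simp add: I sum_distrib_left exp_sum prod_ennreal mult.assoc)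
  also have "\<dots> = (\<Prod>i<k. \<integral>\<^sup>+\<omega>. ennreal (exp (x * c i * (W (t (Suc i)) \<omega> - W (t i) \<omega>))) \<partial>M)"
    by (intro indep_vars_nn_integral indep_vars_compose2[OF ind]) auto
  also have "\<dots> = (\<Prod>i<k. ennreal (exp (x\<^sup>2 * ((c i)\<^sup>2 * (t (Suc i) - t i)) / 2)))"
  proof (intro prod.cong refl)
    fix i assume "i \<in> {..<k}"
    have lt: "t i < t (Suc i)" using t by (simp add: strict_mono_less)
    then have D: "distributed M lborel (\<lambda>\<omega>. W (t (Suc i)) \<omega> - W (t i) \<omega>) (normal_density 0 (sqrt (t (Suc i) - t i)))"
      using W by (auto simp: two_sided_wiener_def)
    have "(\<integral>\<^sup>+\<omega>. ennreal (exp (x * c i * (W (t (Suc i)) \<omega> - W (t i) \<omega>))) \<partial>M)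
       = (\<integral>\<^sup>+y. ennreal (normal_density 0 (sqrt (t (Suc i) - t i)) y) * ennreal (exp (x * c i * y)) \<partial>lborel)"
      by (rule distributed_nn_integral[OF D, symmetric]) auto
    also have "\<dots> = ennreal (exp (x\<^sup>2 * ((c i)\<^sup>2 * (t (Suc i) - t i)) / 2))"
      using lt by (subst nn_integral_exp_normal_density) (auto simp: power_mult_distrib mult.assoc)
    finally show "(\<integral>\<^sup>+\<omega>. ennreal (exp (x * c i * (W (t (Suc i)) \<omega> - W (t i) \<omega>))) \<partial>M)
      = ennreal (exp (x\<^sup>2 * ((c i)\<^sup>2 * (t (Suc i) - t i)) / 2))" .
  qed
  also have "\<dots> = ennreal (exp (x\<^sup>2 * (\<Sum>i<k. (c i)\<^sup>2 * (t (Suc i) - t i)) / 2))"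
    by (simp add: prod_ennreal sum_distrib_left sum_divide_distrib exp_sum)
  also have "\<dots> \<le> ennreal (exp (x\<^sup>2 * v / 2))"
    using vv by (intro ennreal_leI) (auto intro!: mult_left_mono)
  finally show ?thesis .
qed

text \<open>The constant obtained from |x|^q \<le> q! (e^x + e^(-x)) when both exponential moments
  are at most e^(1/2), as for unit variance.\<close>

definition gauss_const :: "nat \<Rightarrow> real" where
  "gauss_const q = 2 * fact q * exp (1/2)"

lemma gauss_const_ge_1: "1 \<le> gauss_const q"
proof -
  have "(1::real) \<le> 2 * fact q" using fact_ge_1[of q, where 'a=real] by linarith
  then have "1 * (1::real) \<le> (2 * fact q) * exp (1/2)"
    by (intro mult_mono) auto
  then show ?thesis by (simp add: gauss_const_def)
qed

text \<open>A single term of the exponential series of |x| is below its sum; using both signs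
  removes the absolute value from the exponent.\<close>

lemma abs_power_le_exp: "\<bar>x\<bar> ^ q \<le> fact q * (exp x + exp (- x :: real))"
proof -
  have "\<bar>x\<bar> ^ q /\<^sub>R fact q \<le> (\<Sum>k<Suc q. \<bar>x\<bar> ^ k /\<^sub>R fact k)"
    by (simp add: sum_nonneg)
  also have "\<dots> \<le> (\<Sum>k. \<bar>x\<bar> ^ k /\<^sub>R fact k)"
    by (intro sum_le_suminf summable_exp_generic) auto
  also have "\<dots> = exp \<bar>x\<bar>" by (simp add: exp_def)
  also have "\<dots> \<le> exp x + exp (- x)" by (auto simp: abs_if)
  finally show ?thesis by (simp add: field_simps)
qed

text \<open>Scaling by 1 / sqrt v reduces to variance at most one, where the exponential moments at
  both signs are at most e^(1/2).\<close>

lemma Lq_step_integral: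
  assumes M: "prob_space M" and W: "two_sided_wiener M W" and "step_ok l"
    and v: "(\<integral>\<^sup>+s. ennreal ((step_fun l s)\<^sup>2) \<partial>lborel) \<le> ennreal v" and "0 < v" and q: "q \<ge> 1"
  shows "Lq M q (step_integral W l) (gauss_const q * sqrt v)"
proof -
  let ?S = "step_integral W l" and ?r = "1 / sqrt v"
  have [measurable]: "?S \<in> borel_measurable M" by (rule step_integral_measurable[OF W])
  have m: "(\<integral>\<^sup>+\<omega>. ennreal (exp (x * ?S \<omega>)) \<partial>M) \<le> ennreal (exp (1/2))" if "x\<^sup>2 * v = 1" for x
    using step_integral_mgf[OF M W assms(3) v, of x] \<open>0 < v\<close> that by simp
  have "(\<integral>\<^sup>+\<omega>. ennreal (\<bar>?S \<omega>\<bar> ^ q) \<partial>M) \<le> (\<integral>\<^sup>+\<omega>. ennreal (sqrt v ^ q * fact q) *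
     (ennreal (exp (?r * ?S \<omega>)) + ennreal (exp (- ?r * ?S \<omega>))) \<partial>M)"
  proof (intro nn_integral_mono)
    fix \<omega>
    have "\<bar>?S \<omega>\<bar> ^ q = sqrt v ^ q * \<bar>?r * ?S \<omega>\<bar> ^ q"
      using \<open>0 < v\<close> by (simp flip: power_mult_distrib add: abs_mult)
    also have "\<dots> \<le> sqrt v ^ q * (fact q * (exp (?r * ?S \<omega>) + exp (- (?r * ?S \<omega>))))"
      using \<open>0 < v\<close> by (intro mult_left_mono abs_power_le_exp) auto
    finally show "ennreal (\<bar>?S \<omega>\<bar> ^ q) \<le> ennreal (sqrt v ^ q * fact q) *
     (ennreal (exp (?r * ?S \<omega>)) + ennreal (exp (- ?r * ?S \<omega>)))"
      using \<open>0 < v\<close> by (simp flip: ennreal_mult' ennreal_plus add: ennreal_leI mult.assoc)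
  qed
  also have "\<dots> = ennreal (sqrt v ^ q * fact q) *
     ((\<integral>\<^sup>+\<omega>. ennreal (exp (?r * ?S \<omega>)) \<partial>M) + (\<integral>\<^sup>+\<omega>. ennreal (exp (- ?r * ?S \<omega>)) \<partial>M))"
    by (simp add: nn_integral_cmult nn_integral_add)
  also have "\<dots> \<le> ennreal (sqrt v ^ q * fact q) * (ennreal (exp (1/2)) + ennreal (exp (1/2)))"
    using \<open>0 < v\<close> by (intro mult_left_mono add_mono m) (auto simp: power_divide)
  also have "\<dots> = ennreal (sqrt v ^ q * gauss_const q)"
    using \<open>0 < v\<close> by (simp flip: ennreal_mult' ennreal_plus add: gauss_const_def algebra_simps)
  \<comment> \<open>\<open>Lq\<close> raises its bound to the power q; as
    \<open>gauss_const q\<close> is at least 1, it may be replaced by its q-th power.\<close>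
  also have "\<dots> \<le> ennreal (sqrt v ^ q * gauss_const q ^ q)"
    using \<open>0 < v\<close> gauss_const_ge_1[of q] q self_le_power[of "gauss_const q" q]
    by (intro ennreal_leI mult_left_mono) auto
  finally show ?thesis using gauss_const_ge_1[of q] \<open>0 < v\<close> by (auto simp: Lq_def power_mult_distrib mult.commute)
qed

text \<open>Fatou's lemma: moment bounds pass to almost sure limits.\<close>

lemma Lq_tendsto_AE:
  assumes "\<And>n. Lq M q (S n) c" "AE \<omega> in M. (\<lambda>n. S n \<omega>) \<longlonglongrightarrow> Y \<omega>" "Y \<in> borel_measurable M"
  shows "Lq M q Y c"
proof -
  have [measurable]: "S n \<in> borel_measurable M" for n using assms(1) by (auto simp: Lq_def)
  have [measurable]: "Y \<in> borel_measurable M" by fact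
  have "(\<integral>\<^sup>+\<omega>. ennreal (\<bar>Y \<omega>\<bar> ^ q) \<partial>M) = (\<integral>\<^sup>+\<omega>. liminf (\<lambda>n. ennreal (\<bar>S n \<omega>\<bar> ^ q)) \<partial>M)"
  proof (intro nn_integral_cong_AE)
    show "AE \<omega> in M. ennreal (\<bar>Y \<omega>\<bar> ^ q) = liminf (\<lambda>n. ennreal (\<bar>S n \<omega>\<bar> ^ q))"
      using assms(2)
    proof eventually_elim
      case (elim \<omega>)
      then have "(\<lambda>n. ennreal (\<bar>S n \<omega>\<bar> ^ q)) \<longlonglongrightarrow> ennreal (\<bar>Y \<omega>\<bar> ^ q)"
        by (intro tendsto_intros) auto
      then show ?case by (intro lim_imp_Liminf[symmetric]) auto
    qed
  qed
  also have "\<dots> \<le> liminf (\<lambda>n. \<integral>\<^sup>+\<omega>. ennreal (\<bar>S n \<omega>\<bar> ^ q) \<partial>M)"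
    by (intro nn_integral_liminf) auto
  also have "\<dots> \<le> liminf (\<lambda>n. ennreal (c ^ q))"
    using assms(1) by (intro Liminf_mono) (auto simp: Lq_def)
  also have "\<dots> = ennreal (c ^ q)" by (simp add: Liminf_const)
  finally show ?thesis using assms(1)[of 0] by (simp add: Lq_def)
qed

text \<open>The first N squares may have infinite integral and are dropped; the others are
  integrable and tend to 0 in L1, hence almost everywhere along a subsequence.\<close>

lemma nn_integral_tendsto_0_AE_subseq:
  fixes u :: "nat \<Rightarrow> 'a \<Rightarrow> real"
  assumes [measurable]: "\<And>n. u n \<in> borel_measurable M"
    and lim: "(\<lambda>n. \<integral>\<^sup>+x. ennreal ((u n x)\<^sup>2) \<partial>M) \<longlonglongrightarrow> 0"
  shows "\<exists>r::nat\<Rightarrow>nat. strict_mono r \<and> (AE x in M. (\<lambda>n. u (r n) x) \<longlonglongrightarrow> 0)"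
proof -
  have "eventually (\<lambda>n. (\<integral>\<^sup>+x. ennreal ((u n x)\<^sup>2) \<partial>M) < 1) sequentially"
    using lim by (intro order_tendstoD(2)) auto
  then obtain N where N: "\<And>n. n \<ge> N \<Longrightarrow> (\<integral>\<^sup>+x. ennreal ((u n x)\<^sup>2) \<partial>M) < 1"
    by (auto simp: eventually_sequentially)
  define w where "w n x = (u (n + N) x)\<^sup>2" for n x
  have int: "integrable M (w n)" for n
    unfolding w_def using N[of "n + N"] by (intro integrableI_nonneg) (auto intro: less_trans)
  have eq: "ennreal (\<integral>x. norm (w n x) \<partial>M) = (\<integral>\<^sup>+x. ennreal ((u (n+N) x)\<^sup>2) \<partial>M)" for n
    using nn_integral_eq_integral[OF int[of n]] by (simp add: w_def[abs_def])
  have "(\<lambda>n. ennreal (\<integral>x. norm (w n x) \<partial>M)) \<longlonglongrightarrow> ennreal 0"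
    unfolding eq using LIMSEQ_ignore_initial_segment[OF lim, of N] by simp
  then have "(\<lambda>n. (\<integral>x. norm (w n x) \<partial>M)) \<longlonglongrightarrow> 0"
    by (subst (asm) tendsto_ennreal_iff) auto
  from tendsto_L1_AE_subseq[OF int this] obtain r :: "nat \<Rightarrow> nat" where
    r: "strict_mono r" "AE x in M. (\<lambda>n. w (r n) x) \<longlonglongrightarrow> 0" by auto
  have "AE x in M. (\<lambda>n. u (r n + N) x) \<longlonglongrightarrow> 0"
    using r(2)
  proof eventually_elim
    case (elim x)
    then have "(\<lambda>n. sqrt (w (r n) x)) \<longlonglongrightarrow> sqrt 0" by (rule tendsto_real_sqrt)
    then show ?case by (simp add: w_def tendsto_rabs_zero_iff)
  qed
  moreover have "strict_mono (\<lambda>n. r n + N)" using r(1) by (simp add: strict_mono_def)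
  ultimately show ?thesis by blast
qed

section \<open>From step functions to general integrands\<close>

lemma sq_add_le: "((x::real) + y)\<^sup>2 \<le> 2 * x\<^sup>2 + 2 * y\<^sup>2"
  using sum_squares_bound[of x y] by (simp add: power2_sum)

lemma step_fun_measurable [measurable]: "step_fun l \<in> borel_measurable borel"
proof -
  have "(\<lambda>s. \<Sum>(c, u, v)\<leftarrow>l. c * indicator {u<..v} s) \<in> borel_measurable (borel :: real measure)"
    by (induction l) auto
  then show ?thesis by (simp add: step_fun_def[abs_def])
qed

text \<open>The approximating step functions eventually have squared norm at most 2 v + 2 v = 4 v,
  which explains the factor 2 next to sqrt v; an almost surely convergent subsequence of their
  integrals and Fatou's lemma transfer the bound to Y.\<close>

lemma Lq_wiener_integral:
  assumes M: "prob_space M" and W: "two_sided_wiener M W" and Y: "has_wiener_integral M W f Y"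
    and v: "(\<integral>\<^sup>+s. ennreal ((f s)\<^sup>2) \<partial>lborel) \<le> ennreal v" and "0 < v" and q: "q \<ge> 1"
  shows "Lq M q Y (2 * gauss_const q * sqrt v)"
proof -
  from Y obtain l :: "nat \<Rightarrow> step_list" where l: "\<And>k. step_ok (l k)"
    and lf: "(\<lambda>k. \<integral>\<^sup>+s. ennreal ((step_fun (l k) s - f s)\<^sup>2) \<partial>lborel) \<longlonglongrightarrow> 0"
    and lY: "(\<lambda>k. \<integral>\<^sup>+\<omega>. ennreal ((step_integral W (l k) \<omega> - Y \<omega>)\<^sup>2) \<partial>M) \<longlonglongrightarrow> 0"
    and [measurable]: "f \<in> borel_measurable borel" "Y \<in> borel_measurable M"
    by (auto simp: has_wiener_integral_def)
  note [measurable] = step_integral_measurable[OF W]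
  from nn_integral_tendsto_0_AE_subseq[OF _ lY] obtain r :: "nat \<Rightarrow> nat" where r: "strict_mono r"
    "AE \<omega> in M. (\<lambda>n. step_integral W (l (r n)) \<omega> - Y \<omega>) \<longlonglongrightarrow> 0" by auto
  have "eventually (\<lambda>k. (\<integral>\<^sup>+s. ennreal ((step_fun (l k) s - f s)\<^sup>2) \<partial>lborel) < ennreal v) sequentially"
    using lf \<open>0 < v\<close> by (intro order_tendstoD(2)) auto
  then obtain N where N: "\<And>k. k \<ge> N \<Longrightarrow> (\<integral>\<^sup>+s. ennreal ((step_fun (l k) s - f s)\<^sup>2) \<partial>lborel) < ennreal v"
    by (auto simp: eventually_sequentially)
  show ?thesis
  proof (rule Lq_tendsto_AE)
    fix n
    let ?k = "r (n + N)"
    \<comment> \<open>A strictly increasing r satisfies r m \<ge> m, so the shift by N places every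
      chosen index in the range where the approximation error is below v.\<close>
    have "?k \<ge> N" using seq_suble[OF r(1), of "n + N"] by simp
    have "(\<integral>\<^sup>+s. ennreal ((step_fun (l ?k) s)\<^sup>2) \<partial>lborel)
      \<le> (\<integral>\<^sup>+s. 2 * ennreal ((step_fun (l ?k) s - f s)\<^sup>2) + 2 * ennreal ((f s)\<^sup>2) \<partial>lborel)"
    proof (intro nn_integral_mono)
      fix s
      have "ennreal ((step_fun (l ?k) s)\<^sup>2) \<le> ennreal (2 * (step_fun (l ?k) s - f s)\<^sup>2 + 2 * (f s)\<^sup>2)"
        using sq_add_le[of "step_fun (l ?k) s - f s" "f s"] by (intro ennreal_leI) simp
      then show "ennreal ((step_fun (l ?k) s)\<^sup>2) \<le> 2 * ennreal ((step_fun (l ?k) s - f s)\<^sup>2) + 2 * ennreal ((f s)\<^sup>2)"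
        by (simp add: ennreal_mult')
    qed
    also have "\<dots> = 2 * (\<integral>\<^sup>+s. ennreal ((step_fun (l ?k) s - f s)\<^sup>2) \<partial>lborel) + 2 * (\<integral>\<^sup>+s. ennreal ((f s)\<^sup>2) \<partial>lborel)"
      by (simp add: nn_integral_add nn_integral_cmult)
    also have "\<dots> \<le> 2 * ennreal v + 2 * ennreal v"
      using N[OF \<open>?k \<ge> N\<close>] v by (intro add_mono mult_left_mono) auto
    also have "\<dots> = ennreal (4 * v)"
      using \<open>0 < v\<close> by (simp add: ennreal_mult' flip: distrib_right)
    finally have "Lq M q (step_integral W (l ?k)) (gauss_const q * sqrt (4 * v))"
      using \<open>0 < v\<close> by (intro Lq_step_integral M W l q) auto
    then show "Lq M q (step_integral W (l (r (n + N)))) (2 * gauss_const q * sqrt v)"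
      by (simp add: real_sqrt_mult mult_ac)
  next
    show "AE \<omega> in M. (\<lambda>n. step_integral W (l (r (n + N))) \<omega>) \<longlonglongrightarrow> Y \<omega>"
      using r(2)
    proof eventually_elim
      case (elim \<omega>)
      then have "(\<lambda>n. step_integral W (l (r n)) \<omega>) \<longlonglongrightarrow> Y \<omega>" by (simp add: LIM_zero_iff)
      then show ?case by (rule LIMSEQ_ignore_initial_segment)
    qed
  qed simp
qed

text \<open>Step lists may overlap, so concatenating one list with the scaled other one represents
  the linear combination. The cases a = 1, -1, -2 produce sums, increments and second
  differences.\<close>

lemma has_wiener_integral_add_scaled:
  assumes W: "two_sided_wiener M W"
    and Y: "has_wiener_integral M W f Y" and Z: "has_wiener_integral M W g Z"
  shows "has_wiener_integral M W (\<lambda>s. f s + a * g s) (\<lambda>\<omega>. Y \<omega> + a * Z \<omega>)"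
proof -
  note [measurable] = step_integral_measurable[OF W]
  from Y obtain l :: "nat \<Rightarrow> step_list" where l: "\<And>k. step_ok (l k)"
    and lf: "(\<lambda>k. \<integral>\<^sup>+s. ennreal ((step_fun (l k) s - f s)\<^sup>2) \<partial>lborel) \<longlonglongrightarrow> 0"
    and lY: "(\<lambda>k. \<integral>\<^sup>+\<omega>. ennreal ((step_integral W (l k) \<omega> - Y \<omega>)\<^sup>2) \<partial>M) \<longlonglongrightarrow> 0"
    and [measurable]: "f \<in> borel_measurable borel" "Y \<in> borel_measurable M"
    by (auto simp: has_wiener_integral_def)
  from Z obtain l' :: "nat \<Rightarrow> step_list" where l': "\<And>k. step_ok (l' k)"
    and lf': "(\<lambda>k. \<integral>\<^sup>+s. ennreal ((step_fun (l' k) s - g s)\<^sup>2) \<partial>lborel) \<longlonglongrightarrow> 0"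
    and lY': "(\<lambda>k. \<integral>\<^sup>+\<omega>. ennreal ((step_integral W (l' k) \<omega> - Z \<omega>)\<^sup>2) \<partial>M) \<longlonglongrightarrow> 0"
    and [measurable]: "g \<in> borel_measurable borel" "Z \<in> borel_measurable M"
    by (auto simp: has_wiener_integral_def)
  define L where "L k = l k @ map (\<lambda>(c, u, v). (a * c, u, v)) (l' k)" for k
  have "step_fun (map (\<lambda>(c, u, v). (a * c, u, v)) l) s = a * step_fun l s" for l s
    by (induction l) (auto simp: step_fun_def algebra_simps)
  then have sf: "step_fun (L k) s = step_fun (l k) s + a * step_fun (l' k) s" for k s
    by (simp add: L_def step_fun_def)
  have "step_integral W (map (\<lambda>(c, u, v). (a * c, u, v)) l) s = a * step_integral W l s" for l s
    by (induction l) (auto simp: step_integral_def algebra_simps)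
  then have si: "step_integral W (L k) s = step_integral W (l k) s + a * step_integral W (l' k) s" for k s
    by (simp add: L_def step_integral_def)
  have sq: "ennreal ((x + a * y)\<^sup>2) \<le> ennreal 2 * ennreal (x\<^sup>2) + ennreal (2 * a\<^sup>2) * ennreal (y\<^sup>2)" for x y
  proof -
    have "ennreal ((x + a * y)\<^sup>2) \<le> ennreal (2 * x\<^sup>2 + 2 * a\<^sup>2 * y\<^sup>2)"
      using sq_add_le[of x "a * y"] by (intro ennreal_leI) (simp add: power_mult_distrib mult.assoc)
    also have "\<dots> = ennreal 2 * ennreal (x\<^sup>2) + ennreal (2 * a\<^sup>2) * ennreal (y\<^sup>2)"
      by (subst ennreal_plus) (auto simp del: ennreal_plus simp: ennreal_mult simp flip: ennreal_mult')
    finally show ?thesis .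
  qed
  have lim: "(\<lambda>k. \<integral>\<^sup>+s. ennreal ((u k s + a * w k s)\<^sup>2) \<partial>N) \<longlonglongrightarrow> 0"
    if [measurable]: "\<And>k. u k \<in> borel_measurable N" "\<And>k. w k \<in> borel_measurable N"
      and "(\<lambda>k. \<integral>\<^sup>+s. ennreal ((u k s)\<^sup>2) \<partial>N) \<longlonglongrightarrow> 0" "(\<lambda>k. \<integral>\<^sup>+s. ennreal ((w k s)\<^sup>2) \<partial>N) \<longlonglongrightarrow> 0"
    for u w :: "nat \<Rightarrow> 'x \<Rightarrow> real" and N
  proof (rule tendsto_sandwich[OF _ _ tendsto_const])
    have "(\<integral>\<^sup>+s. ennreal ((u k s + a * w k s)\<^sup>2) \<partial>N) \<le> ennreal 2 * (\<integral>\<^sup>+s. ennreal ((u k s)\<^sup>2) \<partial>N) + ennreal (2 * a\<^sup>2) * (\<integral>\<^sup>+s. ennreal ((w k s)\<^sup>2) \<partial>N)" for k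
      by (subst (1 2) nn_integral_cmult[symmetric], measurable, subst nn_integral_add[symmetric], measurable)
        (intro nn_integral_mono sq)
    then show "eventually (\<lambda>k. (\<integral>\<^sup>+s. ennreal ((u k s + a * w k s)\<^sup>2) \<partial>N) \<le> ennreal 2 * (\<integral>\<^sup>+s. ennreal ((u k s)\<^sup>2) \<partial>N) + ennreal (2 * a\<^sup>2) * (\<integral>\<^sup>+s. ennreal ((w k s)\<^sup>2) \<partial>N)) sequentially"
      by (intro always_eventually) auto
    have "(\<lambda>k. ennreal 2 * (\<integral>\<^sup>+s. ennreal ((u k s)\<^sup>2) \<partial>N) + ennreal (2 * a\<^sup>2) * (\<integral>\<^sup>+s. ennreal ((w k s)\<^sup>2) \<partial>N)) \<longlonglongrightarrow> ennreal 2 * 0 + ennreal (2 * a\<^sup>2) * 0"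
      by (intro tendsto_add ennreal_tendsto_cmult that) auto
    then show "(\<lambda>k. ennreal 2 * (\<integral>\<^sup>+s. ennreal ((u k s)\<^sup>2) \<partial>N) + ennreal (2 * a\<^sup>2) * (\<integral>\<^sup>+s. ennreal ((w k s)\<^sup>2) \<partial>N)) \<longlonglongrightarrow> 0"
      by simp
  qed auto
  have "step_ok (L k)" for k
    using l[of k] l'[of k] by (auto simp: L_def step_ok_def)
  moreover have "(\<lambda>k. \<integral>\<^sup>+s. ennreal ((step_fun (L k) s - (f s + a * g s))\<^sup>2) \<partial>lborel) \<longlonglongrightarrow> 0"
    using lim[of "\<lambda>k s. step_fun (l k) s - f s" lborel "\<lambda>k s. step_fun (l' k) s - g s"] lf lf'
    by (simp add: sf algebra_simps)
  moreover have "(\<lambda>k. \<integral>\<^sup>+s. ennreal ((step_integral W (L k) s - (Y s + a * Z s))\<^sup>2) \<partial>M) \<longlonglongrightarrow> 0"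
    using lim[of "\<lambda>k s. step_integral W (l k) s - Y s" M "\<lambda>k s. step_integral W (l' k) s - Z s"] lY lY'
    by (simp add: si algebra_simps)
  ultimately show ?thesis unfolding has_wiener_integral_def by auto
qed

section \<open>Fractional Brownian increments\<close>

abbreviation incr2 :: "(real \<Rightarrow> 'a \<Rightarrow> real) \<Rightarrow> real \<Rightarrow> real \<Rightarrow> 'a \<Rightarrow> real" where
  "incr2 Z t w \<omega> \<equiv> Z (t + w) \<omega> + Z (t - w) \<omega> - 2 * Z t \<omega>"

text \<open>Write z^a = z z^(a-1); since a \<le> 1, the factor z^(a-1) is decreasing.\<close>

lemma powr_add_subadditive:
  fixes x y :: real assumes "0 \<le> x" "0 \<le> y" "0 < a" "a \<le> 1"
  shows "(x + y) powr a \<le> x powr a + y powr a"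
proof (cases "x = 0 \<or> y = 0")
  case False
  then have p: "0 < x" "0 < y" using assms by auto
  have e: "z powr a = z * z powr (a - 1)" if "0 < z" for z :: real
    using that by (simp add: powr_diff)
  have "x * (x + y) powr (a - 1) \<le> x * x powr (a - 1)" "y * (x + y) powr (a - 1) \<le> y * y powr (a - 1)"
    using p assms by (auto intro!: mult_left_mono powr_mono2' simp del: mult_le_cancel_left_pos)
  moreover have "(x + y) powr a = x * (x + y) powr (a - 1) + y * (x + y) powr (a - 1)"
    using p e[of "x + y"] by (simp add: distrib_right)
  ultimately show ?thesis using p e[of x] e[of y] by linarith
qed auto

text \<open>A cruder form of the concave tangent bound, with slope x^(a-1) in place of a x^(a-1); it
  supplies the decay of the kernel at infinity.\<close>

lemma powr_add_le_tangent:
  fixes x y :: real assumes "0 < x" "0 \<le> y" "0 < a" "a \<le> 1"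
  shows "(x + y) powr a \<le> x powr a + y * x powr (a - 1)"
proof -
  have e: "z powr a = z * z powr (a - 1)" if "0 < z" for z :: real
    using that by (simp add: powr_diff)
  have "(x + y) * (x + y) powr (a - 1) \<le> (x + y) * x powr (a - 1)"
    using assms by (auto intro!: mult_left_mono powr_mono2')
  then show ?thesis using assms e[of x] e[of "x + y"] by (simp add: distrib_right)
qed

section \<open>Kernels of first and second increments\<close>

lemma pos_powr_mono: "x \<le> y \<Longrightarrow> 0 < a \<Longrightarrow> pos_powr x a \<le> pos_powr y a"
  by (auto simp: pos_powr_def intro: powr_mono2)

lemma pos_powr_measurable [measurable (raw)]:
  assumes "f \<in> borel_measurable M"
  shows "(\<lambda>x. pos_powr (f x) a) \<in> borel_measurable M"
proof -
  have "(\<lambda>x. pos_powr x a) \<in> borel_measurable borel"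
    unfolding pos_powr_def by measurable
  from measurable_compose[OF assms this] show ?thesis .
qed

text \<open>For a = H - 1/2 and x = s - u this is the Wiener kernel, at u, of the increment of
  \<open>B\<close> from s to s + w: the term that normalises \<open>B\<close> at time 0
  cancels.\<close>

definition frac_incr :: "real \<Rightarrow> real \<Rightarrow> real \<Rightarrow> real" where
  "frac_incr a w x = pos_powr (x + w) a - pos_powr x a"

definition frac_incr2 :: "real \<Rightarrow> real \<Rightarrow> real \<Rightarrow> real" where
  "frac_incr2 a w x = pos_powr (x + w) a + pos_powr (x - w) a - 2 * pos_powr x a"

lemma frac_incr_measurable [measurable]: "frac_incr a w \<in> borel_measurable borel"
  unfolding frac_incr_def[abs_def] by measurable

lemma frac_incr2_measurable [measurable]: "frac_incr2 a w \<in> borel_measurable borel"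
  unfolding frac_incr2_def[abs_def] by measurable

lemma frac_incr2_eq: "frac_incr2 a w x = frac_incr a w x - frac_incr a w (x - w)"
  by (simp add: frac_incr_def frac_incr2_def)

context
  fixes a w :: real
  assumes a: "0 < a" "a \<le> 1" and w: "0 < w"
begin

lemma frac_incr_nonneg: "0 \<le> frac_incr a w x"
  using pos_powr_mono[of x "x + w" a] a w by (simp add: frac_incr_def)

lemma frac_incr_le: "frac_incr a w x \<le> w powr a"
proof (cases "0 < x")
  case True
  then show ?thesis using powr_add_subadditive[of x w a] a w by (simp add: frac_incr_def pos_powr_def)
next
  case False
  then show ?thesis using a w by (auto simp: frac_incr_def pos_powr_def intro: powr_mono2)
qed

lemma frac_incr_eq_0: "x \<le> - w \<Longrightarrow> frac_incr a w x = 0"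
  using w by (simp add: frac_incr_def pos_powr_def)

text \<open>For x > 0 the derivative of the difference is nonpositive. The point 0, where the power
  is not differentiable, is treated separately: there the increment equals its maximum w^a.\<close>

lemma frac_incr_antimono:
  assumes "0 \<le> x" "x \<le> y" shows "frac_incr a w y \<le> frac_incr a w x"
proof (cases "x = 0")
  case True
  then show ?thesis using frac_incr_le[of y] w by (simp add: frac_incr_def pos_powr_def)
next
  case False
  have "(y + w) powr a - y powr a \<le> (x + w) powr a - x powr a"
  proof (rule DERIV_nonpos_imp_nonincreasing[of x y "\<lambda>z. (z + w) powr a - z powr a"])
    fix z assume z: "x \<le> z" "z \<le> y"
    with False assms have "0 < z" by auto
    have "((\<lambda>z. (z + w) powr a - z powr a) has_real_derivative a * (z + w) powr (a - 1) - a * z powr (a - 1)) (at z)"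
      using \<open>0 < z\<close> w by (auto intro!: derivative_eq_intros)
    moreover have "a * (z + w) powr (a - 1) - a * z powr (a - 1) \<le> 0"
      using \<open>0 < z\<close> w a by (auto intro!: mult_left_mono powr_mono2')
    ultimately show "\<exists>d. ((\<lambda>z. (z + w) powr a - z powr a) has_real_derivative d) (at z) \<and> d \<le> 0" by blast
  qed fact
  then show ?thesis using False assms w by (simp add: frac_incr_def pos_powr_def)
qed

text \<open>A bounded monotone function whose increments of length \<open>w\<close> dominate \<open>\<bar>frac_incr2 a w\<bar>\<close>, so that both the
  sums along a grid of mesh at least \<open>w\<close> and the integral telescope.\<close>

definition frac_var :: "real \<Rightarrow> real" where
  "frac_var x = (if x \<le> - w then 0 else if x < 0 then w powr a else 3 * w powr a - frac_incr a w x)"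

lemma frac_var_measurable [measurable]: "frac_var \<in> borel_measurable borel"
  unfolding frac_var_def[abs_def] by measurable

lemma frac_var_nonneg: "0 \<le> frac_var x" and frac_var_le: "frac_var x \<le> 3 * w powr a"
  using frac_incr_nonneg[of x] frac_incr_le[of x] by (auto simp: frac_var_def)

lemma frac_var_mono: assumes "x \<le> y" shows "frac_var x \<le> frac_var y"
  using assms frac_incr_antimono[of x y] frac_incr_le[of y] frac_incr_nonneg[of y] w by (auto simp: frac_var_def)

text \<open>Beyond w the second difference equals minus the increment of \<open>frac_var\<close>. On
  each of the intervals (-w, 0) and [0, w) only the bound w^a is available, and there
  \<open>frac_var\<close> gains at least w^a over its value w earlier; this is why its plateaus are
  0, w^a and, from 0 on, at least 2 w^a, with upper bound 3 w^a.\<close>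

lemma frac_incr2_le_var: "\<bar>frac_incr2 a w x\<bar> \<le> frac_var x - frac_var (x - w)"
proof -
  have b: "\<bar>frac_incr2 a w x\<bar> \<le> w powr a"
    using frac_incr_nonneg[of x] frac_incr_le[of x] frac_incr_nonneg[of "x - w"] frac_incr_le[of "x - w"]
    by (auto simp: frac_incr2_eq)
  consider "x \<le> - w" | "- w < x" "x < 0" | "0 \<le> x" "x < w" | "w \<le> x" by linarith
  then show ?thesis
  proof cases
    case 1 then show ?thesis using w by (auto simp: frac_incr2_eq frac_incr_eq_0 frac_var_def)
  next
    case 2 then show ?thesis using b by (auto simp: frac_var_def)
  next
    case 3 then show ?thesis using b frac_incr_le[of x] w by (auto simp: frac_var_def)
  next
    case 4 then show ?thesis using frac_incr_antimono[of "x - w" x] w by (auto simp: frac_var_def frac_incr2_eq)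
  qed
qed

text \<open>Since w \<le> D, monotonicity lets the increment of \<open>frac_var\<close> over length
  w be enlarged to one over length D, and those telescope along the grid. The bound depends neither
  on the number of terms nor on s.\<close>

lemma sum_abs_frac_incr2_le:
  assumes "w \<le> D"
  shows "(\<Sum>i\<in>{l..<m}. \<bar>frac_incr2 a w (real i * D - s)\<bar>) \<le> 3 * w powr a"
proof (cases "l \<le> m")
  case True
  have "(\<Sum>i\<in>{l..<m}. \<bar>frac_incr2 a w (real i * D - s)\<bar>)
    \<le> (\<Sum>i\<in>{l..<m}. frac_var (real (Suc i) * D - (s + D)) - frac_var (real i * D - (s + D)))"
  proof (intro sum_mono)
    fix i
    have "frac_var (real i * D - (s + D)) \<le> frac_var (real i * D - s - w)"
      using assms by (intro frac_var_mono) auto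
    then show "\<bar>frac_incr2 a w (real i * D - s)\<bar> \<le> frac_var (real (Suc i) * D - (s + D)) - frac_var (real i * D - (s + D))"
      using frac_incr2_le_var[of "real i * D - s"] by (simp add: algebra_simps)
  qed
  also have "\<dots> = frac_var (real m * D - (s + D)) - frac_var (real l * D - (s + D))"
    using True by (rule sum_Suc_diff')
  also have "\<dots> \<le> 3 * w powr a"
    using frac_var_nonneg[of "real l * D - (s + D)"] frac_var_le[of "real m * D - (s + D)"] by linarith
  finally show ?thesis .
qed simp

text \<open>The integral of an increment of length w telescopes to the integral over one window of
  length w, where \<open>frac_var\<close> is at most 3 w^a. As \<open>frac_var\<close> stays
  positive at infinity, this is done on a half-line up to A, and then A tends to infinity by Fatou's
  lemma.\<close>

lemma nn_integral_abs_frac_incr2_le: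
  "(\<integral>\<^sup>+x. ennreal \<bar>frac_incr2 a w x\<bar> \<partial>lborel) \<le> ennreal (3 * w powr (a + 1))"
proof -
  have cut: "(\<integral>\<^sup>+x. ennreal \<bar>frac_incr2 a w x\<bar> * indicator {..A} x \<partial>lborel) \<le> ennreal (3 * w powr (a + 1))" for A
  proof -
    let ?I = "\<integral>\<^sup>+x. ennreal \<bar>frac_incr2 a w x\<bar> * indicator {..A} x \<partial>lborel"
    let ?J = "\<integral>\<^sup>+x. ennreal (frac_var x) * indicator {..A - w} x \<partial>lborel"
    have shift: "(\<integral>\<^sup>+x. ennreal (frac_var (x - w)) * indicator {..A} x \<partial>lborel) = ?J"
      by (subst nn_integral_real_affine[where t="w" and c=1])
        (auto simp: indicator_def intro!: nn_integral_cong)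
    \<comment> \<open>Finiteness on the truncated range, which starts effectively at -w, is what
      permits the cancellation of ?J in the extended reals.\<close>
    have fin: "?J < \<infinity>"
    proof -
      have "?J \<le> (\<integral>\<^sup>+x. ennreal (3 * w powr a) * indicator {-w..A - w} x \<partial>lborel)"
        using frac_incr_nonneg by (intro nn_integral_mono) (auto simp: indicator_def frac_var_def intro!: ennreal_leI)
      also have "\<dots> < \<infinity>" by (cases "0 \<le> A") (auto simp: nn_integral_cmult_indicator ennreal_mult_less_top)
      finally show ?thesis .
    qed
    have "?I + ?J = (\<integral>\<^sup>+x. ennreal (\<bar>frac_incr2 a w x\<bar> + frac_var (x - w)) * indicator {..A} x \<partial>lborel)"
      unfolding shift[symmetric] using frac_var_nonneg
      by (subst nn_integral_add[symmetric]) (auto simp: distrib_right)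
    also have "\<dots> \<le> (\<integral>\<^sup>+x. ennreal (frac_var x) * indicator {..A} x \<partial>lborel)"
      using frac_incr2_le_var by (intro nn_integral_mono mult_right_mono ennreal_leI) (auto simp: algebra_simps)
    also have "\<dots> \<le> (\<integral>\<^sup>+x. ennreal (frac_var x) * indicator {..A - w} x + ennreal (3 * w powr a) * indicator {A-w..A} x \<partial>lborel)"
      using frac_var_le by (intro nn_integral_mono) (auto simp: indicator_def intro!: ennreal_leI)
    also have "\<dots> = ?J + ennreal (3 * w powr a) * ennreal w"
      using w by (subst nn_integral_add) (auto simp: nn_integral_cmult_indicator)
    also have "ennreal (3 * w powr a) * ennreal w = ennreal (3 * w powr (a + 1))"
      using w by (simp add: powr_add flip: ennreal_mult')
    finally have "?J + ?I \<le> ?J + ennreal (3 * w powr (a + 1))" by (simp add: add.commute)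
    then show ?thesis using fin by (auto simp: ennreal_add_left_cancel_le)
  qed
  have "(\<integral>\<^sup>+x. ennreal \<bar>frac_incr2 a w x\<bar> \<partial>lborel)
     = (\<integral>\<^sup>+x. liminf (\<lambda>n. ennreal \<bar>frac_incr2 a w x\<bar> * indicator {..real n} x) \<partial>lborel)"
  proof (intro nn_integral_cong)
    fix x :: real
    have "eventually (\<lambda>n. ennreal \<bar>frac_incr2 a w x\<bar> * indicator {..real n} x = ennreal \<bar>frac_incr2 a w x\<bar>) sequentially"
      using eventually_ge_at_top[of "nat \<lceil>x\<rceil>"] by eventually_elim (auto simp: indicator_def nat_le_iff ceiling_le_iff)
    then have "(\<lambda>n. ennreal \<bar>frac_incr2 a w x\<bar> * indicator {..real n} x) \<longlonglongrightarrow> ennreal \<bar>frac_incr2 a w x\<bar>"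
      by (rule tendsto_eventually)
    then show "ennreal \<bar>frac_incr2 a w x\<bar> = liminf (\<lambda>n. ennreal \<bar>frac_incr2 a w x\<bar> * indicator {..real n} x)"
      by (intro lim_imp_Liminf[symmetric]) auto
  qed
  also have "\<dots> \<le> liminf (\<lambda>n. \<integral>\<^sup>+x. ennreal \<bar>frac_incr2 a w x\<bar> * indicator {..real n} x \<partial>lborel)"
    by (intro nn_integral_liminf) auto
  also have "\<dots> \<le> liminf (\<lambda>n. ennreal (3 * w powr (a + 1)))"
    using cut by (intro Liminf_mono) auto
  also have "\<dots> = ennreal (3 * w powr (a + 1))" by (simp add: Liminf_const)
  finally show ?thesis .
qed

text \<open>The origin of the square root in the noise estimate: the square of the summed kernel is
  at most its uniform bound 3 w^a times the sum of absolute values, and each of these integrates to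
  at most 3 w^(a+1). Hence the growth in the number of terms is linear instead of quadratic.\<close>

lemma nn_integral_sum_frac_incr2_sq_le:
  assumes "w \<le> D"
  shows "(\<integral>\<^sup>+s. ennreal ((\<Sum>i\<in>{l..<m}. frac_incr2 a w (real i * D - s))\<^sup>2) \<partial>lborel)
    \<le> ennreal (9 * real (m - l) * w powr (2 * a + 1))"
proof -
  have "(\<integral>\<^sup>+s. ennreal ((\<Sum>i\<in>{l..<m}. frac_incr2 a w (real i * D - s))\<^sup>2) \<partial>lborel)
    \<le> (\<integral>\<^sup>+s. ennreal (3 * w powr a) * (\<Sum>i\<in>{l..<m}. ennreal \<bar>frac_incr2 a w (real i * D - s)\<bar>) \<partial>lborel)"
  proof (intro nn_integral_mono)
    fix s
    let ?S = "\<Sum>i\<in>{l..<m}. \<bar>frac_incr2 a w (real i * D - s)\<bar>"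
    have "(\<Sum>i\<in>{l..<m}. frac_incr2 a w (real i * D - s))\<^sup>2 \<le> ?S\<^sup>2"
      by (intro abs_le_square_iff[THEN iffD1]) (auto simp: sum_nonneg intro: order_trans[OF sum_abs])
    also have "\<dots> \<le> 3 * w powr a * ?S"
      using sum_abs_frac_incr2_le[OF assms, of s l m] by (auto simp: power2_eq_square sum_nonneg intro!: mult_right_mono)
    finally show "ennreal ((\<Sum>i\<in>{l..<m}. frac_incr2 a w (real i * D - s))\<^sup>2)
       \<le> ennreal (3 * w powr a) * (\<Sum>i\<in>{l..<m}. ennreal \<bar>frac_incr2 a w (real i * D - s)\<bar>)"
      by (simp flip: ennreal_mult' add: ennreal_leI)
  qed
  also have "\<dots> = ennreal (3 * w powr a) * (\<Sum>i\<in>{l..<m}. \<integral>\<^sup>+s. ennreal \<bar>frac_incr2 a w (real i * D - s)\<bar> \<partial>lborel)"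
    by (subst nn_integral_cmult, measurable, subst nn_integral_sum, measurable) 
  also have "\<dots> \<le> ennreal (3 * w powr a) * (\<Sum>i\<in>{l..<m}. ennreal (3 * w powr (a + 1)))"
  proof (intro mult_left_mono sum_mono)
    fix i
    have "(\<integral>\<^sup>+s. ennreal \<bar>frac_incr2 a w s\<bar> \<partial>lborel) = (\<integral>\<^sup>+s. ennreal \<bar>frac_incr2 a w (real i * D - s)\<bar> \<partial>lborel)"
      by (subst nn_integral_real_affine[where t="real i * D" and c="-1"]) auto
    then show "(\<integral>\<^sup>+s. ennreal \<bar>frac_incr2 a w (real i * D - s)\<bar> \<partial>lborel) \<le> ennreal (3 * w powr (a + 1))"
      using nn_integral_abs_frac_incr2_le by simp
  qed auto
  also have "\<dots> = ennreal (9 * real (m - l) * w powr (2 * a + 1))"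
    using w by (simp add: sum_ennreal ennreal_mult'[symmetric] powr_add[symmetric] mult_ac)
      (simp add: powr_add[symmetric] mult_ac ennreal_of_nat_eq_real_of_nat ennreal_mult'[symmetric])
  finally show ?thesis .
qed

text \<open>On [-w, w] the kernel is at most w^a. Beyond w it is at most w x^(a-1), and the square
  of that is integrable at infinity precisely because a < 1/2. The two regions give the summands 2
  and 1 / (1 - 2a) of the constant.\<close>

lemma nn_integral_frac_incr_sq_le:
  assumes "a < 1/2"
  shows "(\<integral>\<^sup>+x. ennreal ((frac_incr a w x)\<^sup>2) \<partial>lborel) \<le> ennreal ((2 + 1 / (1 - 2 * a)) * w powr (2 * a + 1))"
proof -
  have X: "(\<integral>\<^sup>+x. ennreal (x powr (2 * a - 2)) * indicator {w..} x \<partial>lborel) = ennreal (w powr (2 * a - 1) / (1 - 2 * a))"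
  proof -
    have e: "2 * a - 2 + 1 = 2 * a - 1" by simp
    have "- (w powr (2 * a - 2 + 1)) / (2 * a - 2 + 1) = w powr (2 * a - 1) / (1 - 2 * a)"
      unfolding e using minus_divide_divide[of "w powr (2 * a - 1)" "1 - 2 * a"] by (simp only: minus_diff_eq)
    then have "((\<lambda>x. x powr (2 * a - 2)) has_integral w powr (2 * a - 1) / (1 - 2 * a)) {w..}"
      using has_integral_powr_to_inf[of "2 * a - 2" w] w assms by simp
    from nn_integral_has_integral_lebesgue'[OF _ this] show ?thesis by simp
  qed
  have "(\<integral>\<^sup>+x. ennreal ((frac_incr a w x)\<^sup>2) \<partial>lborel) \<le>
    (\<integral>\<^sup>+x. ennreal (w powr (2 * a)) * indicator {-w..w} x + ennreal (w\<^sup>2) * (ennreal (x powr (2 * a - 2)) * indicator {w..} x) \<partial>lborel)"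
  proof (intro nn_integral_mono)
    fix x :: real
    consider "x < - w" | "- w \<le> x" "x < w" | "w \<le> x" by linarith
    then show "ennreal ((frac_incr a w x)\<^sup>2) \<le> ennreal (w powr (2 * a)) * indicator {-w..w} x + ennreal (w\<^sup>2) * (ennreal (x powr (2 * a - 2)) * indicator {w..} x)"
    proof cases
      case 1 then show ?thesis by (simp add: frac_incr_eq_0)
    next
      case 2
      have "(frac_incr a w x)\<^sup>2 \<le> (w powr a)\<^sup>2" using frac_incr_nonneg frac_incr_le by (intro power_mono) auto
      also have "(w powr a)\<^sup>2 = w powr (2 * a)" using w by (simp add: power2_eq_square powr_add[symmetric])
      finally show ?thesis using 2 by (auto simp: ennreal_leI)
    next
      case 3
      with w have x: "0 < x" by simp
      have "frac_incr a w x \<le> w * x powr (a - 1)"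
        using powr_add_le_tangent[of x w a] a w x by (simp add: frac_incr_def pos_powr_def)
      then have "(frac_incr a w x)\<^sup>2 \<le> (w * x powr (a - 1))\<^sup>2" using frac_incr_nonneg by (intro power_mono) auto
      also have "\<dots> = w\<^sup>2 * x powr (2 * a - 2)" using x by (simp add: power2_eq_square powr_add[symmetric] mult_ac)
      finally have "ennreal ((frac_incr a w x)\<^sup>2) \<le> ennreal (w\<^sup>2) * ennreal (x powr (2 * a - 2))"
        by (simp add: ennreal_leI flip: ennreal_mult')
      then show ?thesis using 3 by (simp add: add_increasing)
    qed
  qed
  also have "\<dots> = ennreal (w powr (2 * a)) * ennreal (2 * w) + ennreal (w\<^sup>2) * ennreal (w powr (2 * a - 1) / (1 - 2 * a))"
  proof -
    have "(\<integral>\<^sup>+x. ennreal (w powr (2 * a)) * indicator {-w..w} x \<partial>lborel) = ennreal (w powr (2 * a)) * ennreal (2 * w)"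
      using w by (simp add: nn_integral_cmult_indicator)
    moreover have "(\<integral>\<^sup>+x. ennreal (w\<^sup>2) * (ennreal (x powr (2 * a - 2)) * indicator {w..} x) \<partial>lborel)
      = ennreal (w\<^sup>2) * (\<integral>\<^sup>+x. ennreal (x powr (2 * a - 2)) * indicator {w..} x \<partial>lborel)"
      by (rule nn_integral_cmult) measurable
    moreover have "(\<integral>\<^sup>+x. ennreal (w powr (2 * a)) * indicator {-w..w} x + ennreal (w\<^sup>2) * (ennreal (x powr (2 * a - 2)) * indicator {w..} x) \<partial>lborel)
      = (\<integral>\<^sup>+x. ennreal (w powr (2 * a)) * indicator {-w..w} x \<partial>lborel) + (\<integral>\<^sup>+x. ennreal (w\<^sup>2) * (ennreal (x powr (2 * a - 2)) * indicator {w..} x) \<partial>lborel)"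
      by (rule nn_integral_add) measurable
    ultimately show ?thesis by (simp only: X)
  qed
  also have "\<dots> = ennreal (w powr (2 * a) * (2 * w) + w\<^sup>2 * (w powr (2 * a - 1) / (1 - 2 * a)))"
    using w assms by (simp flip: ennreal_mult')
  also have "w powr (2 * a) * (2 * w) + w\<^sup>2 * (w powr (2 * a - 1) / (1 - 2 * a)) = (2 + 1 / (1 - 2 * a)) * w powr (2 * a + 1)"
    using w by (simp add: powr_add powr_diff distrib_right power2_eq_square)
  finally show ?thesis .
qed

end

section \<open>Moments of fractional Brownian increments\<close>

lemma has_wiener_integral_zero: "has_wiener_integral M W (\<lambda>_. 0) (\<lambda>_. 0)"
  unfolding has_wiener_integral_def
  by (auto intro!: exI[of _ "\<lambda>_. []"] simp: step_ok_def step_fun_def step_integral_def)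

lemma has_wiener_integral_sum:
  assumes "two_sided_wiener M W" "finite I" "\<And>i. i \<in> I \<Longrightarrow> has_wiener_integral M W (f i) (Y i)"
  shows "has_wiener_integral M W (\<lambda>s. \<Sum>i\<in>I. f i s) (\<lambda>\<omega>. \<Sum>i\<in>I. Y i \<omega>)"
  using assms(2,3)
proof (induction I rule: finite_induct)
  case empty then show ?case by (simp add: has_wiener_integral_zero)
next
  case (insert i I)
  then show ?case using has_wiener_integral_add_scaled[OF assms(1), of "f i" "Y i" "\<lambda>s. \<Sum>i\<in>I. f i s" "\<lambda>\<omega>. \<Sum>i\<in>I. Y i \<omega>" 1]
    by auto
qed

context
  fixes M :: "'a measure" and W B :: "real \<Rightarrow> 'a \<Rightarrow> real" and H :: real
  assumes M: "prob_space M" and W: "two_sided_wiener M W" and fbm: "fractional_BM M W H B"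
    and H: "1/2 < H" "H < 1"
begin

lemma fBm_wiener:
  assumes "0 \<le> t"
  shows "has_wiener_integral M W (\<lambda>s. pos_powr (t - s) (H - 1/2) - pos_powr (- s) (H - 1/2)) (B t)"
proof -
  have eq: "(\<lambda>s. indicator {..t} s * (pos_powr (t - s) (H - 1/2) - pos_powr (- s) (H - 1/2)))
     = (\<lambda>s. pos_powr (t - s) (H - 1/2) - pos_powr (- s) (H - 1/2))"
    using assms by (auto simp: fun_eq_iff indicator_def pos_powr_def)
  have "has_wiener_integral M W
      (\<lambda>s. indicator {..t} s * (pos_powr (t - s) (H - 1/2) - pos_powr (- s) (H - 1/2))) (B t)"
    using fbm assms unfolding fractional_BM_def by blast
  then show ?thesis unfolding eq .
qed

lemma fBm_measurable: "0 \<le> t \<Longrightarrow> B t \<in> borel_measurable M"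
  using fBm_wiener[of t] by (simp add: has_wiener_integral_def)

text \<open>\<open>B 0\<close> is only a version of the integral of the zero kernel. The moment
  bound asks for a strictly positive v, so v is sent to 0.\<close>

lemma fBm_0: "AE \<omega> in M. B 0 \<omega> = 0"
proof -
  have "Lq M 1 (B 0) (2 * gauss_const 1 * sqrt v)" if "0 < v" for v
    using Lq_wiener_integral[OF M W fBm_wiener[of 0], of v 1] that by simp
  then have le: "(\<integral>\<^sup>+\<omega>. ennreal \<bar>B 0 \<omega>\<bar> \<partial>M) \<le> ennreal (2 * gauss_const 1 * sqrt v)" if "0 < v" for v
    using that by (simp add: Lq_def)
  have "(\<integral>\<^sup>+\<omega>. ennreal \<bar>B 0 \<omega>\<bar> \<partial>M) \<le> 0 + ennreal e" if "0 < e" for e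
  proof -
    have g: "0 < gauss_const 1" using gauss_const_ge_1[of 1] by simp
    \<comment> \<open>This choice of v makes the first-moment bound equal to e.\<close>
    have "2 * gauss_const 1 * sqrt ((e / (2 * gauss_const 1))\<^sup>2) = e"
      using g that by (simp add: real_sqrt_abs)
    then show ?thesis using le[of "(e / (2 * gauss_const 1))\<^sup>2"] g that by simp
  qed
  then have "(\<integral>\<^sup>+\<omega>. ennreal \<bar>B 0 \<omega>\<bar> \<partial>M) \<le> 0" by (rule ennreal_le_epsilon)
  then have "Lq M 1 (B 0) 0" using fBm_measurable[of 0] by (simp add: Lq_def)
  then show ?thesis by (rule Lq_0_AE) simp
qed

text \<open>With a = H - 1/2 the squared kernel norm scales as w^(2a+1) = w^(2H), and its square
  root gives the Hoelder order H.\<close>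

lemma Lq_fBm_incr:
  assumes "q \<ge> 1"
  shows "\<exists>C>0. \<forall>s\<ge>0. \<forall>t\<ge>s. Lq M q (\<lambda>\<omega>. B t \<omega> - B s \<omega>) (C * (t - s) powr H)"
proof -
  let ?a = "H - 1/2"
  define c where "c = 2 + 1 / (1 - 2 * ?a)"
  have c: "0 < c" using H by (simp add: c_def add_pos_nonneg)
  let ?C = "2 * gauss_const q * sqrt c"
  have "Lq M q (\<lambda>\<omega>. B t \<omega> - B s \<omega>) (?C * (t - s) powr H)" if st: "0 \<le> s" "s \<le> t" for s t
  proof (cases "s = t")
    case True
    then show ?thesis using assms by (auto intro!: Lq_zero)
  next
    case False
    define w where "w = t - s"
    have w: "0 < w" using False st by (simp add: w_def)
    have "has_wiener_integral M W (\<lambda>u. frac_incr ?a w (s - u)) (\<lambda>\<omega>. B t \<omega> - B s \<omega>)"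
      using has_wiener_integral_add_scaled[OF W fBm_wiener[of t] fBm_wiener[of s], of "-1"] st
      by (simp add: frac_incr_def w_def algebra_simps)
    moreover have "(\<integral>\<^sup>+u. ennreal ((frac_incr ?a w (s - u))\<^sup>2) \<partial>lborel) \<le> ennreal (c * w powr (2 * H))"
    proof -
      have "(\<integral>\<^sup>+u. ennreal ((frac_incr ?a w u)\<^sup>2) \<partial>lborel) = (\<integral>\<^sup>+u. ennreal ((frac_incr ?a w (s - u))\<^sup>2) \<partial>lborel)"
        by (subst nn_integral_real_affine[where t="s" and c="-1"]) auto
      then show ?thesis using nn_integral_frac_incr_sq_le[of ?a w] w H by (simp add: c_def)
    qed
    ultimately have "Lq M q (\<lambda>\<omega>. B t \<omega> - B s \<omega>) (2 * gauss_const q * sqrt (c * w powr (2 * H)))"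
      using w c by (intro Lq_wiener_integral[OF M W] assms) auto
    moreover have "sqrt (w powr (2 * H)) = w powr H"
      by (simp add: powr_half_sqrt[symmetric] powr_powr)
    ultimately show ?thesis by (simp add: real_sqrt_mult w_def mult_ac)
  qed
  then show ?thesis using c gauss_const_ge_1[of q] by (intro exI[of _ ?C]) auto
qed

text \<open>By linearity the sum is the Wiener integral of the summed kernel, whose squared norm is
  at most 9 (m - l) w^(2H); the constant 6 is 2 times the root of 9. Replacing w by D at the end
  makes the bound uniform over offsets within a cell.\<close>

lemma Lq_fBm_sum_incr2:
  assumes "q \<ge> 1" "0 \<le> w" "w \<le> D" "1 \<le> l"
  shows "Lq M q (\<lambda>\<omega>. \<Sum>i\<in>{l..<m}. incr2 B (real i * D) w \<omega>)
    (6 * gauss_const q * D powr H * sqrt (real (m - l)))"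
proof (cases "w = 0 \<or> m \<le> l")
  case True
  have "0 \<le> gauss_const q" using gauss_const_ge_1[of q] by simp
  then show ?thesis using True assms by (auto intro!: Lq_zero)
next
  case False
  then have w: "0 < w" and ml: "l < m" using assms by auto
  let ?a = "H - 1/2"
  have wi: "has_wiener_integral M W (\<lambda>s. frac_incr2 ?a w (real i * D - s))
     (\<lambda>\<omega>. incr2 B (real i * D) w \<omega>)" if "i \<in> {l..<m}" for i
  proof -
    \<comment> \<open>From i \<ge> 1 and w \<le> D all times stay nonnegative, where the Wiener
      representation of \<open>B\<close> is available.\<close>
    have "1 * D \<le> real i * D" using that assms by (intro mult_right_mono) auto
    then have p: "0 \<le> real i * D - w" "0 \<le> real i * D" "0 \<le> real i * D + w" using assms by auto
    have eq: "real i * D - w - s = real i * D - s - w" "real i * D + w - s = real i * D - s + w" for s by auto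
    show ?thesis
      using has_wiener_integral_add_scaled[OF W has_wiener_integral_add_scaled[OF W fBm_wiener[OF p(3)] fBm_wiener[OF p(1)], of 1] fBm_wiener[OF p(2)], of "-2"]
      by (simp add: frac_incr2_def eq algebra_simps)
  qed
  have "9 * real (m - l) * w powr (2 * ?a + 1) > 0" using w ml by simp
  moreover have "(\<integral>\<^sup>+s. ennreal ((\<Sum>i\<in>{l..<m}. frac_incr2 ?a w (real i * D - s))\<^sup>2) \<partial>lborel)
    \<le> ennreal (9 * real (m - l) * w powr (2 * ?a + 1))"
    using w H assms by (intro nn_integral_sum_frac_incr2_sq_le) auto
  moreover have "has_wiener_integral M W (\<lambda>s. \<Sum>i\<in>{l..<m}. frac_incr2 ?a w (real i * D - s))
     (\<lambda>\<omega>. \<Sum>i\<in>{l..<m}. incr2 B (real i * D) w \<omega>)"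
    by (rule has_wiener_integral_sum[OF W finite_atLeastLessThan wi])
  ultimately have "Lq M q (\<lambda>\<omega>. \<Sum>i\<in>{l..<m}. incr2 B (real i * D) w \<omega>)
    (2 * gauss_const q * sqrt (9 * real (m - l) * w powr (2 * ?a + 1)))"
    using assms(1) by (intro Lq_wiener_integral[OF M W])
  then show ?thesis
  proof (rule Lq_mono)
    have "sqrt (w powr (2 * H)) = w powr H"
      by (simp add: powr_half_sqrt[symmetric] powr_powr)
    then have "2 * gauss_const q * sqrt (9 * real (m - l) * w powr (2 * ?a + 1)) = 6 * gauss_const q * w powr H * sqrt (real (m - l))"
      by (simp add: real_sqrt_mult)
    also have "\<dots> \<le> 6 * gauss_const q * D powr H * sqrt (real (m - l))"
      using gauss_const_ge_1[of q] assms H by (intro mult_right_mono mult_left_mono powr_mono2) auto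
    finally show "2 * gauss_const q * sqrt (9 * real (m - l) * w powr (2 * ?a + 1)) \<le> 6 * gauss_const q * D powr H * sqrt (real (m - l))" .
  qed
qed

end

section \<open>Densities, discrete sewing and joint measurability\<close>

text \<open>Identifies the supremum in the Jordan decomposition with the integral of the positive
  part of the density: enlarging the integrand and then the set gives one inequality, and the set
  where g is nonnegative gives the other.\<close>

lemma positive_part_density:
  assumes g [measurable]: "g \<in> borel_measurable borel" and bd: "\<And>r. \<bar>g r\<bar> \<le> G"
    and \<eta>: "\<And>A. A \<in> sets (delay_space \<tau>) \<Longrightarrow> \<eta> A = (LINT r:A|lborel. g r)"
  shows "positive_part (delay_space \<tau>) \<eta> = density (restrict_space lborel {0..\<tau>}) (\<lambda>r. ennreal (max 0 (g r)))"
    (is "_ = ?P")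
proof -
  have setsP: "sets ?P = sets (delay_space \<tau>)" by (simp cong: sets_restrict_space_cong)
  have spaceP: "space ?P = space (delay_space \<tau>)" by (simp add: space_restrict_space)
  have int: "set_integrable lborel A g" if "A \<in> sets (delay_space \<tau>)" for A
  proof -
    have A: "A \<subseteq> {0..\<tau>}" "A \<in> sets borel" using that by (auto simp: sets_restrict_space)
    have "set_integrable lborel {0..\<tau>} g"
      unfolding set_integrable_def using bd
      by (intro integrableI_bounded_set_indicator[where B=G]) (auto simp: emeasure_lborel_Icc_eq)
    then show ?thesis by (rule set_integrable_subset) (use A in auto)
  qed
  have emP: "emeasure ?P A = (\<integral>\<^sup>+r. ennreal (max 0 (g r)) * indicator A r \<partial>lborel)" if "A \<in> sets (delay_space \<tau>)" for A
  proof -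
    have A: "A \<subseteq> {0..\<tau>}" "A \<in> sets borel" using that by (auto simp: sets_restrict_space)
    have "A \<in> sets ?P" using that setsP by simp
    then have "emeasure ?P A = (\<integral>\<^sup>+r. ennreal (max 0 (g r)) * indicator A r \<partial>restrict_space lborel {0..\<tau>})"
      by (subst emeasure_density) (auto intro!: measurable_restrict_space1)
    also have "\<dots> = (\<integral>\<^sup>+r. ennreal (max 0 (g r)) * indicator A r * indicator {0..\<tau>} r \<partial>lborel)"
      by (subst nn_integral_restrict_space) auto
    also have "\<dots> = (\<integral>\<^sup>+r. ennreal (max 0 (g r)) * indicator A r \<partial>lborel)"
      using A by (intro nn_integral_cong) (auto simp: indicator_def)
    finally show ?thesis .
  qed
  have sup: "(SUP B\<in>{B \<in> sets (delay_space \<tau>). B \<subseteq> A}. ennreal (\<eta> B)) = emeasure ?P A"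
    if A: "A \<in> sets (delay_space \<tau>)" for A
  proof (rule antisym)
    show "(SUP B\<in>{B \<in> sets (delay_space \<tau>). B \<subseteq> A}. ennreal (\<eta> B)) \<le> emeasure ?P A"
    proof (rule SUP_least)
      fix B assume "B \<in> {B \<in> sets (delay_space \<tau>). B \<subseteq> A}"
      then have B: "B \<in> sets (delay_space \<tau>)" "B \<subseteq> A" by auto
      then have [measurable]: "B \<in> sets borel" by (auto simp: sets_restrict_space)
      have i: "integrable lborel (\<lambda>r. indicator B r * max 0 (g r))"
        using int[OF B(1)] unfolding set_integrable_def
        by (rule Bochner_Integration.integrable_bound) (auto simp: indicator_def)
      have "\<eta> B \<le> (\<integral>r. indicator B r * max 0 (g r) \<partial>lborel)"
        unfolding \<eta>[OF B(1)] set_lebesgue_integral_def using int[OF B(1)] i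
        by (intro integral_mono) (auto simp: set_integrable_def indicator_def)
      then have "ennreal (\<eta> B) \<le> (\<integral>\<^sup>+r. ennreal (indicator B r * max 0 (g r)) \<partial>lborel)"
        by (subst nn_integral_eq_integral[OF i]) (auto intro!: ennreal_leI simp: indicator_def)
      also have "\<dots> \<le> (\<integral>\<^sup>+r. ennreal (max 0 (g r)) * indicator A r \<partial>lborel)"
        using B by (intro nn_integral_mono) (auto simp: indicator_def)
      finally show "ennreal (\<eta> B) \<le> emeasure ?P A" unfolding emP[OF A] .
    qed
    \<comment> \<open>The subset of A that attains the supremum: A cut with a positive Hahn
      set.\<close>
    define B where "B = A \<inter> {r. 0 \<le> g r}"
    have "A \<subseteq> {0..\<tau>}" and [measurable]: "A \<in> sets borel" using A by (auto simp: sets_restrict_space)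
    have [measurable]: "B \<in> sets borel" unfolding B_def by measurable
    then have B: "B \<in> sets (delay_space \<tau>)" "B \<subseteq> A"
      using \<open>A \<subseteq> {0..\<tau>}\<close> by (simp_all add: B_def sets_restrict_space_iff le_infI1)
    have "emeasure ?P A = (\<integral>\<^sup>+r. ennreal (indicator B r * g r) \<partial>lborel)"
      unfolding emP[OF A] by (intro nn_integral_cong) (auto simp: B_def indicator_def max_def)
    also have "\<dots> = ennreal (\<eta> B)"
      unfolding \<eta>[OF B(1)] set_lebesgue_integral_def using int[OF B(1)]
      by (subst nn_integral_eq_integral) (auto simp: set_integrable_def indicator_def B_def)
    also have "\<dots> \<le> (SUP B\<in>{B \<in> sets (delay_space \<tau>). B \<subseteq> A}. ennreal (\<eta> B))"
      using B by (intro SUP_upper) auto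
    finally show "emeasure ?P A \<le> (SUP B\<in>{B \<in> sets (delay_space \<tau>). B \<subseteq> A}. ennreal (\<eta> B))" .
  qed
  have "positive_part (delay_space \<tau>) \<eta> = measure_of (space (delay_space \<tau>)) (sets (delay_space \<tau>)) (emeasure ?P)"
    unfolding positive_part_def using sup by (intro measure_of_eq sets.space_closed) (simp only: sets.sigma_sets_eq)
  also have "\<dots> = measure_of (space ?P) (sets ?P) (emeasure ?P)" by (simp only: setsP spaceP)
  also have "\<dots> = ?P" by (rule measure_of_of_measure)
  finally show ?thesis .
qed

text \<open>The integrand f' has to agree with a bounded measurable f on [0, \<tau>] only. The
  solution and the scheme can therefore be replaced by well-behaved versions without any claim about
  their values outside the relevant time range.\<close>

lemma signed_integral_density:
  assumes g [measurable]: "g \<in> borel_measurable borel" and bd: "\<And>r. \<bar>g r\<bar> \<le> G"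
    and \<eta>: "\<And>A. A \<in> sets (delay_space \<tau>) \<Longrightarrow> \<eta> A = (LINT r:A|lborel. g r)"
    and f [measurable]: "f \<in> borel_measurable borel" and fb: "\<And>r. \<bar>f r\<bar> \<le> F"
    and eq: "\<And>r. r \<in> {0..\<tau>} \<Longrightarrow> f' r = f r"
  shows "signed_integral (delay_space \<tau>) \<eta> f' = (LINT r:{0..\<tau>}|lborel. f r * g r)"
proof -
  have F0: "0 \<le> F" using fb[of 0] by linarith
  have *: "(\<integral>r. f' r \<partial>positive_part (delay_space \<tau>) \<mu>) = (LINT r:{0..\<tau>}|lborel. max 0 (h r) * f r)"
    if [measurable]: "h \<in> borel_measurable borel" and "\<And>r. \<bar>h r\<bar> \<le> G"
      "\<And>A. A \<in> sets (delay_space \<tau>) \<Longrightarrow> \<mu> A = (LINT r:A|lborel. h r)" for h \<mu>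
  proof -
    have [measurable]: "f \<in> borel_measurable (restrict_space lborel {0..\<tau>})" "h \<in> borel_measurable (restrict_space lborel {0..\<tau>})"
      by (auto intro!: measurable_restrict_space1)
    have PP: "positive_part (delay_space \<tau>) \<mu> = density (restrict_space lborel {0..\<tau>}) (\<lambda>r. ennreal (max 0 (h r)))"
      by (rule positive_part_density) (use that in auto)
    have "(\<integral>r. f' r \<partial>positive_part (delay_space \<tau>) \<mu>) = (\<integral>r. f r \<partial>positive_part (delay_space \<tau>) \<mu>)"
      unfolding PP using eq by (intro Bochner_Integration.integral_cong) (auto simp: space_restrict_space)
    also have "\<dots> = (\<integral>r. max 0 (h r) * f r \<partial>restrict_space lborel {0..\<tau>})"
      unfolding PP by (subst integral_real_density) auto
    also have "\<dots> = (LINT r:{0..\<tau>}|lborel. max 0 (h r) * f r)"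
      by (subst integral_restrict_space) (auto simp: set_lebesgue_integral_def)
    finally show ?thesis .
  qed
  have int: "set_integrable lborel {0..\<tau>} (\<lambda>r. max 0 (h r) * f r)"
    if [measurable]: "h \<in> borel_measurable borel" and "\<And>r. \<bar>h r\<bar> \<le> G" for h
    unfolding set_integrable_def
  proof (rule integrableI_bounded_set_indicator[where B="G * F"])
    show "AE x in lborel. x \<in> {0..\<tau>} \<longrightarrow> norm (max 0 (h x) * f x) \<le> G * F"
    proof (intro AE_I2 impI)
      fix x
      have "\<bar>max 0 (h x)\<bar> \<le> G" using that(2)[of x] by auto
      then show "norm (max 0 (h x) * f x) \<le> G * F"
        unfolding real_norm_def abs_mult using fb[of x] by (intro mult_mono) auto
    qed
  qed (auto simp: emeasure_lborel_Icc_eq)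
  have m: "- \<eta> A = (LINT r:A|lborel. - g r)" if "A \<in> sets (delay_space \<tau>)" for A
    using \<eta>[OF that] by (simp add: set_lebesgue_integral_def)
  have "signed_integral (delay_space \<tau>) \<eta> f' = (LINT r:{0..\<tau>}|lborel. max 0 (g r) * f r) - (LINT r:{0..\<tau>}|lborel. max 0 (- g r) * f r)"
    unfolding signed_integral_def using *[OF g bd \<eta>] *[of "\<lambda>r. - g r" "\<lambda>A. - \<eta> A"] m bd by simp
  also have "\<dots> = (LINT r:{0..\<tau>}|lborel. max 0 (g r) * f r - max 0 (- g r) * f r)"
    using int[of g] int[of "\<lambda>r. - g r"] bd by (intro set_integral_diff(2)[symmetric]) auto
  also have "(\<lambda>r. max 0 (g r) * f r - max 0 (- g r) * f r) = (\<lambda>r. f r * g r)"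
    by (auto simp: max_def fun_eq_iff)
  finally show ?thesis .
qed

text \<open>Superlinear powers gain a factor below 1 under splitting. The proportion 2/3 instead of
  1/2 accommodates odd lengths; the extreme case is 3 = 1 + 2.\<close>

lemma powr_split_le:
  fixes x y N :: nat and r :: real
  assumes "N = x + y" "3 * x \<le> 2 * N" "3 * y \<le> 2 * N" "0 < r"
  shows "real x powr (r + 1) + real y powr (r + 1) \<le> (2/3) powr r * real N powr (r + 1)"
proof -
  have e: "real z powr (r + 1) = real z * real z powr r" for z by (simp add: powr_add)
  have le: "real z powr r \<le> (2/3 * real N) powr r" if "3 * z \<le> 2 * N" for z
    using that assms(4) by (intro powr_mono2) auto
  have "real x powr (r + 1) + real y powr (r + 1) \<le> real x * (2/3 * real N) powr r + real y * (2/3 * real N) powr r"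
    unfolding e using le assms by (intro add_mono mult_left_mono) auto
  also have "\<dots> = (real x + real y) * (2/3 * real N) powr r" by (simp add: distrib_right)
  also have "\<dots> = real N * ((2/3) powr r * real N powr r)"
    unfolding assms(1) of_nat_add by (subst powr_mult) auto
  also have "\<dots> = (2/3) powr r * real N powr (r + 1)" by (simp add: e)
  finally show ?thesis .
qed

text \<open>Bisection of the block: the two halves, each recentred at its own left end, are handled
  by induction, and the defect is the increment of a times the sum of z over the right half, a
  product bounded by A Z times the length to the power h + e. Since h + e > 1, splitting gains a
  factor below 1, which absorbs the defect.\<close>

lemma Lq_discrete_sewing:
  fixes a z :: "nat \<Rightarrow> 'a \<Rightarrow> real"
  assumes a: "\<And>i j. L \<le> i \<Longrightarrow> i \<le> j \<Longrightarrow> j < U \<Longrightarrow> Lq M (2 * q) (\<lambda>\<omega>. a j \<omega> - a i \<omega>) (A * real (j - i) powr h)"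
    and z: "\<And>i j. L \<le> i \<Longrightarrow> i \<le> j \<Longrightarrow> j \<le> U \<Longrightarrow> Lq M (2 * q) (\<lambda>\<omega>. \<Sum>k\<in>{i..<j}. z k \<omega>) (Z * real (j - i) powr e)"
    and pos: "0 \<le> A" "0 \<le> Z" "0 \<le> h" "0 \<le> e" "1 < h + e" and q: "q \<ge> 1"
    and "L \<le> l" "l \<le> m" "m \<le> U"
  shows "Lq M q (\<lambda>\<omega>. \<Sum>i\<in>{l..<m}. (a i \<omega> - a l \<omega>) * z i \<omega>)
     (A * Z / (1 - (2/3) powr (h + e - 1)) * real (m - l) powr (h + e))"
  using assms(9-11)
proof (induction "m - l" arbitrary: l m rule: less_induct)
  case less
  define N where "N = m - l"
  define r where "r = h + e - 1"
  have r: "0 < r" using pos by (simp add: r_def)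
  \<comment> \<open>The fixed point of the recursion: \<kappa> (2/3)^r + A Z = \<kappa>.\<close>
  define \<kappa> where "\<kappa> = A * Z / (1 - (2/3) powr r)"
  have q1: "(2/3 :: real) powr r < 1" using r powr_less_mono2[of r "2/3" 1] by simp
  have \<kappa>0: "0 \<le> \<kappa>" using q1 pos by (simp add: \<kappa>_def)
  have he: "h + e = r + 1" by (simp add: r_def)
  show ?case
  proof (cases "N \<le> 1")
    case True
    \<comment> \<open>On a block of at most one index the only possible weight is a l - a l =
      0.\<close>
    then consider "m = l" | "m = Suc l" using less.prems by (force simp: N_def)
    then have "(\<lambda>\<omega>. \<Sum>i\<in>{l..<m}. (a i \<omega> - a l \<omega>) * z i \<omega>) = (\<lambda>_. 0)" by cases auto
    moreover have "0 \<le> \<kappa> * real (m - l) powr (h + e)" using \<kappa>0 by simp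
    ultimately show ?thesis unfolding \<kappa>_def r_def using q by (simp only: Lq_zero)
  next
    case False
    define x where "x = N div 2"
    define y where "y = N - x"
    define u where "u = l + x"
    have xy: "N = x + y" "3 * x \<le> 2 * N" "3 * y \<le> 2 * N" "0 < x" "0 < y" "x \<le> N" "y \<le> N"
      using False by (auto simp: x_def y_def)
    have u: "l < u" "u < m" "u - l = x" "m - u = y" using xy less.prems by (auto simp: u_def N_def)
    have I1: "Lq M q (\<lambda>\<omega>. \<Sum>i\<in>{l..<u}. (a i \<omega> - a l \<omega>) * z i \<omega>) (\<kappa> * real x powr (r + 1))"
      using less.hyps[of u l] u less.prems xy by (simp add: \<kappa>_def r_def N_def)
    have I2: "Lq M q (\<lambda>\<omega>. \<Sum>i\<in>{u..<m}. (a i \<omega> - a u \<omega>) * z i \<omega>) (\<kappa> * real y powr (r + 1))"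
      using less.hyps[of m u] u less.prems xy by (simp add: \<kappa>_def r_def N_def)
    have I3: "Lq M q (\<lambda>\<omega>. (a u \<omega> - a l \<omega>) * (\<Sum>i\<in>{u..<m}. z i \<omega>)) ((A * real x powr h) * (Z * real y powr e))"
      using a[of l u] z[of u m] u less.prems by (intro Lq_mult q) auto
    have split: "(\<Sum>i\<in>{l..<m}. (a i \<omega> - a l \<omega>) * z i \<omega>) = (\<Sum>i\<in>{l..<u}. (a i \<omega> - a l \<omega>) * z i \<omega>)
        + (\<Sum>i\<in>{u..<m}. (a i \<omega> - a u \<omega>) * z i \<omega>) + (a u \<omega> - a l \<omega>) * (\<Sum>i\<in>{u..<m}. z i \<omega>)" for \<omega>
    proof -
      have "(\<Sum>i\<in>{l..<m}. (a i \<omega> - a l \<omega>) * z i \<omega>) = (\<Sum>i\<in>{l..<u}. (a i \<omega> - a l \<omega>) * z i \<omega>) + (\<Sum>i\<in>{u..<m}. (a i \<omega> - a l \<omega>) * z i \<omega>)"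
        using u by (subst sum.atLeastLessThan_concat) auto
      also have "(\<Sum>i\<in>{u..<m}. (a i \<omega> - a l \<omega>) * z i \<omega>) = (\<Sum>i\<in>{u..<m}. (a i \<omega> - a u \<omega>) * z i \<omega> + (a u \<omega> - a l \<omega>) * z i \<omega>)"
        by (intro sum.cong) (auto simp: algebra_simps)
      finally show ?thesis by (simp add: sum.distrib sum_distrib_left)
    qed
    have "Lq M q (\<lambda>\<omega>. \<Sum>i\<in>{l..<m}. (a i \<omega> - a l \<omega>) * z i \<omega>)
      (\<kappa> * real x powr (r + 1) + \<kappa> * real y powr (r + 1) + (A * real x powr h) * (Z * real y powr e))"
      unfolding split using I1 I2 I3 q by (intro Lq_add)
    moreover have "\<kappa> * real x powr (r + 1) + \<kappa> * real y powr (r + 1) + (A * real x powr h) * (Z * real y powr e)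
      \<le> \<kappa> * real N powr (r + 1)"
    proof -
      have "\<kappa> * (real x powr (r + 1) + real y powr (r + 1)) \<le> \<kappa> * ((2/3) powr r * real N powr (r + 1))"
        using powr_split_le[OF xy(1-3) r] \<kappa>0 by (rule mult_left_mono)
      moreover have "(A * real x powr h) * (Z * real y powr e) \<le> (A * real N powr h) * (Z * real N powr e)"
        using xy pos by (intro mult_mono mult_left_mono powr_mono2 mult_nonneg_nonneg) auto
      moreover have "(A * real N powr h) * (Z * real N powr e) = A * Z * real N powr (r + 1)"
        by (simp add: he[symmetric] powr_add)
      moreover have "\<kappa> * ((2/3) powr r * real N powr (r + 1)) + A * Z * real N powr (r + 1) = \<kappa> * real N powr (r + 1)"
      proof -
        have "A * Z = \<kappa> * (1 - (2/3) powr r)" using q1 r by (simp add: \<kappa>_def)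
        show ?thesis unfolding \<open>A * Z = _\<close> by (simp add: algebra_simps)
      qed
      ultimately show ?thesis by (simp add: distrib_left)
    qed
    ultimately show ?thesis using Lq_mono by (simp add: \<kappa>_def he N_def) blast
  qed
qed

text \<open>Rounding the time down to multiples of 1 / (n + 1) leaves countably many times, hence
  joint measurability of the approximations; path continuity gives their convergence.\<close>

lemma continuous_process_measurable:
  fixes Y :: "real \<Rightarrow> 'a \<Rightarrow> real"
  assumes [measurable]: "\<And>t. Y t \<in> borel_measurable M"
    and cont: "\<And>\<omega>. \<omega> \<in> space M \<Longrightarrow> continuous_on UNIV (\<lambda>t. Y t \<omega>)"
  shows "(\<lambda>(t, \<omega>). Y t \<omega>) \<in> borel_measurable (borel \<Otimes>\<^sub>M M)"
proof (rule borel_measurable_LIMSEQ_real)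
  fix n :: nat
  have "(\<lambda>x. Y (real_of_int k / real (Suc n)) (snd x)) \<in> borel_measurable (borel \<Otimes>\<^sub>M M)" for k
    by measurable
  moreover have "(\<lambda>x. \<lfloor>real (Suc n) * fst x\<rfloor>) \<in> measurable (borel \<Otimes>\<^sub>M M) (count_space UNIV)"
    by measurable
  ultimately show "(\<lambda>x. Y (real_of_int \<lfloor>real (Suc n) * fst x\<rfloor> / real (Suc n)) (snd x)) \<in> borel_measurable (borel \<Otimes>\<^sub>M M)"
    by (rule measurable_compose_countable)
next
  fix x assume "x \<in> space ((borel :: real measure) \<Otimes>\<^sub>M M)"
  then have c: "continuous_on UNIV (\<lambda>t. Y t (snd x))" using cont by (auto simp: space_pair_measure)
  have "(\<lambda>n. real_of_int \<lfloor>real (Suc n) * fst x\<rfloor> / real (Suc n)) \<longlonglongrightarrow> fst x"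
  proof (rule real_tendsto_sandwich)
    show "\<forall>\<^sub>F n in sequentially. fst x - 1 / real (Suc n) \<le> real_of_int \<lfloor>real (Suc n) * fst x\<rfloor> / real (Suc n)"
    proof (intro always_eventually allI)
      fix n
      have "real (Suc n) * fst x - 1 \<le> real_of_int \<lfloor>real (Suc n) * fst x\<rfloor>" by linarith
      then have "(real (Suc n) * fst x - 1) / real (Suc n) \<le> real_of_int \<lfloor>real (Suc n) * fst x\<rfloor> / real (Suc n)"
        by (rule divide_right_mono) simp
      then show "fst x - 1 / real (Suc n) \<le> real_of_int \<lfloor>real (Suc n) * fst x\<rfloor> / real (Suc n)"
        by (simp add: diff_divide_distrib)
    qed
    show "\<forall>\<^sub>F n in sequentially. real_of_int \<lfloor>real (Suc n) * fst x\<rfloor> / real (Suc n) \<le> fst x"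
    proof (intro always_eventually allI)
      fix n
      have "real_of_int \<lfloor>real (Suc n) * fst x\<rfloor> \<le> real (Suc n) * fst x" by linarith
      then have "real_of_int \<lfloor>real (Suc n) * fst x\<rfloor> / real (Suc n) \<le> (real (Suc n) * fst x) / real (Suc n)"
        by (rule divide_right_mono) simp
      then show "real_of_int \<lfloor>real (Suc n) * fst x\<rfloor> / real (Suc n) \<le> fst x" by simp
    qed
    have "(\<lambda>n. fst x - 1 / real (Suc n)) \<longlonglongrightarrow> fst x - 0"
      by (intro tendsto_diff tendsto_const LIMSEQ_Suc[OF lim_1_over_n])
    then show "(\<lambda>n. fst x - 1 / real (Suc n)) \<longlonglongrightarrow> fst x" by simp
  qed auto
  with c show "(\<lambda>n. Y (real_of_int \<lfloor>real (Suc n) * fst x\<rfloor> / real (Suc n)) (snd x)) \<longlonglongrightarrow> (case x of (t, \<omega>) \<Rightarrow> Y t \<omega>)"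
    by (simp add: case_prod_unfold) (rule continuous_on_tendsto_compose[of UNIV], auto)
qed

section \<open>Integrals over intervals and cells\<close>

lemma set_integrable_Icc_bounded:
  fixes f :: "real \<Rightarrow> real"
  assumes "f \<in> borel_measurable borel" "\<And>s. s \<in> {a..b} \<Longrightarrow> \<bar>f s\<bar> \<le> c"
  shows "set_integrable lborel {a..b} f"
  unfolding set_integrable_def using assms
  by (intro integrableI_bounded_set_indicator[where B=c]) (auto simp: emeasure_lborel_Icc_eq)

lemma set_integral_Icc_const: "a \<le> b \<Longrightarrow> (LINT s:{a..b}|lborel. c) = c * (b - a)" for a b c :: real
  by (simp add: set_lebesgue_integral_def)

text \<open>No regularity of f is assumed: if f is not integrable its integral is 0, and h is
  nonnegative on the interval because it dominates an absolute value.\<close>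

lemma set_integral_abs_le:
  fixes f h :: "real \<Rightarrow> real"
  assumes "set_integrable lborel {a..b} h" "\<And>s. s \<in> {a..b} \<Longrightarrow> \<bar>f s\<bar> \<le> h s"
  shows "\<bar>LINT s:{a..b}|lborel. f s\<bar> \<le> (LINT s:{a..b}|lborel. h s)"
proof (cases "set_integrable lborel {a..b} f")
  case True
  have "\<bar>LINT s:{a..b}|lborel. f s\<bar> \<le> (\<integral>s. \<bar>indicator {a..b} s *\<^sub>R f s\<bar> \<partial>lborel)"
    unfolding set_lebesgue_integral_def by (rule integral_abs_bound)
  also have "\<dots> \<le> (\<integral>s. indicator {a..b} s *\<^sub>R h s \<partial>lborel)"
    using True assms unfolding set_integrable_def
    by (intro integral_mono integrable_abs) (auto simp: indicator_def)
  finally show ?thesis by (simp add: set_lebesgue_integral_def)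
next
  case False
  have "0 \<le> (\<integral>s. indicator {a..b} s *\<^sub>R h s \<partial>lborel)"
    using assms(2) by (intro integral_nonneg_AE AE_I2) (force simp: indicator_def)
  then show ?thesis using False
    by (simp add: set_lebesgue_integral_def set_integrable_def not_integrable_integral_eq)
qed

lemma set_integral_abs_le_const:
  fixes f :: "real \<Rightarrow> real"
  assumes "a \<le> b" "\<And>s. s \<in> {a..b} \<Longrightarrow> \<bar>f s\<bar> \<le> c"
  shows "\<bar>LINT s:{a..b}|lborel. f s\<bar> \<le> c * (b - a)"
proof -
  have "set_integrable lborel {a..b} (\<lambda>_. c)"
    by (rule set_integrable_Icc_bounded[where c="\<bar>c\<bar>"]) auto
  from set_integral_abs_le[OF this assms(2)] show ?thesis
    using assms(1) by (simp add: set_integral_Icc_const)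
qed

lemma set_integral_measurable_param [measurable (raw)]:
  fixes F :: "'b \<Rightarrow> real \<Rightarrow> real"
  assumes [measurable]: "(\<lambda>(x, s). F x s) \<in> borel_measurable (N \<Otimes>\<^sub>M borel)"
  shows "(\<lambda>x. LINT s:{a..b}|lborel. F x s) \<in> borel_measurable N"
  unfolding set_lebesgue_integral_def by measurable

text \<open>Moment bounds are required on the open interval only, as the end points are null;
  applications then have strict inequalities for the time variable.\<close>

lemma Lq_set_integral:
  fixes F :: "real \<Rightarrow> 'a \<Rightarrow> real"
  assumes "prob_space M" and ab: "a \<le> b"
    and F [measurable]: "(\<lambda>(s, \<omega>). F s \<omega>) \<in> borel_measurable (borel \<Otimes>\<^sub>M M)"
    and c: "continuous_on {a..b} c" and pos: "\<And>s. s \<in> {a..b} \<Longrightarrow> 0 < c s"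
    and bd: "\<And>s. s \<in> {a<..<b} \<Longrightarrow> Lq M q (F s) (c s)" and q: "q \<ge> 1"
  shows "Lq M q (\<lambda>\<omega>. LINT s:{a..b}|lborel. F s \<omega>) (LINT s:{a..b}|lborel. c s)"
proof -
  interpret prob_space M by fact
  let ?N = "restrict_space lborel {a..b}"
  have eq: "(LINT s:{a..b}|lborel. f s) = (\<integral>s. f s \<partial>?N)" for f :: "real \<Rightarrow> real"
    by (simp add: integral_restrict_space set_lebesgue_integral_def)
  show ?thesis
    unfolding eq
  proof (rule Lq_integral)
    show "sigma_finite_measure M" by (rule sigma_finite_measure_axioms)
    have "finite_measure ?N"
      by (rule finite_measureI) (simp add: space_restrict_space emeasure_restrict_space emeasure_lborel_Icc_eq)
    then show "sigma_finite_measure ?N" by (simp add: finite_measure_def)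
    have "(\<lambda>x. F (fst x) (snd x)) \<in> borel_measurable (?N \<Otimes>\<^sub>M M)"
    proof -
      have "(\<lambda>x. (fst x, snd x)) \<in> measurable (?N \<Otimes>\<^sub>M M) (borel \<Otimes>\<^sub>M M)"
        by (intro measurable_Pair measurable_snd measurable_compose[OF measurable_fst measurable_restrict_space1]) auto
      from measurable_compose[OF this F] show ?thesis by simp
    qed
    then show "(\<lambda>(s, \<omega>). F s \<omega>) \<in> borel_measurable (?N \<Otimes>\<^sub>M M)" by (simp add: case_prod_unfold)
    show "integrable ?N c"
      using borel_integrable_atLeastAtMost'[OF c] by (simp add: integrable_restrict_space set_integrable_def)
    show "AE s in ?N. Lq M q (F s) (c s)"
      unfolding AE_restrict_space_iff[of "{a..b}" lborel, simplified]
      using AE_lborel_singleton[of a] AE_lborel_singleton[of b]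
      by eventually_elim (use bd in auto)
  qed (use pos q in \<open>auto simp: space_restrict_space\<close>)
qed

lemma Lq_set_integral_const:
  fixes F :: "real \<Rightarrow> 'a \<Rightarrow> real"
  assumes "prob_space M" "a \<le> b" "(\<lambda>(s, \<omega>). F s \<omega>) \<in> borel_measurable (borel \<Otimes>\<^sub>M M)"
    and "0 < c" "\<And>s. s \<in> {a<..<b} \<Longrightarrow> Lq M q (F s) c" "q \<ge> 1"
  shows "Lq M q (\<lambda>\<omega>. LINT s:{a..b}|lborel. F s \<omega>) (c * (b - a))"
  using Lq_set_integral[OF assms(1-3), of "\<lambda>_. c" q] assms by (simp add: set_integral_Icc_const)

lemma set_integral_shift:
  fixes f :: "real \<Rightarrow> real"
  shows "(LINT s:{c + a..c + b}|lborel. f s) = (LINT s:{a..b}|lborel. f (c + s))"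
  unfolding set_lebesgue_integral_def
  by (subst lborel_integral_real_affine[where c=1 and t=c])
    (auto intro!: Bochner_Integration.integral_cong simp: indicator_def)

lemma set_integral_reflect_Icc:
  fixes f :: "real \<Rightarrow> real"
  shows "(LINT s:{0..d}|lborel. f s) = (LINT s:{0..d}|lborel. f (d - s))"
  unfolding set_lebesgue_integral_def
  by (subst lborel_integral_real_affine[where c="-1" and t=d])
    (auto intro!: Bochner_Integration.integral_cong simp: indicator_def)

text \<open>The right end point is left out because the grid projection jumps there.\<close>

lemma set_integral_cong_less:
  fixes f g :: "real \<Rightarrow> real"
  assumes "\<And>s. a \<le> s \<Longrightarrow> s < b \<Longrightarrow> f s = g s"
    and [measurable]: "f \<in> borel_measurable borel" "g \<in> borel_measurable borel"
  shows "(LINT s:{a..b}|lborel. f s) = (LINT s:{a..b}|lborel. g s)"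
proof (rule set_lebesgue_integral_cong_AE)
  show "AE x\<in>{a..b} in lborel. f x = g x"
    using AE_lborel_singleton[of b] by eventually_elim (use assms(1) in auto)
qed auto

lemma set_integral_combine:
  fixes f :: "real \<Rightarrow> real"
  assumes "a \<le> c" "c \<le> b" "set_integrable lborel {a..b} f"
  shows "(LINT s:{a..b}|lborel. f s) = (LINT s:{a..c}|lborel. f s) + (LINT s:{c..b}|lborel. f s)"
proof -
  have "(LINT s:{a..c} \<union> {c..b}|lborel. f s) = (LINT s:{a..c}|lborel. f s) + (LINT s:{c..b}|lborel. f s)"
  proof (rule set_integral_Un_AE)
    show "AE x in lborel. \<not> (x \<in> {a..c} \<and> x \<in> {c..b})"
      using AE_lborel_singleton[of c] by eventually_elim auto
    show "set_integrable lborel {a..c} f" "set_integrable lborel {c..b} f"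
      using assms by (auto intro: set_integrable_subset)
  qed auto
  moreover have "{a..c} \<union> {c..b} = {a..b}" using assms by auto
  ultimately show ?thesis by simp
qed

lemma set_integral_cells:
  fixes f :: "real \<Rightarrow> real"
  assumes "0 \<le> d" "set_integrable lborel {0..real K * d} f"
  shows "(LINT s:{0..real K * d}|lborel. f s) = (\<Sum>k<K. LINT s:{0..d}|lborel. f (real k * d + s))"
  using assms(2)
proof (induction K)
  case 0
  have "AE s in lborel. indicator {0..0::real} s *\<^sub>R f s = 0"
    using AE_lborel_singleton[of "0::real"] by eventually_elim auto
  then show ?case by (simp add: set_lebesgue_integral_def integral_eq_zero_AE)
next
  case (Suc K)
  have le: "real K * d \<le> real (Suc K) * d" "0 \<le> real K * d" using assms(1) by (auto intro: mult_right_mono)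
  have "(LINT s:{0..real (Suc K) * d}|lborel. f s) = (LINT s:{0..real K * d}|lborel. f s) + (LINT s:{real K * d..real (Suc K) * d}|lborel. f s)"
    using le Suc.prems by (intro set_integral_combine)
  also have "(LINT s:{0..real K * d}|lborel. f s) = (\<Sum>k<K. LINT s:{0..d}|lborel. f (real k * d + s))"
    using le by (intro Suc.IH set_integrable_subset[OF Suc.prems]) auto
  also have "(LINT s:{real K * d..real (Suc K) * d}|lborel. f s) = (LINT s:{0..d}|lborel. f (real K * d + s))"
    using set_integral_shift[of "real K * d" 0 d f] by (simp add: distrib_right add.commute)
  finally show ?case by simp
qed

text \<open>One predicate, stable under sums and scalar multiples, that yields integrability both of
  the sections and of the inner integral over bounded intervals; iterated integrals can then be
  split without further side conditions.\<close>

definition bdd_meas2 :: "(real \<Rightarrow> real \<Rightarrow> real) \<Rightarrow> bool" where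
  "bdd_meas2 f \<longleftrightarrow> (\<lambda>(x, y). f x y) \<in> borel_measurable (borel \<Otimes>\<^sub>M borel) \<and> (\<exists>c. \<forall>x y. \<bar>f x y\<bar> \<le> c)"

lemma bdd_meas2I:
  "(\<lambda>(x, y). f x y) \<in> borel_measurable (borel \<Otimes>\<^sub>M borel) \<Longrightarrow> (\<And>x y. \<bar>f x y\<bar> \<le> c) \<Longrightarrow> bdd_meas2 f"
  by (auto simp: bdd_meas2_def)

lemma bdd_meas2_add: "bdd_meas2 f \<Longrightarrow> bdd_meas2 g \<Longrightarrow> bdd_meas2 (\<lambda>x y. f x y + g x y)"
proof -
  assume "bdd_meas2 f" "bdd_meas2 g"
  then obtain c d where [measurable]: "(\<lambda>(x, y). f x y) \<in> borel_measurable (borel \<Otimes>\<^sub>M borel)" "(\<lambda>(x, y). g x y) \<in> borel_measurable (borel \<Otimes>\<^sub>M borel)"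
    and b: "\<And>x y. \<bar>f x y\<bar> \<le> c" "\<And>x y. \<bar>g x y\<bar> \<le> d" by (auto simp: bdd_meas2_def)
  show ?thesis
  proof (rule bdd_meas2I)
    show "(\<lambda>(x, y). f x y + g x y) \<in> borel_measurable (borel \<Otimes>\<^sub>M borel)" by measurable
    show "\<bar>f x y + g x y\<bar> \<le> c + d" for x y using b[where x=x and y=y] by linarith
  qed
qed

lemma bdd_meas2_sum: "finite I \<Longrightarrow> (\<And>i. i \<in> I \<Longrightarrow> bdd_meas2 (f i)) \<Longrightarrow> bdd_meas2 (\<lambda>x y. \<Sum>i\<in>I. f i x y)"
proof (induction I rule: finite_induct)
  case empty
  show ?case by (rule bdd_meas2I[where c=0]) auto
qed (auto intro!: bdd_meas2_add)

lemma bdd_meas2_integrable: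
  assumes "bdd_meas2 f"
  shows "set_integrable lborel {a..b} (f x)" "set_integrable lborel {a..b} (\<lambda>x. LINT y:{c..d}|lborel. f x y)"
proof -
  obtain k where m [measurable]: "(\<lambda>(x, y). f x y) \<in> borel_measurable (borel \<Otimes>\<^sub>M borel)" and b: "\<And>x y. \<bar>f x y\<bar> \<le> k"
    using assms by (auto simp: bdd_meas2_def)
  show "set_integrable lborel {a..b} (f x)"
    using b by (intro set_integrable_Icc_bounded[where c=k]) measurable
  show "set_integrable lborel {a..b} (\<lambda>x. LINT y:{c..d}|lborel. f x y)"
  proof (rule set_integrable_Icc_bounded)
    show "(\<lambda>x. LINT y:{c..d}|lborel. f x y) \<in> borel_measurable borel" by measurable
    fix x
    have "k \<ge> 0" using b[of x x] by linarith
    show "\<bar>LINT y:{c..d}|lborel. f x y\<bar> \<le> k * \<bar>d - c\<bar>"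
    proof (cases "c \<le> d")
      case True
      then show ?thesis using set_integral_abs_le_const[of c d "f x" k] b by simp
    next
      case False
      then show ?thesis using \<open>k \<ge> 0\<close> by (simp add: set_lebesgue_integral_def)
    qed
  qed
qed

lemma double_integral_add:
  assumes "bdd_meas2 f" "bdd_meas2 g"
  shows "(LINT x:{a..b}|lborel. LINT y:{c..d}|lborel. f x y + g x y)
    = (LINT x:{a..b}|lborel. LINT y:{c..d}|lborel. f x y) + (LINT x:{a..b}|lborel. LINT y:{c..d}|lborel. g x y)"
  using bdd_meas2_integrable[OF assms(1)] bdd_meas2_integrable[OF assms(2)] by simp

lemma double_integral_sum:
  assumes "finite I" "\<And>i. i \<in> I \<Longrightarrow> bdd_meas2 (f i)"
  shows "(LINT x:{a..b}|lborel. LINT y:{c..d}|lborel. (\<Sum>i\<in>I. f i x y))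
    = (\<Sum>i\<in>I. LINT x:{a..b}|lborel. LINT y:{c..d}|lborel. f i x y)"
  using assms
proof (induction I rule: finite_induct)
  case empty then show ?case by (simp add: set_lebesgue_integral_def)
next
  case (insert i I)
  then show ?case by (simp add: double_integral_add bdd_meas2_sum)
qed

lemma set_integral_finite_sum:
  fixes f :: "'i \<Rightarrow> 'b \<Rightarrow> real"
  assumes "\<And>i. i \<in> I \<Longrightarrow> set_integrable N A (f i)"
  shows "(LINT x:A|N. \<Sum>i\<in>I. f i x) = (\<Sum>i\<in>I. LINT x:A|N. f i x)"
  using assms unfolding set_lebesgue_integral_def set_integrable_def
  by (simp add: sum_distrib_left Bochner_Integration.integral_sum)

lemma bdd_meas2_cmult:
  assumes "bdd_meas2 f" shows "bdd_meas2 (\<lambda>x y. k * f x y)"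
proof -
  obtain c where [measurable]: "(\<lambda>(x, y). f x y) \<in> borel_measurable (borel \<Otimes>\<^sub>M borel)" and b: "\<And>x y. \<bar>f x y\<bar> \<le> c"
    using assms by (auto simp: bdd_meas2_def)
  show ?thesis
  proof (rule bdd_meas2I)
    show "\<bar>k * f x y\<bar> \<le> \<bar>k\<bar> * c" for x y
      unfolding abs_mult using b[of x y] by (intro mult_left_mono) auto
  qed measurable
qed

section \<open>Cell decomposition and symmetrisation of the delay integral\<close>

lemma grid_floor_cell:
  assumes "0 \<le> x" "x < d"
  shows "grid_floor d (real k * d + x) = real k * d"
proof -
  have "\<lfloor>(real k * d + x) / d\<rfloor> = int k"
    using assms by (intro floor_unique) (auto simp: field_simps)
  then show ?thesis by (simp add: grid_floor_def)
qed

lemma grid_floor_measurable [measurable]: "grid_floor d \<in> borel_measurable borel"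
  unfolding grid_floor_def[abs_def] by measurable

text \<open>On the cell (k, j) the bracket depends on x - y alone. The reflection (x, y) to (d - x,
  d - y) preserves the cell and changes the sign of x - y; averaging the integral with its
  reflection turns first differences into second ones and produces the factor 1/2.\<close>

lemma delay_integral_decomposition:
  fixes \<phi> g :: "real \<Rightarrow> real" and n K :: nat
  assumes \<phi> [measurable]: "\<phi> \<in> borel_measurable borel" and F: "\<And>x. \<bar>\<phi> x\<bar> \<le> F"
    and g [measurable]: "g \<in> borel_measurable borel" and G: "\<And>x. \<bar>g x\<bar> \<le> G"
    and n: "n \<ge> 1" and d: "0 < d" "real n * d = \<tau>"
  shows "(LINT s:{0..real K * d}|lborel. LINT r:{0..\<tau>}|lborel. (\<phi> (s - r) - \<phi> (grid_floor d s - grid_floor d r)) * g r)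
    = (LINT x:{0..d}|lborel. LINT y:{0..d}|lborel.
        (\<Sum>k<K. \<Sum>j<n. (\<phi> ((real k - real j) * d + (x - y)) - \<phi> ((real k - real j) * d)) * (g (real j * d + y) - g (real j * d)))
      + (\<Sum>j<n. g (real j * d) / 2 * (\<Sum>k<K. \<phi> ((real k - real j) * d + (x - y)) + \<phi> ((real k - real j) * d - (x - y)) - 2 * \<phi> ((real k - real j) * d))))"
    (is "?L = ?R")
proof -
  define p where "p k j x y = \<phi> ((real k - real j) * d + (x - y)) - \<phi> ((real k - real j) * d)" for k j x y
  define h where "h j y = g (real j * d + y)" for j y
  have p_bd: "\<bar>p k j x y\<bar> \<le> 2 * F" for k j x y
    using F[of "(real k - real j) * d + (x - y)"] F[of "(real k - real j) * d"] unfolding p_def by linarith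
  have F0: "0 \<le> F" using F[of 0] by linarith
  have p_meas [measurable]: "(\<lambda>(x, y). p k j x y) \<in> borel_measurable (borel \<Otimes>\<^sub>M borel)" for k j
    unfolding p_def by measurable
  have h_meas [measurable]: "h j \<in> borel_measurable borel" for j unfolding h_def[abs_def] by measurable
  have h_bd: "\<bar>h j y\<bar> \<le> G" for j y using G by (simp add: h_def)
  have pm: "bdd_meas2 (\<lambda>x y. p k j x y * f y)" if [measurable]: "f \<in> borel_measurable borel" and "\<And>y. \<bar>f y\<bar> \<le> c" for k j f c
  proof (rule bdd_meas2I)
    show "\<bar>p k j x y * f y\<bar> \<le> 2 * F * c" for x y
      unfolding abs_mult using p_bd[of k j x y] that(2)[of y] F0 by (intro mult_mono) auto
  qed measurable
  have bph: "bdd_meas2 (\<lambda>x y. p k j x y * h j y)" for k j by (rule pm[OF h_meas h_bd])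
  have bpd: "bdd_meas2 (\<lambda>x y. p k j x y * (h j y - h j 0))" for k j
  proof (rule pm)
    show "\<bar>h j y - h j 0\<bar> \<le> 2 * G" for y using h_bd[of j y] h_bd[of j 0] by linarith
  qed measurable
  have bpc: "bdd_meas2 (\<lambda>x y. p k j x y * h j 0)" for k j by (rule pm[where c=G]) (use h_bd in auto)
  have bpc': "bdd_meas2 (\<lambda>x y. p k j y x * h j 0)" for k j
  proof (rule bdd_meas2I)
    show "\<bar>p k j y x * h j 0\<bar> \<le> 2 * F * G" for x y
      unfolding abs_mult using p_bd[of k j y x] h_bd[of j 0] F0 by (intro mult_mono) auto
    show "(\<lambda>(x, y). p k j y x * h j 0) \<in> borel_measurable (borel \<Otimes>\<^sub>M borel)" unfolding p_def by measurable
  qed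
  let ?q = "\<lambda>s r. (\<phi> (s - r) - \<phi> (grid_floor d s - grid_floor d r)) * g r"
  have bq: "bdd_meas2 ?q"
  proof (rule bdd_meas2I)
    show "\<bar>?q s r\<bar> \<le> 2 * F * G" for s r
    proof -
      have "\<bar>\<phi> (s - r) - \<phi> (grid_floor d s - grid_floor d r)\<bar> \<le> 2 * F"
        using F[of "s - r"] F[of "grid_floor d s - grid_floor d r"] by linarith
      then show ?thesis unfolding abs_mult using G[of r] F0 by (intro mult_mono) auto
    qed
  qed measurable
  have cell: "?q (real k * d + x) (real j * d + y) = p k j x y * h j y"
    if "0 \<le> x" "x < d" "0 \<le> y" "y < d" for k j x y
  proof -
    have "real k * d + x - (real j * d + y) = (real k - real j) * d + (x - y)"
      "real k * d - real j * d = (real k - real j) * d" by (auto simp: algebra_simps)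
    then show ?thesis by (simp only: p_def h_def grid_floor_cell[OF that(1,2)] grid_floor_cell[OF that(3,4)])
  qed
  have inner: "(LINT r:{0..\<tau>}|lborel. ?q (real k * d + x) r) = (\<Sum>j<n. LINT y:{0..d}|lborel. p k j x y * h j y)"
    if "0 \<le> x" "x < d" for k x
  proof -
    have "(LINT r:{0..\<tau>}|lborel. ?q (real k * d + x) r) = (\<Sum>j<n. LINT y:{0..d}|lborel. ?q (real k * d + x) (real j * d + y))"
      unfolding d(2)[symmetric] using d bdd_meas2_integrable(1)[OF bq] by (intro set_integral_cells) auto
    also have "\<dots> = (\<Sum>j<n. LINT y:{0..d}|lborel. p k j x y * h j y)"
    proof (intro sum.cong refl set_integral_cong_less)
      show "(\<lambda>y. p k j x y * h j y) \<in> borel_measurable borel" for j unfolding p_def by measurable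
    qed (use cell that in auto)
    finally show ?thesis .
  qed
  have "?L = (\<Sum>k<K. LINT x:{0..d}|lborel. LINT r:{0..\<tau>}|lborel. ?q (real k * d + x) r)"
    using d bdd_meas2_integrable(2)[OF bq] by (intro set_integral_cells) auto
  also have "\<dots> = (\<Sum>k<K. LINT x:{0..d}|lborel. \<Sum>j<n. LINT y:{0..d}|lborel. p k j x y * h j y)"
    by (intro sum.cong refl set_integral_cong_less inner) measurable
  also have "\<dots> = (\<Sum>k<K. LINT x:{0..d}|lborel. LINT y:{0..d}|lborel. \<Sum>j<n. p k j x y * h j y)"
    using bdd_meas2_integrable(1)[OF bph] by (simp add: set_integral_finite_sum)
  also have "\<dots> = (LINT x:{0..d}|lborel. LINT y:{0..d}|lborel. \<Sum>k<K. \<Sum>j<n. p k j x y * h j y)"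
    by (subst double_integral_sum) (auto intro!: bdd_meas2_sum bph)
  also have "\<dots> = (LINT x:{0..d}|lborel. LINT y:{0..d}|lborel. (\<Sum>k<K. \<Sum>j<n. p k j x y * (h j y - h j 0)) + (\<Sum>k<K. \<Sum>j<n. p k j x y * h j 0))"
    by (simp add: sum.distrib[symmetric] algebra_simps)
  also have "\<dots> = (LINT x:{0..d}|lborel. LINT y:{0..d}|lborel. (\<Sum>k<K. \<Sum>j<n. p k j x y * (h j y - h j 0)))
      + (LINT x:{0..d}|lborel. LINT y:{0..d}|lborel. (\<Sum>k<K. \<Sum>j<n. p k j x y * h j 0))" (is "_ = ?A + ?B")
    by (intro double_integral_add bdd_meas2_sum bpd bpc) auto
  \<comment> \<open>Reflecting both variables replaces p k j x y by p k j y x, so ?B is the mean of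
    the two integrals.\<close>
  also have "?B = (LINT x:{0..d}|lborel. LINT y:{0..d}|lborel. (\<Sum>j<n. h j 0 / 2 * (\<Sum>k<K. p k j x y + p k j y x)))" (is "_ = ?C")
  proof -
    have "?B = (LINT x:{0..d}|lborel. LINT y:{0..d}|lborel. (\<Sum>k<K. \<Sum>j<n. p k j (d - x) (d - y) * h j 0))"
      by (subst set_integral_reflect_Icc, subst (2) set_integral_reflect_Icc) simp
    also have "\<dots> = (LINT x:{0..d}|lborel. LINT y:{0..d}|lborel. (\<Sum>k<K. \<Sum>j<n. p k j y x * h j 0))"
      by (simp add: p_def)
    finally have "?B + ?B = ?B + (LINT x:{0..d}|lborel. LINT y:{0..d}|lborel. (\<Sum>k<K. \<Sum>j<n. p k j y x * h j 0))" by simp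
    also have "\<dots> = (LINT x:{0..d}|lborel. LINT y:{0..d}|lborel. (\<Sum>k<K. \<Sum>j<n. p k j x y * h j 0) + (\<Sum>k<K. \<Sum>j<n. p k j y x * h j 0))"
      by (intro double_integral_add[symmetric] bdd_meas2_sum bpc bpc') auto
    also have "\<dots> = (LINT x:{0..d}|lborel. LINT y:{0..d}|lborel. 2 * (\<Sum>j<n. h j 0 / 2 * (\<Sum>k<K. p k j x y + p k j y x)))"
      by (subst (1 2) sum.swap) (simp add: sum.distrib[symmetric] sum_distrib_left distrib_right algebra_simps)
    also have "\<dots> = 2 * ?C" by simp
    finally show ?thesis by simp
  qed
  also have "?A + ?C = (LINT x:{0..d}|lborel. LINT y:{0..d}|lborel. (\<Sum>k<K. \<Sum>j<n. p k j x y * (h j y - h j 0)) + (\<Sum>j<n. h j 0 / 2 * (\<Sum>k<K. p k j x y + p k j y x)))"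
  proof (intro double_integral_add[symmetric] bdd_meas2_sum bpd)
    fix j
    have "bdd_meas2 (\<lambda>x y. 1/2 * (\<Sum>k<K. (p k j x y * h j 0 + p k j y x * h j 0)))"
      by (intro bdd_meas2_cmult bdd_meas2_sum bdd_meas2_add bpc bpc') auto
    moreover have "1/2 * (\<Sum>k<K. (p k j x y * h j 0 + p k j y x * h j 0)) = h j 0 / 2 * (\<Sum>k<K. p k j x y + p k j y x)" for x y
      by (simp add: sum_distrib_left algebra_simps)
    ultimately show "bdd_meas2 (\<lambda>x y. h j 0 / 2 * (\<Sum>k<K. p k j x y + p k j y x))"
      by simp
  qed auto
  also have "\<dots> = ?R"
  proof -
    have "p k j x y + p k j y x = \<phi> ((real k - real j) * d + (x - y)) + \<phi> ((real k - real j) * d - (x - y)) - 2 * \<phi> ((real k - real j) * d)" for k j x y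
      by (simp add: p_def algebra_simps)
    then show ?thesis by (simp add: p_def h_def)
  qed
  finally show ?thesis .
qed

section \<open>Regularity of the solution\<close>

lemma set_integral_exp:
  fixes c k t :: real
  assumes "0 < k" "0 \<le> t"
  shows "(LINT s:{0..t}|lborel. c * exp (k * s)) = c * (exp (k * t) - 1) / k"
proof -
  have "(\<integral>s. (c * exp (k * s)) * indicator {0..t} s \<partial>lborel) = c * exp (k * t) / k - c * exp (k * 0) / k"
    using assms by (intro integral_FTC_Icc_real[where F="\<lambda>s. c * exp (k * s) / k"])
      (auto intro!: derivative_eq_intros continuous_intros)
  moreover have "(LINT s:{0..t}|lborel. c * exp (k * s)) = (\<integral>s. (c * exp (k * s)) * indicator {0..t} s \<partial>lborel)"
    unfolding set_lebesgue_integral_def by (intro Bochner_Integration.integral_cong) auto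
  ultimately show ?thesis by (simp add: right_diff_distrib diff_divide_distrib)
qed

text \<open>Downgrades a Lipschitz increment to Hoelder order H on a bounded range.\<close>

lemma le_powr_mult:
  fixes x T H :: real
  assumes "0 \<le> x" "x \<le> T" "0 < H" "H \<le> 1" shows "x \<le> T powr (1 - H) * x powr H"
proof (cases "x = 0")
  case False
  have "x = x powr (1 - H) * x powr H" using False assms by (simp flip: powr_add)
  also have "\<dots> \<le> T powr (1 - H) * x powr H" using assms by (intro mult_right_mono powr_mono2) auto
  finally show ?thesis .
qed auto

text \<open>The analytic setting after all preparations. \<open>Y\<close> and \<open>B\<close> are
  versions of solution and noise with bounded continuous paths on the whole line for every outcome,
  so joint measurability and path integrals raise no exceptional sets; g is defined and Lipschitz
  everywhere. \<open>B\<close> is 0 at nonpositive times, so \<open>Y\<close> - \<open>B\<close>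
  equals the initial function there. The quantitative input on the noise is \<open>B_incr\<close>
  and \<open>B_incr2\<close>.\<close>

locale delay_em = prob_space M for M :: "'a measure" +
  fixes H \<tau> T G Lb X0 :: real and b b' g x0 :: "real \<Rightarrow> real" and Y B :: "real \<Rightarrow> 'a \<Rightarrow> real"
  assumes H: "1/2 < H" "H < 1" and \<tau>: "0 < \<tau>" and T: "0 < T"
    and Lb: "0 < Lb" and b_deriv: "\<And>x. (b has_real_derivative b' x) (at x)"
    and b'_le: "\<And>x. \<bar>b' x\<bar> \<le> Lb" and b'_lip: "\<And>x y. \<bar>b' x - b' y\<bar> \<le> Lb * \<bar>x - y\<bar>"
    and G: "0 < G" and g_le: "\<And>r. \<bar>g r\<bar> \<le> G" and g_lip: "\<And>r s. \<bar>g r - g s\<bar> \<le> G * \<bar>r - s\<bar>"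
    and X0: "0 < X0" and x0_le: "\<And>t. t \<in> {-\<tau>..0} \<Longrightarrow> \<bar>x0 t\<bar> \<le> X0"
    and x0_lip: "\<And>s t. s \<in> {-\<tau>..0} \<Longrightarrow> t \<in> {-\<tau>..0} \<Longrightarrow> \<bar>x0 t - x0 s\<bar> \<le> X0 * \<bar>t - s\<bar>"
    and x0_incr2: "\<And>t w. 0 \<le> w \<Longrightarrow> - \<tau> \<le> t - w \<Longrightarrow> t + w \<le> 0 \<Longrightarrow> \<bar>x0 (t + w) + x0 (t - w) - 2 * x0 t\<bar> \<le> X0 * w\<^sup>2"
    and Y_meas: "\<And>t. Y t \<in> borel_measurable M" and B_meas: "\<And>t. B t \<in> borel_measurable M"
    and Y_cont: "\<And>\<omega>. \<omega> \<in> space M \<Longrightarrow> continuous_on UNIV (\<lambda>t. Y t \<omega>)"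
    and B_cont: "\<And>\<omega>. \<omega> \<in> space M \<Longrightarrow> continuous_on UNIV (\<lambda>t. B t \<omega>)"
    and Y_bdd: "\<And>\<omega>. \<omega> \<in> space M \<Longrightarrow> \<exists>c. \<forall>t. \<bar>Y t \<omega>\<bar> \<le> c"
    and B_bdd: "\<And>\<omega>. \<omega> \<in> space M \<Longrightarrow> \<exists>c. \<forall>t. \<bar>B t \<omega>\<bar> \<le> c"
    and B_neg: "\<And>t \<omega>. t \<le> 0 \<Longrightarrow> \<omega> \<in> space M \<Longrightarrow> B t \<omega> = 0"
    and Y_eq: "AE \<omega> in M. \<forall>t\<in>{0..T}. Y t \<omega> = x0 0 + (LINT s:{0..t}|lborel. LINT r:{0..\<tau>}|lborel. b (Y (s - r) \<omega>) * g r) + B t \<omega>"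
    and Y_init: "AE \<omega> in M. \<forall>t\<in>{-\<tau>..0}. Y t \<omega> = x0 t"
    and B_incr: "\<And>q::nat. q \<ge> 1 \<Longrightarrow> \<exists>C>0. \<forall>s t. 0 \<le> s \<longrightarrow> s \<le> t \<longrightarrow> t \<le> T \<longrightarrow> Lq M q (\<lambda>\<omega>. B t \<omega> - B s \<omega>) (C * (t - s) powr H)"
    and B_incr2: "\<And>q::nat. q \<ge> 1 \<Longrightarrow> \<exists>C>0. \<forall>w D l m. 0 \<le> w \<longrightarrow> w \<le> D \<longrightarrow> 1 \<le> l \<longrightarrow> real m * D \<le> T \<longrightarrow>
       Lq M q (\<lambda>\<omega>. \<Sum>i\<in>{l..<m}. incr2 B (real i * D) w \<omega>) (C * D powr H * sqrt (real (m - l)))"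
begin

section \<open>Consequences of the smoothness of the coefficients\<close>

lemma prob_M: "prob_space M" by (rule prob_space_axioms)

lemma b_lip: "\<bar>b x - b y\<bar> \<le> Lb * \<bar>x - y\<bar>"
  using field_differentiable_bound[of UNIV b b' Lb x y] b_deriv b'_le by simp

lemma b_growth: "\<bar>b x\<bar> \<le> \<bar>b 0\<bar> + Lb * \<bar>x\<bar>"
  using b_lip[of x 0] by simp

text \<open>The mean value bound for u \<mapsto> b u - b' y u on the segment, where its derivative
  is at most Lb |h| by the Lipschitz continuity of b'.\<close>

lemma b_taylor: "\<bar>b (y + h) - b y - b' y * h\<bar> \<le> Lb * h\<^sup>2"
proof -
  have "norm ((\<lambda>u. b u - b' y * u) (y + h) - (\<lambda>u. b u - b' y * u) y) \<le> (Lb * \<bar>h\<bar>) * norm ((y + h) - y)"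
  proof (rule field_differentiable_bound[of "closed_segment y (y + h)" _ "\<lambda>u. b' u - b' y"])
    fix u assume u: "u \<in> closed_segment y (y + h)"
    show "((\<lambda>u. b u - b' y * u) has_field_derivative b' u - b' y) (at u within closed_segment y (y + h))"
      by (auto intro!: derivative_eq_intros has_field_derivative_at_within[OF b_deriv])
    have "\<bar>u - y\<bar> \<le> \<bar>h\<bar>" using u segment_bound(1)[OF u] by (simp add: norm_minus_commute)
    then have "Lb * \<bar>u - y\<bar> \<le> Lb * \<bar>h\<bar>" using Lb by (intro mult_left_mono) auto
    then show "norm (b' u - b' y) \<le> Lb * \<bar>h\<bar>" using b'_lip[of u y] by simp
  qed auto
  then show ?thesis by (simp add: algebra_simps power2_eq_square abs_mult_self_eq)
qed

lemma b_measurable [measurable]: "b \<in> borel_measurable borel"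
proof -
  have "continuous_on UNIV b"
    by (rule continuous_at_imp_continuous_on) (blast intro: DERIV_isCont b_deriv)
  then show ?thesis by (rule borel_measurable_continuous_onI)
qed

lemma lipschitz_measurable:
  fixes f :: "real \<Rightarrow> real" assumes "\<And>x y. \<bar>f x - f y\<bar> \<le> L * \<bar>x - y\<bar>" "0 < L"
  shows "f \<in> borel_measurable borel"
proof -
  have "L-lipschitz_on UNIV f"
    using assms by (intro lipschitz_onI) (simp_all add: dist_real_def)
  then show ?thesis by (rule borel_measurable_continuous_onI[OF lipschitz_on_continuous_on])
qed

lemma b'_measurable [measurable]: "b' \<in> borel_measurable borel"
  by (rule lipschitz_measurable[OF b'_lip Lb])

lemma g_measurable [measurable]: "g \<in> borel_measurable borel"
  by (rule lipschitz_measurable[OF g_lip G])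

lemma process_measurable:
  fixes Z :: "real \<Rightarrow> 'a \<Rightarrow> real"
  assumes "\<And>t. Z t \<in> borel_measurable M" "\<And>\<omega>. \<omega> \<in> space M \<Longrightarrow> continuous_on UNIV (\<lambda>t. Z t \<omega>)"
    and "f \<in> borel_measurable N" "h \<in> measurable N M"
  shows "(\<lambda>x. Z (f x) (h x)) \<in> borel_measurable N"
proof -
  have "(\<lambda>(t, \<omega>). Z t \<omega>) \<in> borel_measurable (borel \<Otimes>\<^sub>M M)"
    using assms(1,2) by (rule continuous_process_measurable)
  from measurable_compose[OF measurable_Pair[OF assms(3,4)] this] show ?thesis by simp
qed

lemmas Y_measurable [measurable (raw)] = process_measurable[OF Y_meas Y_cont]
lemmas B_measurable [measurable (raw)] = process_measurable[OF B_meas B_cont]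

definition drift :: "real \<Rightarrow> 'a \<Rightarrow> real" where
  "drift s \<omega> = (LINT r:{0..\<tau>}|lborel. b (Y (s - r) \<omega>) * g r)"

lemma drift_measurable [measurable (raw)]:
  assumes [measurable]: "f \<in> borel_measurable N" "h \<in> measurable N M"
  shows "(\<lambda>x. drift (f x) (h x)) \<in> borel_measurable N"
  unfolding drift_def by measurable

lemma bY_bdd: assumes "\<omega> \<in> space M" obtains c where "0 \<le> c" "\<And>t. \<bar>b (Y t \<omega>)\<bar> \<le> c"
proof -
  obtain c where c: "\<And>t. \<bar>Y t \<omega>\<bar> \<le> c" using Y_bdd[OF assms] by auto
  have "\<bar>b (Y t \<omega>)\<bar> \<le> \<bar>b 0\<bar> + Lb * c" for t
    using b_growth[of "Y t \<omega>"] mult_left_mono[OF c[of t], of Lb] Lb by linarith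
  moreover have "0 \<le> \<bar>b 0\<bar> + Lb * c" using calculation[of 0] by linarith
  ultimately show ?thesis using that by blast
qed

lemma Y_path_measurable: "\<omega> \<in> space M \<Longrightarrow> (\<lambda>t. Y t \<omega>) \<in> borel_measurable borel"
  by measurable

lemma drift_integrand_integrable:
  assumes [measurable]: "\<omega> \<in> space M"
  shows "set_integrable lborel {u..v} (\<lambda>r. b (Y (s - r) \<omega>) * g r)"
proof -
  obtain c where c: "0 \<le> c" "\<And>t. \<bar>b (Y t \<omega>)\<bar> \<le> c" using bY_bdd[OF assms] by blast
  show ?thesis
  proof (rule set_integrable_Icc_bounded)
    show "\<bar>b (Y (s - r) \<omega>) * g r\<bar> \<le> c * G" for r
      unfolding abs_mult using c g_le by (intro mult_mono) auto
  qed measurable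
qed

lemma drift_integrable:
  assumes [measurable]: "\<omega> \<in> space M"
  shows "set_integrable lborel {u..v} (\<lambda>s. drift s \<omega>)"
proof -
  obtain c where c: "0 \<le> c" "\<And>t. \<bar>b (Y t \<omega>)\<bar> \<le> c" using bY_bdd[OF assms] by blast
  show ?thesis
  proof (rule set_integrable_Icc_bounded)
    show "\<bar>drift s \<omega>\<bar> \<le> c * G * (\<tau> - 0)" for s
      unfolding drift_def using \<tau> c g_le by (intro set_integral_abs_le_const) (auto simp: abs_mult intro!: mult_mono)
  qed measurable
qed

lemma Y_eq_drift: "AE \<omega> in M. \<forall>t\<in>{0..T}. Y t \<omega> = x0 0 + (LINT s:{0..t}|lborel. drift s \<omega>) + B t \<omega>"
  using Y_eq by (simp add: drift_def)

lemma abs_B_path_measurable: "\<omega> \<in> space M \<Longrightarrow> (\<lambda>r. \<bar>B (s - r) \<omega>\<bar>) \<in> borel_measurable borel"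
  by (intro borel_measurable_abs B_measurable borel_measurable_diff borel_measurable_const
      measurable_ident_sets measurable_const) auto

lemma abs_B_integral_measurable: "\<omega> \<in> space M \<Longrightarrow> (\<lambda>s. LINT r:{0..\<tau>}|lborel. \<bar>B (s - r) \<omega>\<bar>) \<in> borel_measurable borel"
  by (intro set_integral_measurable_param) measurable

text \<open>An integral of the noise path instead of its supremum: moments of an integral follow
  from Minkowski's integral inequality, whereas a supremum would call for a maximal
  inequality.\<close>

definition noise_mass :: "'a \<Rightarrow> real" where
  "noise_mass \<omega> = (LINT s:{0..T}|lborel. LINT r:{0..\<tau>}|lborel. \<bar>B (s - r) \<omega>\<bar>)"

lemma noise_mass_measurable [measurable]: "noise_mass \<in> borel_measurable M"
  unfolding noise_mass_def[abs_def] by measurable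

text \<open>Gronwall's inequality in the form of a weighted supremum norm: the moments of the solution are not known
  to be finite beforehand, so the argument has to be pathwise.\<close>

lemma pathwise_bound:
  "\<exists>K>0. AE \<omega> in M. \<forall>t\<in>{-\<tau>..T}. \<bar>Y t \<omega> - B t \<omega>\<bar> \<le> K + K * noise_mass \<omega>"
proof -
  \<comment> \<open>With this rate the integral of G \<tau> Lb m e^(ks) over [0, t] is at most m
    e^(kt) / 2, and one half of m can be absorbed.\<close>
  define k where "k = 2 * G * \<tau> * Lb"
  have k: "0 < k" using G \<tau> Lb by (simp add: k_def)
  define A where "A = X0 + G * \<tau> * \<bar>b 0\<bar> * T"
  have A: "0 < A" using X0 G \<tau> T by (simp add: A_def add_pos_nonneg)
  define K where "K = (2 * A + X0 * exp (k * \<tau>) + 2 * G * Lb) * exp (k * T)"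
  have K: "0 < K" using A X0 G Lb by (simp add: K_def add_pos_pos)
  have "AE \<omega> in M. \<forall>t\<in>{-\<tau>..T}. \<bar>Y t \<omega> - B t \<omega>\<bar> \<le> K + K * noise_mass \<omega>"
    using Y_eq_drift Y_init AE_space
  proof eventually_elim
    case (elim \<omega>)
    note [measurable] = \<open>\<omega> \<in> space M\<close>
    obtain cB where cB: "\<And>t. \<bar>B t \<omega>\<bar> \<le> cB" using B_bdd[OF \<open>\<omega> \<in> space M\<close>] by blast
    define D where "D t = Y t \<omega> - B t \<omega>" for t
    have "continuous_on {-\<tau>..T} (\<lambda>t. exp (- k * t) * \<bar>D t\<bar>)"
      unfolding D_def using continuous_on_subset[OF Y_cont] continuous_on_subset[OF B_cont] elim
      by (intro continuous_intros) auto
    \<comment> \<open>For each fixed path the weighted supremum is attained, hence finite; this is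
      what makes the absorption legitimate.\<close>
    from continuous_attains_sup[OF compact_Icc _ this] \<tau> T obtain u where u: "u \<in> {-\<tau>..T}"
      and max: "\<And>t. t \<in> {-\<tau>..T} \<Longrightarrow> exp (- k * t) * \<bar>D t\<bar> \<le> exp (- k * u) * \<bar>D u\<bar>" by auto
    define m where "m = exp (- k * u) * \<bar>D u\<bar>"
    have m0: "0 \<le> m" by (simp add: m_def)
    have Dm: "\<bar>D t\<bar> \<le> m * exp (k * t)" if "t \<in> {-\<tau>..T}" for t
    proof -
      have "exp (k * t) * (exp (- k * t) * \<bar>D t\<bar>) \<le> exp (k * t) * m"
        unfolding m_def using max[OF that] by (intro mult_left_mono) auto
      moreover have "exp (k * t) * (exp (- k * t) * \<bar>D t\<bar>) = \<bar>D t\<bar>"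
        by (simp add: exp_minus)
      ultimately show ?thesis by (simp only: mult.commute)
    qed
    define Bs where "Bs s = (LINT r:{0..\<tau>}|lborel. \<bar>B (s - r) \<omega>\<bar>)" for s
    have Bs_int: "set_integrable lborel {0..\<tau>} (\<lambda>r. \<bar>B (s - r) \<omega>\<bar>)" for s
      by (rule set_integrable_Icc_bounded[OF abs_B_path_measurable[OF \<open>\<omega> \<in> space M\<close>], where c=cB]) (simp add: cB)
    have Bs_bd: "\<bar>Bs s\<bar> \<le> cB * (\<tau> - 0)" for s
      unfolding Bs_def using \<tau> by (intro set_integral_abs_le_const) (simp_all add: cB)
    have Bs_meas [measurable]: "Bs \<in> borel_measurable borel" unfolding Bs_def[abs_def]
      by (rule abs_B_integral_measurable[OF \<open>\<omega> \<in> space M\<close>])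
    have Bs_set: "set_integrable lborel {c..d} Bs" for c d
      by (rule set_integrable_Icc_bounded[OF Bs_meas Bs_bd])
    have Bs0: "0 \<le> Bs s" for s
      unfolding Bs_def set_lebesgue_integral_def by (intro integral_nonneg_AE AE_I2) (auto simp: indicator_def)
    have drift_le: "\<bar>drift s \<omega>\<bar> \<le> G * \<tau> * \<bar>b 0\<bar> + G * \<tau> * Lb * m * exp (k * s) + G * Lb * Bs s" if s: "s \<in> {0..T}" for s
    proof -
      have "\<bar>drift s \<omega>\<bar> \<le> (LINT r:{0..\<tau>}|lborel. (G * \<bar>b 0\<bar> + G * Lb * m * exp (k * s)) + G * Lb * \<bar>B (s - r) \<omega>\<bar>)"
        unfolding drift_def
      proof (rule set_integral_abs_le)
        show "set_integrable lborel {0..\<tau>} (\<lambda>r. (G * \<bar>b 0\<bar> + G * Lb * m * exp (k * s)) + G * Lb * \<bar>B (s - r) \<omega>\<bar>)"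
          by (intro set_integral_add(1) set_integrable_mult_right Bs_int set_integrable_Icc_bounded[OF _ order_refl]) auto
        fix r assume r: "r \<in> {0..\<tau>}"
        have "\<bar>D (s - r)\<bar> \<le> m * exp (k * (s - r))" using r s by (intro Dm) auto
        also have "\<dots> \<le> m * exp (k * s)" using m0 k r by (intro mult_left_mono) auto
        finally have "\<bar>Y (s - r) \<omega>\<bar> \<le> m * exp (k * s) + \<bar>B (s - r) \<omega>\<bar>" unfolding D_def by linarith
        then have "Lb * \<bar>Y (s - r) \<omega>\<bar> \<le> Lb * (m * exp (k * s) + \<bar>B (s - r) \<omega>\<bar>)" using Lb by (intro mult_left_mono) auto
        then have "\<bar>b (Y (s - r) \<omega>)\<bar> \<le> \<bar>b 0\<bar> + Lb * (m * exp (k * s) + \<bar>B (s - r) \<omega>\<bar>)" using b_growth[of "Y (s - r) \<omega>"] by linarith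
        then have "\<bar>b (Y (s - r) \<omega>) * g r\<bar> \<le> (\<bar>b 0\<bar> + Lb * (m * exp (k * s) + \<bar>B (s - r) \<omega>\<bar>)) * G"
          unfolding abs_mult using g_le[of r] Lb m0 by (intro mult_mono) auto
        then show "\<bar>b (Y (s - r) \<omega>) * g r\<bar> \<le> (G * \<bar>b 0\<bar> + G * Lb * m * exp (k * s)) + G * Lb * \<bar>B (s - r) \<omega>\<bar>"
          by (simp add: algebra_simps)
      qed
      also have "\<dots> = (LINT r:{0..\<tau>}|lborel. (G * \<bar>b 0\<bar> + G * Lb * m * exp (k * s))) + (LINT r:{0..\<tau>}|lborel. G * Lb * \<bar>B (s - r) \<omega>\<bar>)"
        by (intro set_integral_add(2) set_integrable_mult_right Bs_int set_integrable_Icc_bounded[OF _ order_refl]) auto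
      also have "\<dots> = G * \<tau> * \<bar>b 0\<bar> + G * \<tau> * Lb * m * exp (k * s) + G * Lb * Bs s"
        using \<tau> by (simp add: set_integral_Icc_const Bs_def algebra_simps)
      finally show ?thesis .
    qed
    have pos: "\<bar>D t\<bar> \<le> A + G * Lb * noise_mass \<omega> + m * exp (k * t) / 2" if t: "t \<in> {0..T}" for t
    proof -
      have exp_int: "set_integrable lborel {0..t} (\<lambda>s. G * \<tau> * Lb * m * exp (k * s))"
        by (intro borel_integrable_atLeastAtMost' continuous_intros)
      have c_int: "set_integrable lborel {0..t} (\<lambda>s. G * \<tau> * \<bar>b 0\<bar>)"
        by (intro set_integrable_Icc_bounded[OF _ order_refl]) auto
      have "\<bar>LINT s:{0..t}|lborel. drift s \<omega>\<bar> \<le> (LINT s:{0..t}|lborel. G * \<tau> * \<bar>b 0\<bar> + G * \<tau> * Lb * m * exp (k * s) + G * Lb * Bs s)"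
        using t by (intro set_integral_abs_le set_integral_add(1) exp_int c_int set_integrable_mult_right Bs_set drift_le) auto
      also have "\<dots> = (LINT s:{0..t}|lborel. G * \<tau> * \<bar>b 0\<bar>) + (LINT s:{0..t}|lborel. G * \<tau> * Lb * m * exp (k * s)) + (LINT s:{0..t}|lborel. G * Lb * Bs s)"
        using exp_int c_int Bs_set[of 0 t] by (simp add: set_integral_add)
      also have "(LINT s:{0..t}|lborel. G * \<tau> * \<bar>b 0\<bar>) \<le> G * \<tau> * \<bar>b 0\<bar> * T"
      proof -
        have "(LINT s:{0..t}|lborel. G * \<tau> * \<bar>b 0\<bar>) = G * \<tau> * \<bar>b 0\<bar> * (t - 0)"
          by (rule set_integral_Icc_const) (use t in simp)
        also have "\<dots> \<le> G * \<tau> * \<bar>b 0\<bar> * T" using t G \<tau> by (intro mult_left_mono) auto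
        finally show ?thesis .
      qed
      also have "(LINT s:{0..t}|lborel. G * \<tau> * Lb * m * exp (k * s)) \<le> m * exp (k * t) / 2"
      proof -
        have "(LINT s:{0..t}|lborel. G * \<tau> * Lb * m * exp (k * s)) = G * \<tau> * Lb * m * (exp (k * t) - 1) / k"
          using t k by (intro set_integral_exp) auto
        also have "\<dots> = m * (exp (k * t) - 1) / 2" using G \<tau> Lb by (simp add: k_def)
        also have "\<dots> \<le> m * exp (k * t) / 2" using m0 by (simp add: mult_left_mono divide_right_mono)
        finally show ?thesis .
      qed
      also have "(LINT s:{0..t}|lborel. G * Lb * Bs s) \<le> G * Lb * noise_mass \<omega>"
      proof -
        have "noise_mass \<omega> = (LINT s:{0..t}|lborel. Bs s) + (LINT s:{t..T}|lborel. Bs s)"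
          unfolding noise_mass_def Bs_def[symmetric] using t Bs_set by (intro set_integral_combine) auto
        moreover have "0 \<le> (LINT s:{t..T}|lborel. Bs s)"
          unfolding set_lebesgue_integral_def using Bs0 by (intro integral_nonneg_AE AE_I2) (auto simp: indicator_def)
        ultimately show ?thesis using G Lb by (simp add: mult_left_mono)
      qed
      finally have "\<bar>LINT s:{0..t}|lborel. drift s \<omega>\<bar> \<le> G * \<tau> * \<bar>b 0\<bar> * T + m * exp (k * t) / 2 + G * Lb * noise_mass \<omega>" by simp
      moreover have "D t = x0 0 + (LINT s:{0..t}|lborel. drift s \<omega>)" using elim t by (simp add: D_def)
      moreover have "\<bar>x0 0\<bar> \<le> X0" using x0_le[of 0] \<tau> by simp
      ultimately show ?thesis unfolding A_def by linarith
    qed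
    have N0: "0 \<le> noise_mass \<omega>"
      unfolding noise_mass_def Bs_def[symmetric] set_lebesgue_integral_def using Bs0
      by (intro integral_nonneg_AE AE_I2) (auto simp: indicator_def)
    \<comment> \<open>If the maximum lies at a nonnegative time, the integral inequality gives m
      \<le> (constant) + m / 2; at a negative time the weighted value is a value of the initial
      function.\<close>
    have mle: "m \<le> 2 * (A + G * Lb * noise_mass \<omega>) + X0 * exp (k * \<tau>)"
    proof (cases "0 \<le> u")
      case True
      have e1: "exp (- k * u) \<le> 1" using True k by simp
      have "exp (- k * u) * \<bar>D u\<bar> \<le> exp (- k * u) * (A + G * Lb * noise_mass \<omega> + m * exp (k * u) / 2)"
        using pos[of u] u True by (intro mult_left_mono) auto
      then have "m \<le> exp (- k * u) * (A + G * Lb * noise_mass \<omega> + m * exp (k * u) / 2)"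
        by (simp only: m_def[symmetric])
      also have "\<dots> = exp (- k * u) * (A + G * Lb * noise_mass \<omega>) + m / 2"
        by (simp add: distrib_left exp_minus field_simps)
      also have "\<dots> \<le> 1 * (A + G * Lb * noise_mass \<omega>) + m / 2"
        using e1 A G Lb N0 by (intro add_right_mono mult_right_mono) auto
      finally have "m \<le> 2 * (A + G * Lb * noise_mass \<omega>)" by simp
      moreover have "0 \<le> X0 * exp (k * \<tau>)" using X0 by simp
      ultimately show ?thesis by linarith
    next
      case False
      then have "D u = x0 u" using elim u by (simp add: D_def B_neg)
      then have "\<bar>D u\<bar> \<le> X0" using x0_le[of u] u False by auto
      moreover have "exp (- k * u) \<le> exp (k * \<tau>)"
        using u k mult_left_mono[of "- u" \<tau> k] by auto
      ultimately have "m \<le> exp (k * \<tau>) * X0" unfolding m_def by (intro mult_mono) auto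
      moreover have "0 \<le> A + G * Lb * noise_mass \<omega>" using A G Lb N0 by simp
      ultimately show ?thesis by (simp add: mult.commute)
    qed
    show ?case
    proof
      fix t assume t: "t \<in> {-\<tau>..T}"
      have "\<bar>D t\<bar> \<le> m * exp (k * t)" using Dm t by auto
      also have "\<dots> \<le> m * exp (k * T)" using t k m0 by (intro mult_left_mono) auto
      also have "\<dots> \<le> (2 * (A + G * Lb * noise_mass \<omega>) + X0 * exp (k * \<tau>)) * exp (k * T)"
        using mle by (intro mult_right_mono) auto
      also have "\<dots> \<le> K + K * noise_mass \<omega>"
      proof -
        have "(2 * A + X0 * exp (k * \<tau>)) * exp (k * T) \<le> K" "2 * G * Lb * exp (k * T) \<le> K"
          unfolding K_def using A X0 G Lb by (auto intro!: mult_right_mono)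
        from this(1) mult_right_mono[OF this(2) N0] show ?thesis by (simp add: algebra_simps)
      qed
      finally show "\<bar>Y t \<omega> - B t \<omega>\<bar> \<le> K + K * noise_mass \<omega>" by (simp add: D_def)
    qed
  qed
  with K show ?thesis by blast
qed

section \<open>Moments of the solution, of the drift and of their increments\<close>

lemma Lq_B:
  assumes q: "(q::nat) \<ge> 1" shows "\<exists>C>0. \<forall>t\<le>T. Lq M q (B t) C"
proof -
  obtain C where C: "C > 0" "\<And>s t. 0 \<le> s \<Longrightarrow> s \<le> t \<Longrightarrow> t \<le> T \<Longrightarrow> Lq M q (\<lambda>\<omega>. B t \<omega> - B s \<omega>) (C * (t - s) powr H)"
    using B_incr[OF q] by blast
  have "Lq M q (B t) (C * T powr H)" if "t \<le> T" for t
  proof (cases "0 \<le> t")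
    case True
    have "Lq M q (\<lambda>\<omega>. B t \<omega> - B 0 \<omega>) (C * T powr H)"
      by (rule Lq_mono[OF C(2)]) (use C(1) True that H in \<open>auto intro!: mult_left_mono powr_mono2\<close>)
    then show ?thesis by (rule Lq_cong_AE) (auto simp: B_neg B_meas)
  next
    case False
    have "Lq M q (\<lambda>_. 0) (C * T powr H)" using q C(1) by (intro Lq_zero) auto
    then show ?thesis by (rule Lq_cong_AE) (use False in \<open>auto simp: B_neg B_meas\<close>)
  qed
  then show ?thesis using C(1) T by (intro exI[of _ "C * T powr H"]) auto
qed

text \<open>Turns the pathwise bound into moments; \<open>noise_mass\<close> is a double integral,
  so Minkowski's integral inequality is applied twice.\<close>

lemma Lq_Y:
  assumes q: "(q::nat) \<ge> 1" shows "\<exists>C>0. \<forall>t\<in>{-\<tau>..T}. Lq M q (Y t) C"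
proof -
  obtain C where C: "C > 0" "\<And>t. t \<le> T \<Longrightarrow> Lq M q (B t) C" using Lq_B[OF q] by blast
  obtain K where K: "K > 0" "AE \<omega> in M. \<forall>t\<in>{-\<tau>..T}. \<bar>Y t \<omega> - B t \<omega>\<bar> \<le> K + K * noise_mass \<omega>"
    using pathwise_bound by blast
  have inner: "Lq M q (\<lambda>\<omega>. LINT r:{0..\<tau>}|lborel. \<bar>B (s - r) \<omega>\<bar>) (C * (\<tau> - 0))" if "s \<le> T" for s
  proof (rule Lq_set_integral_const[OF prob_M _ _ C(1) _ q])
    show "(\<lambda>(r, \<omega>). \<bar>B (s - r) \<omega>\<bar>) \<in> borel_measurable (borel \<Otimes>\<^sub>M M)" by measurable
    show "Lq M q (\<lambda>\<omega>. \<bar>B (s - r) \<omega>\<bar>) C" if "r \<in> {0<..<\<tau>}" for r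
      using that \<open>s \<le> T\<close> by (intro Lq_abs C(2)) auto
  qed (use \<tau> in auto)
  have N: "Lq M q noise_mass (C * (\<tau> - 0) * (T - 0))"
    unfolding noise_mass_def[abs_def]
  proof (rule Lq_set_integral_const[OF prob_M _ _ _ _ q])
    show "(\<lambda>(s, \<omega>). LINT r:{0..\<tau>}|lborel. \<bar>B (s - r) \<omega>\<bar>) \<in> borel_measurable (borel \<Otimes>\<^sub>M M)" by measurable
  qed (use inner \<tau> T C in auto)
  let ?c = "C + (K + \<bar>K\<bar> * (C * (\<tau> - 0) * (T - 0)))"
  have "Lq M q (Y t) ?c" if t: "t \<in> {-\<tau>..T}" for t
  proof (rule Lq_mono_AE[OF _ Y_meas _ order_refl])
    show "Lq M q (\<lambda>\<omega>. \<bar>B t \<omega>\<bar> + (K + K * noise_mass \<omega>)) ?c"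
      using t K(1) by (intro Lq_add q Lq_abs C(2) Lq_cmult N Lq_bounded) auto
    show "AE \<omega> in M. \<bar>Y t \<omega>\<bar> \<le> \<bar>\<bar>B t \<omega>\<bar> + (K + K * noise_mass \<omega>)\<bar>"
      using K(2) by eventually_elim (use t in force)
  qed
  moreover have "0 < ?c" using C K \<tau> T by (intro add_pos_nonneg) auto
  ultimately show ?thesis by blast
qed

lemma Lq_drift:
  assumes q: "(q::nat) \<ge> 1" shows "\<exists>C>0. \<forall>s\<in>{0..T}. Lq M q (drift s) C"
proof -
  obtain C where C: "C > 0" "\<And>t. t \<in> {-\<tau>..T} \<Longrightarrow> Lq M q (Y t) C" using Lq_Y[OF q] by blast
  let ?c = "G * (\<bar>b 0\<bar> + Lb * C)"
  have c: "0 < ?c" using G Lb C by (simp add: add_nonneg_pos)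
  have "Lq M q (drift s) (?c * (\<tau> - 0))" if s: "s \<in> {0..T}" for s
    unfolding drift_def[abs_def]
  proof (rule Lq_set_integral_const[OF prob_M _ _ c _ q])
    fix r assume r: "r \<in> {0<..<\<tau>}"
    show "Lq M q (\<lambda>\<omega>. b (Y (s - r) \<omega>) * g r) ?c"
    proof (rule Lq_mono_AE[OF _ _ _ order_refl])

      show "Lq M q (\<lambda>\<omega>. G * (\<bar>b 0\<bar> + Lb * \<bar>Y (s - r) \<omega>\<bar>)) ?c"
        using r s Lb G by (intro Lq_cmult_le Lq_add q C(2) Lq_abs Lq_bounded) auto
      show "AE \<omega> in M. \<bar>b (Y (s - r) \<omega>) * g r\<bar> \<le> \<bar>G * (\<bar>b 0\<bar> + Lb * \<bar>Y (s - r) \<omega>\<bar>)\<bar>"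
      proof (intro AE_I2)
        fix \<omega>
        have "\<bar>b (Y (s - r) \<omega>)\<bar> * \<bar>g r\<bar> \<le> (\<bar>b 0\<bar> + Lb * \<bar>Y (s - r) \<omega>\<bar>) * G"
          using b_growth[of "Y (s - r) \<omega>"] g_le[of r] by (intro mult_mono) auto
        then show "\<bar>b (Y (s - r) \<omega>) * g r\<bar> \<le> \<bar>G * (\<bar>b 0\<bar> + Lb * \<bar>Y (s - r) \<omega>\<bar>)\<bar>"
          using G Lb by (simp add: abs_mult mult.commute)
      qed
    qed measurable
  qed (use \<tau> in auto)
  then show ?thesis using c \<tau> by (intro exI[of _ "?c * (\<tau> - 0)"]) auto
qed

lemma drift_integral_diff:
  "AE \<omega> in M. \<forall>s t. 0 \<le> s \<longrightarrow> s \<le> t \<longrightarrow> t \<le> T \<longrightarrow> (Y t \<omega> - B t \<omega>) - (Y s \<omega> - B s \<omega>) = (LINT u:{s..t}|lborel. drift u \<omega>)"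
  using Y_eq_drift AE_space
proof eventually_elim
  case (elim \<omega>)
  show ?case
  proof (intro allI impI)
    fix s t assume st: "0 \<le> s" "s \<le> t" "t \<le> T"
    have "(LINT u:{0..t}|lborel. drift u \<omega>) = (LINT u:{0..s}|lborel. drift u \<omega>) + (LINT u:{s..t}|lborel. drift u \<omega>)"
      using st drift_integrable elim by (intro set_integral_combine) auto
    moreover have "s \<in> {0..T}" "t \<in> {0..T}" using st by auto
    ultimately show "(Y t \<omega> - B t \<omega>) - (Y s \<omega> - B s \<omega>) = (LINT u:{s..t}|lborel. drift u \<omega>)"
      using elim by simp
  qed
qed

text \<open>After time 0 the drift integral is Lipschitz in the moments and the noise has order H;
  before time 0 the initial function is Lipschitz. An increment across 0 is split there, which costs
  the factor 2.\<close>

lemma Lq_Y_incr: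
  assumes q: "(q::nat) \<ge> 1"
  shows "\<exists>C>0. \<forall>s\<in>{-\<tau>..T}. \<forall>t\<in>{-\<tau>..T}. Lq M q (\<lambda>\<omega>. Y t \<omega> - Y s \<omega>) (C * \<bar>t - s\<bar> powr H)"
proof -
  obtain C1 where C1: "C1 > 0" "\<And>s. s \<in> {0..T} \<Longrightarrow> Lq M q (drift s) C1" using Lq_drift[OF q] by blast
  obtain C2 where C2: "C2 > 0" "\<And>s t. 0 \<le> s \<Longrightarrow> s \<le> t \<Longrightarrow> t \<le> T \<Longrightarrow> Lq M q (\<lambda>\<omega>. B t \<omega> - B s \<omega>) (C2 * (t - s) powr H)"
    using B_incr[OF q] by blast
  define C where "C = C1 * T powr (1 - H) + C2 + X0 * \<tau> powr (1 - H)"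
  have C: "0 < C" "C1 * T powr (1 - H) + C2 \<le> C" "X0 * \<tau> powr (1 - H) \<le> C"
  proof -
    have "0 < C1 * T powr (1 - H)" "0 < X0 * \<tau> powr (1 - H)" using C1 X0 T \<tau> by auto
    then show "0 < C" "C1 * T powr (1 - H) + C2 \<le> C" "X0 * \<tau> powr (1 - H) \<le> C"
      unfolding C_def using C2 by linarith+
  qed
  have pos: "Lq M q (\<lambda>\<omega>. Y t \<omega> - Y s \<omega>) (C * (t - s) powr H)" if st: "0 \<le> s" "s \<le> t" "t \<le> T" for s t
  proof -
    have "Lq M q (\<lambda>\<omega>. (LINT u:{s..t}|lborel. drift u \<omega>) + (B t \<omega> - B s \<omega>)) (C1 * (t - s) + C2 * (t - s) powr H)"
      using st C1 by (intro Lq_add q C2(2) Lq_set_integral_const prob_M C1(2)) auto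
    then have "Lq M q (\<lambda>\<omega>. Y t \<omega> - Y s \<omega>) (C1 * (t - s) + C2 * (t - s) powr H)"
    proof (rule Lq_cong_AE)
      show "AE \<omega> in M. Y t \<omega> - Y s \<omega> = (LINT u:{s..t}|lborel. drift u \<omega>) + (B t \<omega> - B s \<omega>)"
        using drift_integral_diff by eventually_elim (use st in force)
    qed measurable
    moreover have "C1 * (t - s) + C2 * (t - s) powr H \<le> C * (t - s) powr H"
    proof -
      have "C1 * (t - s) \<le> C1 * (T powr (1 - H) * (t - s) powr H)"
        using st H C1 by (intro mult_left_mono le_powr_mult) auto
      moreover have "(C1 * T powr (1 - H) + C2) * (t - s) powr H \<le> C * (t - s) powr H"
        using C(2) by (intro mult_right_mono) auto
      ultimately show ?thesis by (simp add: algebra_simps)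
    qed
    ultimately show ?thesis by (rule Lq_mono)
  qed
  have neg: "Lq M q (\<lambda>\<omega>. Y t \<omega> - Y s \<omega>) (C * (t - s) powr H)" if st: "-\<tau> \<le> s" "s \<le> t" "t \<le> 0" for s t
  proof (rule Lq_bounded)
    show "AE \<omega> in M. \<bar>Y t \<omega> - Y s \<omega>\<bar> \<le> C * (t - s) powr H"
      using Y_init
    proof eventually_elim
      case (elim \<omega>)
      have "\<bar>Y t \<omega> - Y s \<omega>\<bar> \<le> X0 * \<bar>t - s\<bar>" using elim st x0_lip[of s t] by auto
      also have "\<dots> \<le> X0 * (\<tau> powr (1 - H) * (t - s) powr H)"
        using st H X0 le_powr_mult[of "t - s" \<tau> H] by (intro mult_left_mono) auto
      also have "\<dots> \<le> C * (t - s) powr H" using C(3) by (simp add: mult.assoc[symmetric] mult_right_mono)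
      finally show ?case .
    qed
  qed (use C in auto)
  have le: "Lq M q (\<lambda>\<omega>. Y t \<omega> - Y s \<omega>) (2 * C * (t - s) powr H)" if st: "-\<tau> \<le> s" "s \<le> t" "t \<le> T" for s t
  proof -
    have C2: "C * (t - s) powr H \<le> 2 * C * (t - s) powr H" using C(1) by (intro mult_right_mono) auto
    consider "0 \<le> s" | "t \<le> 0" | "s \<le> 0" "0 \<le> t" by linarith
    then show ?thesis
    proof cases
      case 1 then show ?thesis using Lq_mono[OF pos C2] st by auto
    next
      case 2 then show ?thesis using Lq_mono[OF neg C2] st by auto
    next
      case 3
      have "Lq M q (\<lambda>\<omega>. (Y t \<omega> - Y 0 \<omega>) + (Y 0 \<omega> - Y s \<omega>)) (C * (t - 0) powr H + C * (0 - s) powr H)"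
        using 3 st by (intro Lq_add q pos neg) auto
      then have "Lq M q (\<lambda>\<omega>. Y t \<omega> - Y s \<omega>) (C * (t - 0) powr H + C * (0 - s) powr H)" by simp
      moreover have "C * (t - 0) powr H + C * (0 - s) powr H \<le> C * (t - s) powr H + C * (t - s) powr H"
        using 3 H C(1) by (intro add_mono mult_left_mono powr_mono2) auto
      ultimately show ?thesis by (rule Lq_mono[OF _ order_trans]) simp
    qed
  qed
  show ?thesis
  proof (intro exI[of _ "2 * C"] conjI ballI)
    fix s t assume st: "s \<in> {-\<tau>..T}" "t \<in> {-\<tau>..T}"
    show "Lq M q (\<lambda>\<omega>. Y t \<omega> - Y s \<omega>) (2 * C * \<bar>t - s\<bar> powr H)"
    proof (cases "s \<le> t")
      case True then show ?thesis using le[of s t] st by auto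
    next
      case False
      then have "Lq M q (\<lambda>\<omega>. - (Y s \<omega> - Y t \<omega>)) (2 * C * (s - t) powr H)"
        using st by (intro Lq_minus le) auto
      then show ?thesis using False by (simp add: abs_minus_commute)
    qed
  qed (use C in auto)
qed

lemma Lq_bY_incr:
  assumes q: "(q::nat) \<ge> 1"
  shows "\<exists>C>0. \<forall>s\<in>{-\<tau>..T}. \<forall>t\<in>{-\<tau>..T}. Lq M q (\<lambda>\<omega>. b (Y t \<omega>) - b (Y s \<omega>)) (C * \<bar>t - s\<bar> powr H)"
proof -
  obtain C where C: "C > 0" "\<And>s t. s \<in> {-\<tau>..T} \<Longrightarrow> t \<in> {-\<tau>..T} \<Longrightarrow> Lq M q (\<lambda>\<omega>. Y t \<omega> - Y s \<omega>) (C * \<bar>t - s\<bar> powr H)"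
    using Lq_Y_incr[OF q] by blast
  have "Lq M q (\<lambda>\<omega>. b (Y t \<omega>) - b (Y s \<omega>)) (Lb * C * \<bar>t - s\<bar> powr H)" if "s \<in> {-\<tau>..T}" "t \<in> {-\<tau>..T}" for s t
  proof (rule Lq_mono_AE[OF Lq_cmult[OF C(2)[OF that], of Lb]])
    show "AE \<omega> in M. \<bar>b (Y t \<omega>) - b (Y s \<omega>)\<bar> \<le> \<bar>Lb * (Y t \<omega> - Y s \<omega>)\<bar>"
      using b_lip Lb by (auto simp: abs_mult)
  qed (use Lb in auto)
  then show ?thesis using C(1) Lb by (intro exI[of _ "Lb * C"]) auto
qed

text \<open>Both times are shifted by the same delay r, so the order H of b(Y) passes through the
  delay integral. The drift part \<open>Y\<close> - \<open>B\<close> thus gains one derivative of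
  order H.\<close>

lemma Lq_drift_incr:
  assumes q: "(q::nat) \<ge> 1"
  shows "\<exists>C>0. \<forall>s\<in>{0..T}. \<forall>t\<in>{0..T}. Lq M q (\<lambda>\<omega>. drift t \<omega> - drift s \<omega>) (C * \<bar>t - s\<bar> powr H)"
proof -
  obtain C where C: "C > 0" "\<And>s t. s \<in> {-\<tau>..T} \<Longrightarrow> t \<in> {-\<tau>..T} \<Longrightarrow> Lq M q (\<lambda>\<omega>. b (Y t \<omega>) - b (Y s \<omega>)) (C * \<bar>t - s\<bar> powr H)"
    using Lq_bY_incr[OF q] by blast
  have "Lq M q (\<lambda>\<omega>. drift t \<omega> - drift s \<omega>) (\<tau> * G * C * \<bar>t - s\<bar> powr H)" if st: "s \<in> {0..T}" "t \<in> {0..T}" for s t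
  proof (cases "s = t")
    case True
    then show ?thesis using \<tau> G C q by (auto intro!: Lq_zero)
  next
    case False
    let ?c = "G * (C * \<bar>t - s\<bar> powr H)"
    have c: "0 < ?c" using False G C by simp
    have "Lq M q (\<lambda>\<omega>. LINT r:{0..\<tau>}|lborel. g r * (b (Y (t - r) \<omega>) - b (Y (s - r) \<omega>))) (?c * (\<tau> - 0))"
    proof (rule Lq_set_integral_const[OF prob_M _ _ c _ q])
      fix r assume r: "r \<in> {0<..<\<tau>}"
      have "Lq M q (\<lambda>\<omega>. b (Y (t - r) \<omega>) - b (Y (s - r) \<omega>)) (C * \<bar>(t - r) - (s - r)\<bar> powr H)"
        using r st by (intro C(2)) auto
      then show "Lq M q (\<lambda>\<omega>. g r * (b (Y (t - r) \<omega>) - b (Y (s - r) \<omega>))) ?c"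
        using g_le by (intro Lq_cmult_le) auto
    qed (use \<tau> in auto)
    then have "Lq M q (\<lambda>\<omega>. drift t \<omega> - drift s \<omega>) (?c * (\<tau> - 0))"
    proof (rule Lq_cong_AE)
      show "AE \<omega> in M. drift t \<omega> - drift s \<omega> = (LINT r:{0..\<tau>}|lborel. g r * (b (Y (t - r) \<omega>) - b (Y (s - r) \<omega>)))"
      proof (rule AE_I2)
        fix \<omega> assume w: "\<omega> \<in> space M"
        have "drift t \<omega> - drift s \<omega> = (LINT r:{0..\<tau>}|lborel. b (Y (t - r) \<omega>) * g r - b (Y (s - r) \<omega>) * g r)"
          unfolding drift_def by (rule set_integral_diff(2)[symmetric]) (intro drift_integrand_integrable w)+
        then show "drift t \<omega> - drift s \<omega> = (LINT r:{0..\<tau>}|lborel. g r * (b (Y (t - r) \<omega>) - b (Y (s - r) \<omega>)))"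
          by (simp add: algebra_simps)
      qed
    qed measurable
    then show ?thesis by (simp add: mult_ac)
  qed
  then show ?thesis using C(1) G \<tau> by (intro exI[of _ "\<tau> * G * C"]) auto
qed

text \<open>The second difference of \<open>Y\<close> - \<open>B\<close> is the integral over
  [t, t + w] of drift s - drift (s - w): length w times increments of order w^H. The condition w
  \<le> t keeps all times nonnegative, where the equation holds.\<close>

lemma Lq_smooth_incr2:
  assumes q: "(q::nat) \<ge> 1"
  shows "\<exists>C>0. \<forall>t w. 0 < w \<longrightarrow> w \<le> t \<longrightarrow> t + w \<le> T \<longrightarrow>
     Lq M q (\<lambda>\<omega>. (Y (t + w) \<omega> - B (t + w) \<omega>) + (Y (t - w) \<omega> - B (t - w) \<omega>) - 2 * (Y t \<omega> - B t \<omega>)) (C * w powr (1 + H))"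
proof -
  obtain C where C: "C > 0" "\<And>s t. s \<in> {0..T} \<Longrightarrow> t \<in> {0..T} \<Longrightarrow> Lq M q (\<lambda>\<omega>. drift t \<omega> - drift s \<omega>) (C * \<bar>t - s\<bar> powr H)"
    using Lq_drift_incr[OF q] by blast
  have "Lq M q (\<lambda>\<omega>. (Y (t + w) \<omega> - B (t + w) \<omega>) + (Y (t - w) \<omega> - B (t - w) \<omega>) - 2 * (Y t \<omega> - B t \<omega>)) (C * w powr (1 + H))"
    if w: "0 < w" "w \<le> t" "t + w \<le> T" for t w
  proof -
    have c: "0 < C * w powr H" using C w by simp
    have "Lq M q (\<lambda>\<omega>. LINT s:{t..t + w}|lborel. drift s \<omega> - drift (s - w) \<omega>) (C * w powr H * (t + w - t))"
    proof (rule Lq_set_integral_const[OF prob_M _ _ c _ q])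
      fix s assume "s \<in> {t<..<t + w}"
      then have "Lq M q (\<lambda>\<omega>. drift s \<omega> - drift (s - w) \<omega>) (C * \<bar>s - (s - w)\<bar> powr H)"
        using w by (intro C(2)) auto
      then show "Lq M q (\<lambda>\<omega>. drift s \<omega> - drift (s - w) \<omega>) (C * w powr H)" using w by simp
    qed (use w in auto)
    then have "Lq M q (\<lambda>\<omega>. (Y (t + w) \<omega> - B (t + w) \<omega>) + (Y (t - w) \<omega> - B (t - w) \<omega>) - 2 * (Y t \<omega> - B t \<omega>)) (C * w powr H * (t + w - t))"
    proof (rule Lq_cong_AE)
      show "AE \<omega> in M. (Y (t + w) \<omega> - B (t + w) \<omega>) + (Y (t - w) \<omega> - B (t - w) \<omega>) - 2 * (Y t \<omega> - B t \<omega>)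
          = (LINT s:{t..t + w}|lborel. drift s \<omega> - drift (s - w) \<omega>)"
        using drift_integral_diff AE_space
      proof eventually_elim
        case (elim \<omega>)
        have "(Y (t + w) \<omega> - B (t + w) \<omega>) - (Y t \<omega> - B t \<omega>) = (LINT s:{t..t + w}|lborel. drift s \<omega>)"
          using elim(1)[rule_format, of t "t + w"] w by auto
        moreover have "(Y t \<omega> - B t \<omega>) - (Y (t - w) \<omega> - B (t - w) \<omega>) = (LINT s:{t - w..t}|lborel. drift s \<omega>)"
          using elim(1)[rule_format, of "t - w" t] w by auto
        moreover have "(LINT s:{t - w..t}|lborel. drift s \<omega>) = (LINT s:{t..t + w}|lborel. drift (s - w) \<omega>)"
          using set_integral_shift[of "- w" t "t + w" "\<lambda>s. drift s \<omega>"] by simp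
        moreover have "set_integrable lborel {t..t + w} (\<lambda>s. drift (s - w) \<omega>)"
        proof -
          note [measurable] = \<open>\<omega> \<in> space M\<close>
          obtain c where c: "0 \<le> c" "\<And>t. \<bar>b (Y t \<omega>)\<bar> \<le> c" using bY_bdd[OF \<open>\<omega> \<in> space M\<close>] by blast
          show ?thesis
          proof (rule set_integrable_Icc_bounded)
            show "\<bar>drift (s - w) \<omega>\<bar> \<le> c * G * (\<tau> - 0)" for s
              unfolding drift_def using \<tau> c g_le by (intro set_integral_abs_le_const) (auto simp: abs_mult intro!: mult_mono)
          qed measurable
        qed
        ultimately show ?case using drift_integrable[OF \<open>\<omega> \<in> space M\<close>, of t "t + w"]
          by (simp add: set_integral_diff)
      qed
    qed measurable
    moreover have "C * w powr H * (t + w - t) = C * w powr (1 + H)" using w by (simp add: powr_add)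
    ultimately show ?thesis by (simp only:)
  qed
  then show ?thesis using C(1) by blast
qed

end

section \<open>Second differences along the grid\<close>

lemma powr_le_powr_mult:
  fixes d \<tau> e e' :: real
  assumes "0 < d" "d \<le> \<tau>" "e' \<le> e" shows "d powr e \<le> \<tau> powr (e - e') * d powr e'"
proof -
  have "d powr e = d powr (e - e') * d powr e'" using assms by (simp flip: powr_add)
  also have "\<dots> \<le> \<tau> powr (e - e') * d powr e'" using assms by (intro mult_right_mono powr_mono2) auto
  finally show ?thesis .
qed

context delay_em
begin

text \<open>Sewing with h = H and e = 1/2: weights and noise sums each carry d^H, and (T/d)^(H +
  1/2) d^(2H) is of order d^(H - 1/2). The same order results from the weight frozen at the first
  grid point, d^H (T/d)^(1/2). Powers 2q appear because the sewing defect is a product.\<close>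

lemma Lq_weighted_noise_incr2:
  assumes q: "(q::nat) \<ge> 1"
  shows "\<exists>C>0. \<forall>d w m. 0 < d \<longrightarrow> 0 \<le> w \<longrightarrow> w \<le> d \<longrightarrow> real m * d \<le> T \<longrightarrow>
    Lq M q (\<lambda>\<omega>. \<Sum>i\<in>{1..<m}. b' (Y (real i * d) \<omega>) * (incr2 B (real i * d) w \<omega>)) (C * d powr (H - 1/2))"
proof -
  have q2: "2 * q \<ge> 1" using q by simp
  obtain C1 where C1: "C1 > 0" "\<And>s t. s \<in> {-\<tau>..T} \<Longrightarrow> t \<in> {-\<tau>..T} \<Longrightarrow> Lq M (2 * q) (\<lambda>\<omega>. Y t \<omega> - Y s \<omega>) (C1 * \<bar>t - s\<bar> powr H)"
    using Lq_Y_incr[OF q2] by blast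
  obtain C2 where C2: "C2 > 0" "\<And>w D l m. 0 \<le> w \<Longrightarrow> w \<le> D \<Longrightarrow> 1 \<le> l \<Longrightarrow> real m * D \<le> T \<Longrightarrow>
       Lq M (2 * q) (\<lambda>\<omega>. \<Sum>i\<in>{l..<m}. incr2 B (real i * D) w \<omega>) (C2 * D powr H * sqrt (real (m - l)))"
    using B_incr2[OF q2] by blast
  obtain C3 where C3: "C3 > 0" "\<And>w D l m. 0 \<le> w \<Longrightarrow> w \<le> D \<Longrightarrow> 1 \<le> l \<Longrightarrow> real m * D \<le> T \<Longrightarrow>
       Lq M q (\<lambda>\<omega>. \<Sum>i\<in>{l..<m}. incr2 B (real i * D) w \<omega>) (C3 * D powr H * sqrt (real (m - l)))"
    using B_incr2[OF q] by blast
  \<comment> \<open>The factor of the sewing bound for h + e = H + 1/2; it is finite because H >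
    1/2.\<close>
  define \<kappa> where "\<kappa> = 1 / (1 - (2/3) powr (H + 1/2 - 1))"
  have "(2/3 :: real) powr (H + 1/2 - 1) < 1" using H powr_less_mono2[of "H + 1/2 - 1" "2/3" 1] by simp
  then have \<kappa>: "0 < \<kappa>" by (simp add: \<kappa>_def)
  define C where "C = Lb * C1 * C2 * \<kappa> * T powr (H + 1/2) + Lb * C3 * T powr (1/2)"
  have C: "0 < C" unfolding C_def using Lb C1(1) C2(1) C3(1) \<kappa> T by (intro add_pos_pos mult_pos_pos) auto
  have "Lq M q (\<lambda>\<omega>. \<Sum>i\<in>{1..<m}. b' (Y (real i * d) \<omega>) * (incr2 B (real i * d) w \<omega>)) (C * d powr (H - 1/2))"
    if d: "0 < d" and w: "0 \<le> w" "w \<le> d" and m: "real m * d \<le> T" for d w m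
  proof (cases "m \<le> 1")
    case True
    then show ?thesis using q C by (auto intro!: Lq_zero)
  next
    case False
    define a where "a i \<omega> = b' (Y (real i * d) \<omega>)" for i \<omega>
    define z where "z i \<omega> = incr2 B (real i * d) w \<omega>" for i \<omega>
    have in_T: "real i * d \<in> {-\<tau>..T}" if "i \<le> m" for i
    proof -
      have "real i * d \<le> real m * d" using that d by (intro mult_right_mono) auto
      moreover have "0 \<le> real i * d" using d by simp
      ultimately show ?thesis using m \<tau> by auto
    qed
    have S: "Lq M q (\<lambda>\<omega>. \<Sum>i\<in>{1..<m}. (a i \<omega> - a 1 \<omega>) * z i \<omega>)
      ((Lb * C1 * d powr H) * (C2 * d powr H) / (1 - (2/3) powr (H + 1/2 - 1)) * real (m - 1) powr (H + 1/2))"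
    proof (rule Lq_discrete_sewing[where L=1 and U=m])
      fix i j assume ij: "1 \<le> i" "i \<le> j" "j < m"
      have "Lq M (2 * q) (\<lambda>\<omega>. Lb * (Y (real j * d) \<omega> - Y (real i * d) \<omega>)) (Lb * (C1 * \<bar>real j * d - real i * d\<bar> powr H))"
        using ij Lb by (intro Lq_cmult_le C1(2) in_T) auto
      then have "Lq M (2 * q) (\<lambda>\<omega>. a j \<omega> - a i \<omega>) (Lb * (C1 * \<bar>real j * d - real i * d\<bar> powr H))"
      proof (rule Lq_mono_AE[OF _ _ _ order_refl])
        show "AE \<omega> in M. \<bar>a j \<omega> - a i \<omega>\<bar> \<le> \<bar>Lb * (Y (real j * d) \<omega> - Y (real i * d) \<omega>)\<bar>"
          using b'_lip Lb by (simp add: a_def abs_mult)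
      qed (unfold a_def, measurable)
      moreover have "\<bar>real j * d - real i * d\<bar> powr H = d powr H * real (j - i) powr H"
      proof -
        have "\<bar>real j * d - real i * d\<bar> = d * real (j - i)" using ij d by (simp add: of_nat_diff algebra_simps mult_left_mono)
        then show ?thesis using d by (simp add: powr_mult)
      qed
      ultimately show "Lq M (2 * q) (\<lambda>\<omega>. a j \<omega> - a i \<omega>) (Lb * C1 * d powr H * real (j - i) powr H)"
        by (simp add: mult.assoc)
    next
      fix i j assume ij: "1 \<le> i" "i \<le> j" "j \<le> m"
      have "Lq M (2 * q) (\<lambda>\<omega>. \<Sum>k\<in>{i..<j}. z k \<omega>) (C2 * d powr H * sqrt (real (j - i)))"
        unfolding z_def using ij w in_T[of j] by (intro C2(2)) auto
      then show "Lq M (2 * q) (\<lambda>\<omega>. \<Sum>k\<in>{i..<j}. z k \<omega>) (C2 * d powr H * real (j - i) powr (1/2))"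
        by (simp add: powr_half_sqrt)
    qed (use q H Lb C1(1) C2(1) False in auto)
    have S2: "Lq M q (\<lambda>\<omega>. a 1 \<omega> * (\<Sum>i\<in>{1..<m}. z i \<omega>)) (Lb * (C3 * d powr H * sqrt (real (m - 1))))"
    proof (rule Lq_mono_AE[OF _ _ _ order_refl])
      show "Lq M q (\<lambda>\<omega>. Lb * (\<Sum>i\<in>{1..<m}. z i \<omega>)) (Lb * (C3 * d powr H * sqrt (real (m - 1))))"
        unfolding z_def using Lb w m by (intro Lq_cmult_le C3(2)) auto
      show "AE \<omega> in M. \<bar>a 1 \<omega> * (\<Sum>i\<in>{1..<m}. z i \<omega>)\<bar> \<le> \<bar>Lb * (\<Sum>i\<in>{1..<m}. z i \<omega>)\<bar>"
        using Lb b'_le by (simp add: a_def abs_mult mult_right_mono)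
      show "(\<lambda>\<omega>. a 1 \<omega> * (\<Sum>i\<in>{1..<m}. z i \<omega>)) \<in> borel_measurable M" unfolding a_def z_def by measurable
    qed
    have eq: "(\<Sum>i\<in>{1..<m}. (a i \<omega> - a 1 \<omega>) * z i \<omega>) + a 1 \<omega> * (\<Sum>i\<in>{1..<m}. z i \<omega>) = (\<Sum>i\<in>{1..<m}. a i \<omega> * z i \<omega>)" for \<omega>
      by (simp add: sum_distrib_left sum.distrib[symmetric] algebra_simps)
    have md: "real (m - 1) \<le> T / d"
    proof -
      have "real (m - 1) * d \<le> real m * d" using d by (intro mult_right_mono) auto
      then have "real (m - 1) * d \<le> T" using m by linarith
      then show ?thesis using d by (simp only: pos_le_divide_eq)
    qed
    have p1: "real (m - 1) powr (H + 1/2) \<le> T powr (H + 1/2) / d powr (H + 1/2)"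
    proof -
      have "real (m - 1) powr (H + 1/2) \<le> (T / d) powr (H + 1/2)" by (rule powr_mono2[OF _ _ md]) (use H in auto)
      then show ?thesis using T d by (simp add: powr_divide)
    qed
    have p2: "sqrt (real (m - 1)) \<le> T powr (1/2) / d powr (1/2)"
      using real_sqrt_le_mono[OF md] T d by (simp add: powr_half_sqrt real_sqrt_divide)
    have e1: "d powr H * d powr H / d powr (H + 1/2) = d powr (H - 1/2)" "d powr H / d powr (1/2) = d powr (H - 1/2)"
      using d by (simp_all flip: powr_add powr_diff)
    have "Lq M q (\<lambda>\<omega>. \<Sum>i\<in>{1..<m}. a i \<omega> * z i \<omega>) ((Lb * C1 * d powr H) * (C2 * d powr H) / (1 - (2/3) powr (H + 1/2 - 1)) * real (m - 1) powr (H + 1/2)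
        + Lb * (C3 * d powr H * sqrt (real (m - 1))))"
      using Lq_add[OF S S2 q] by (simp only: eq)
    moreover have "(Lb * C1 * d powr H) * (C2 * d powr H) / (1 - (2/3) powr (H + 1/2 - 1)) * real (m - 1) powr (H + 1/2)
        + Lb * (C3 * d powr H * sqrt (real (m - 1))) \<le> C * d powr (H - 1/2)"
    proof -
      have "(Lb * C1 * d powr H) * (C2 * d powr H) / (1 - (2/3) powr (H + 1/2 - 1)) * real (m - 1) powr (H + 1/2)
        = (Lb * C1 * C2 * \<kappa> * (d powr H * d powr H)) * real (m - 1) powr (H + 1/2)" by (simp add: \<kappa>_def)
      also have "\<dots> \<le> (Lb * C1 * C2 * \<kappa> * (d powr H * d powr H)) * (T powr (H + 1/2) / d powr (H + 1/2))"
        using p1 Lb C1(1) C2(1) \<kappa> by (intro mult_left_mono) auto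
      also have "\<dots> = Lb * C1 * C2 * \<kappa> * T powr (H + 1/2) * (d powr H * d powr H / d powr (H + 1/2))" by simp
      also have "\<dots> = Lb * C1 * C2 * \<kappa> * T powr (H + 1/2) * d powr (H - 1/2)" by (simp only: e1)
      finally have 1: "(Lb * C1 * d powr H) * (C2 * d powr H) / (1 - (2/3) powr (H + 1/2 - 1)) * real (m - 1) powr (H + 1/2)
        \<le> Lb * C1 * C2 * \<kappa> * T powr (H + 1/2) * d powr (H - 1/2)" .
      have "Lb * (C3 * d powr H * sqrt (real (m - 1))) \<le> Lb * (C3 * d powr H * (T powr (1/2) / d powr (1/2)))"
        using p2 Lb C3(1) by (intro mult_left_mono) auto
      also have "\<dots> = Lb * C3 * T powr (1/2) * (d powr H / d powr (1/2))" by simp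
      also have "\<dots> = Lb * C3 * T powr (1/2) * d powr (H - 1/2)" by (simp only: e1)
      finally show ?thesis using 1 by (simp add: C_def distrib_right)
    qed
    ultimately show ?thesis unfolding a_def z_def by (rule Lq_mono)
  qed
  then show ?thesis using C by blast
qed

section \<open>Second differences of b along the solution\<close>

definition bY_incr2 :: "real \<Rightarrow> real \<Rightarrow> 'a \<Rightarrow> real" where
  "bY_incr2 t w \<omega> = b (Y (t + w) \<omega>) + b (Y (t - w) \<omega>) - 2 * b (Y t \<omega>)"

lemma bY_incr2_measurable [measurable]: "bY_incr2 t w \<in> borel_measurable M"
  unfolding bY_incr2_def[abs_def] by measurable

text \<open>The Taylor expansions at y towards both sides are added, so their linear parts combine
  into b' y times the second difference.\<close>

lemma b_incr2_taylor:
  "\<bar>b y1 + b y2 - 2 * b y - b' y * (y1 + y2 - 2 * y)\<bar> \<le> Lb * ((y1 - y)\<^sup>2 + (y2 - y)\<^sup>2)"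
  using b_taylor[of y "y1 - y"] b_taylor[of y "y2 - y"] by (simp add: algebra_simps abs_le_iff)

text \<open>Before time 0 the path is the deterministic C^2 initial function, which gives the full
  order w^2 almost surely.\<close>

lemma bY_incr2_initial:
  "\<exists>C>0. AE \<omega> in M. \<forall>t w. 0 \<le> w \<longrightarrow> -\<tau> \<le> t - w \<longrightarrow> t + w \<le> 0 \<longrightarrow> \<bar>bY_incr2 t w \<omega>\<bar> \<le> C * w\<^sup>2"
proof -
  let ?C = "Lb * X0 + 2 * Lb * X0\<^sup>2"
  have "AE \<omega> in M. \<forall>t w. 0 \<le> w \<longrightarrow> -\<tau> \<le> t - w \<longrightarrow> t + w \<le> 0 \<longrightarrow> \<bar>bY_incr2 t w \<omega>\<bar> \<le> ?C * w\<^sup>2"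
    using Y_init
  proof eventually_elim
    case (elim \<omega>)
    show ?case
    proof (intro allI impI)
      fix t w :: real assume tw: "0 \<le> w" "-\<tau> \<le> t - w" "t + w \<le> 0"
      then have Y: "Y (t + w) \<omega> = x0 (t + w)" "Y (t - w) \<omega> = x0 (t - w)" "Y t \<omega> = x0 t" using elim by auto
      have h: "(x0 (t + w) - x0 t)\<^sup>2 \<le> X0\<^sup>2 * w\<^sup>2" "(x0 (t - w) - x0 t)\<^sup>2 \<le> X0\<^sup>2 * w\<^sup>2"
      proof -
        have "\<bar>x0 (t + w) - x0 t\<bar> \<le> X0 * w" "\<bar>x0 (t - w) - x0 t\<bar> \<le> X0 * w"
          using x0_lip[of t "t + w"] x0_lip[of t "t - w"] tw by auto
        then show "(x0 (t + w) - x0 t)\<^sup>2 \<le> X0\<^sup>2 * w\<^sup>2" "(x0 (t - w) - x0 t)\<^sup>2 \<le> X0\<^sup>2 * w\<^sup>2"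
          unfolding power_mult_distrib[symmetric] by (auto simp: power2_le_iff_abs_le X0 tw less_imp_le)
      qed
      have "\<bar>b' (x0 t) * (x0 (t + w) + x0 (t - w) - 2 * x0 t)\<bar> \<le> Lb * (X0 * w\<^sup>2)"
        unfolding abs_mult using b'_le x0_incr2[OF tw] Lb by (intro mult_mono) auto
      moreover have "Lb * ((x0 (t + w) - x0 t)\<^sup>2 + (x0 (t - w) - x0 t)\<^sup>2) \<le> Lb * (X0\<^sup>2 * w\<^sup>2 + X0\<^sup>2 * w\<^sup>2)"
        using h Lb by (intro mult_left_mono add_mono) auto
      ultimately have "\<bar>b (x0 (t + w)) + b (x0 (t - w)) - 2 * b (x0 t)\<bar> \<le> Lb * (X0 * w\<^sup>2) + Lb * (X0\<^sup>2 * w\<^sup>2 + X0\<^sup>2 * w\<^sup>2)"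
        using b_incr2_taylor[of "x0 (t + w)" "x0 (t - w)" "x0 t"] by linarith
      then show "\<bar>bY_incr2 t w \<omega>\<bar> \<le> ?C * w\<^sup>2" unfolding bY_incr2_def Y by (simp add: algebra_simps)
    qed
  qed
  moreover have "0 < ?C" using Lb X0 by (intro add_pos_pos) auto
  ultimately show ?thesis by blast
qed

text \<open>Two remainders: the squared increments of \<open>Y\<close> in the Taylor bound, of order
  2H, and the second difference of the smooth part \<open>Y\<close> - \<open>B\<close>, of order 1 +
  H, which is lowered to 2H at the price of \<tau>^(1 - H).\<close>

lemma Lq_bY_incr2_remainder:
  assumes q: "(q::nat) \<ge> 1"
  shows "\<exists>C>0. \<forall>t w. 0 \<le> w \<longrightarrow> w \<le> t \<longrightarrow> w \<le> \<tau> \<longrightarrow> t + w \<le> T \<longrightarrow>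
    Lq M q (\<lambda>\<omega>. bY_incr2 t w \<omega> - b' (Y t \<omega>) * (incr2 B t w \<omega>)) (C * w powr (2 * H))"
proof -
  have q2: "2 * q \<ge> 1" using q by simp
  obtain C1 where C1: "C1 > 0" "\<And>s t. s \<in> {-\<tau>..T} \<Longrightarrow> t \<in> {-\<tau>..T} \<Longrightarrow> Lq M (2 * q) (\<lambda>\<omega>. Y t \<omega> - Y s \<omega>) (C1 * \<bar>t - s\<bar> powr H)"
    using Lq_Y_incr[OF q2] by blast
  obtain C2 where C2: "C2 > 0" "\<And>t w. 0 < w \<Longrightarrow> w \<le> t \<Longrightarrow> t + w \<le> T \<Longrightarrow>
     Lq M q (\<lambda>\<omega>. (Y (t + w) \<omega> - B (t + w) \<omega>) + (Y (t - w) \<omega> - B (t - w) \<omega>) - 2 * (Y t \<omega> - B t \<omega>)) (C2 * w powr (1 + H))"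
    using Lq_smooth_incr2[OF q] by blast
  let ?C = "Lb * C2 * \<tau> powr (1 - H) + Lb * (2 * C1\<^sup>2)"
  have "Lq M q (\<lambda>\<omega>. bY_incr2 t w \<omega> - b' (Y t \<omega>) * (incr2 B t w \<omega>)) (?C * w powr (2 * H))"
    if tw: "0 \<le> w" "w \<le> t" "w \<le> \<tau>" "t + w \<le> T" for t w
  proof (cases "w = 0")
    case True
    then show ?thesis using q by (auto simp: bY_incr2_def intro!: Lq_zero)
  next
    case False
    with tw have w: "0 < w" by simp
    let ?S = "\<lambda>\<omega>. (Y (t + w) \<omega> - B (t + w) \<omega>) + (Y (t - w) \<omega> - B (t - w) \<omega>) - 2 * (Y t \<omega> - B t \<omega>)"
    let ?h1 = "\<lambda>\<omega>. Y (t + w) \<omega> - Y t \<omega>" and ?h2 = "\<lambda>\<omega>. Y (t - w) \<omega> - Y t \<omega>"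
    have h1: "Lq M (2 * q) ?h1 (C1 * w powr H)" using C1(2)[of t "t + w"] tw \<tau> by auto
    have h2: "Lq M (2 * q) ?h2 (C1 * w powr H)" using C1(2)[of t "t - w"] tw \<tau> by auto
    have "Lq M q (\<lambda>\<omega>. Lb * \<bar>?S \<omega>\<bar> + Lb * (?h1 \<omega> * ?h1 \<omega> + ?h2 \<omega> * ?h2 \<omega>))
      (Lb * (C2 * w powr (1 + H)) + Lb * ((C1 * w powr H) * (C1 * w powr H) + (C1 * w powr H) * (C1 * w powr H)))"
      using Lb w tw q by (intro Lq_add Lq_cmult_le Lq_abs C2(2) Lq_mult h1 h2) auto
    then have "Lq M q (\<lambda>\<omega>. bY_incr2 t w \<omega> - b' (Y t \<omega>) * (incr2 B t w \<omega>))
      (Lb * (C2 * w powr (1 + H)) + Lb * ((C1 * w powr H) * (C1 * w powr H) + (C1 * w powr H) * (C1 * w powr H)))"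
    proof (rule Lq_mono_AE[OF _ _ _ order_refl])
      show "AE \<omega> in M. \<bar>bY_incr2 t w \<omega> - b' (Y t \<omega>) * (incr2 B t w \<omega>)\<bar>
         \<le> \<bar>Lb * \<bar>?S \<omega>\<bar> + Lb * (?h1 \<omega> * ?h1 \<omega> + ?h2 \<omega> * ?h2 \<omega>)\<bar>"
      proof (rule AE_I2)
        fix \<omega>
        let ?e = "bY_incr2 t w \<omega> - b' (Y t \<omega>) * (incr2 Y t w \<omega>)"
        have "\<bar>?e\<bar> \<le> Lb * (?h1 \<omega> * ?h1 \<omega> + ?h2 \<omega> * ?h2 \<omega>)"
          unfolding bY_incr2_def power2_eq_square[symmetric] by (rule b_incr2_taylor)
        moreover have "\<bar>b' (Y t \<omega>) * ?S \<omega>\<bar> \<le> Lb * \<bar>?S \<omega>\<bar>"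
          unfolding abs_mult using b'_le by (intro mult_right_mono) auto
        moreover have "bY_incr2 t w \<omega> - b' (Y t \<omega>) * (incr2 B t w \<omega>) = ?e + b' (Y t \<omega>) * ?S \<omega>"
          by (simp add: algebra_simps)
        ultimately show "\<bar>bY_incr2 t w \<omega> - b' (Y t \<omega>) * (incr2 B t w \<omega>)\<bar>
         \<le> \<bar>Lb * \<bar>?S \<omega>\<bar> + Lb * (?h1 \<omega> * ?h1 \<omega> + ?h2 \<omega> * ?h2 \<omega>)\<bar>" by linarith
      qed
    qed measurable
    moreover have "Lb * (C2 * w powr (1 + H)) + Lb * ((C1 * w powr H) * (C1 * w powr H) + (C1 * w powr H) * (C1 * w powr H)) \<le> ?C * w powr (2 * H)"
    proof -
      have "Lb * (C2 * w powr (1 + H)) \<le> Lb * (C2 * (\<tau> powr (1 + H - 2 * H) * w powr (2 * H)))"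
        using Lb C2(1) w tw H by (intro mult_left_mono powr_le_powr_mult) auto
      moreover have "w powr H * w powr H = w powr (2 * H)" using w by (simp flip: powr_add)
      then have "(C1 * w powr H) * (C1 * w powr H) = C1\<^sup>2 * w powr (2 * H)" by (simp add: power2_eq_square)
      ultimately show ?thesis by (simp add: algebra_simps)
    qed
    ultimately show ?thesis by (rule Lq_mono)
  qed
  moreover have "0 < ?C" using Lb C1(1) C2(1) \<tau> by (intro add_pos_pos) auto
  ultimately show ?thesis by blast
qed

text \<open>Separates the indices by the sign of k - j. The diagonal stands alone because its window
  straddles time 0, where neither the initial regime nor the equation covers both sides.\<close>

lemma sum_shift_split:
  fixes f :: "real \<Rightarrow> real"
  shows "(\<Sum>k<K. f (real k - real j)) = (\<Sum>k<min K j. f (real k - real j)) + (if j < K then f 0 else 0) + (\<Sum>i\<in>{1..<K - j}. f (real i))"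
proof (cases "j < K")
  case True
  have "(\<Sum>k<K. f (real k - real j)) = (\<Sum>k<j. f (real k - real j)) + (\<Sum>k\<in>{j..<K}. f (real k - real j))"
    using True by (simp add: lessThan_atLeast0 sum.atLeastLessThan_concat)
  also have "(\<Sum>k\<in>{j..<K}. f (real k - real j)) = (\<Sum>i\<in>{0..<K - j}. f (real i))"
    using True by (intro sum.reindex_bij_witness[of _ "\<lambda>i. i + j" "\<lambda>k. k - j"]) (auto simp: of_nat_diff)
  also have "\<dots> = f 0 + (\<Sum>i\<in>{1..<K - j}. f (real i))"
    using True by (subst sum.atLeast_Suc_lessThan) auto
  finally show ?thesis using True by (simp add: min_def)
qed (auto simp: min_def)

text \<open>Contributions: about T/d terms of order d^2 before time 0, a single term of order d^H at
  0, about T/d Taylor remainders of order d^(2H) after 0, and the weighted noise. The resulting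
  orders 1, H, 2H - 1 and H - 1/2 are all at least H - 1/2.\<close>

lemma Lq_sum_bY_incr2:
  assumes q: "(q::nat) \<ge> 1"
  shows "\<exists>C>0. \<forall>d w K j n. 0 < d \<longrightarrow> \<bar>w\<bar> \<le> d \<longrightarrow> real n * d = \<tau> \<longrightarrow> j < n \<longrightarrow> real K * d \<le> T \<longrightarrow>
    Lq M q (\<lambda>\<omega>. \<Sum>k<K. bY_incr2 ((real k - real j) * d) w \<omega>) (C * d powr (H - 1/2))"
proof -
  obtain C1 where C1: "C1 > 0" "AE \<omega> in M. \<forall>t w. 0 \<le> w \<longrightarrow> -\<tau> \<le> t - w \<longrightarrow> t + w \<le> 0 \<longrightarrow> \<bar>bY_incr2 t w \<omega>\<bar> \<le> C1 * w\<^sup>2"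
    using bY_incr2_initial by blast
  obtain C2 where C2: "C2 > 0" "\<And>s t. s \<in> {-\<tau>..T} \<Longrightarrow> t \<in> {-\<tau>..T} \<Longrightarrow> Lq M q (\<lambda>\<omega>. b (Y t \<omega>) - b (Y s \<omega>)) (C2 * \<bar>t - s\<bar> powr H)"
    using Lq_bY_incr[OF q] by blast
  obtain C3 where C3: "C3 > 0" "\<And>t w. 0 \<le> w \<Longrightarrow> w \<le> t \<Longrightarrow> w \<le> \<tau> \<Longrightarrow> t + w \<le> T \<Longrightarrow>
    Lq M q (\<lambda>\<omega>. bY_incr2 t w \<omega> - b' (Y t \<omega>) * (incr2 B t w \<omega>)) (C3 * w powr (2 * H))"
    using Lq_bY_incr2_remainder[OF q] by blast
  obtain C4 where C4: "C4 > 0" "\<And>d w m. 0 < d \<Longrightarrow> 0 \<le> w \<Longrightarrow> w \<le> d \<Longrightarrow> real m * d \<le> T \<Longrightarrow>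
    Lq M q (\<lambda>\<omega>. \<Sum>i\<in>{1..<m}. b' (Y (real i * d) \<omega>) * (incr2 B (real i * d) w \<omega>)) (C4 * d powr (H - 1/2))"
    using Lq_weighted_noise_incr2[OF q] by blast
  define e where "e = H - 1/2"
  \<comment> \<open>The powers of \<tau> lower the natural orders 1, H and 2H - 1 to the common
    order e, using d \<le> \<tau>.\<close>
  define K1 where "K1 = T * C1 * \<tau> powr (1 - e)"
  define K2 where "K2 = 2 * C2 * \<tau> powr (H - e)"
  define K3 where "K3 = T * C3 * \<tau> powr (2 * H - 1 - e)"
  have K: "0 < K1" "0 < K2" "0 < K3" using C1(1) C2(1) C3(1) T \<tau> by (auto simp: K1_def K2_def K3_def)
  let ?C = "K1 + K2 + (K3 + C4)"
  have pos: "Lq M q (\<lambda>\<omega>. \<Sum>k<K. bY_incr2 ((real k - real j) * d) w \<omega>) (?C * d powr e)"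
    if d: "0 < d" and w: "0 \<le> w" "w \<le> d" and n: "real n * d = \<tau>" "j < n" and KT: "real K * d \<le> T" for d w K j n
  proof -
    have "1 * d \<le> real n * d" using n(2) d by (intro mult_right_mono) auto
    then have dt: "d \<le> \<tau>" using n by simp
    have KT': "real K \<le> T / d" using KT d by (simp add: field_simps)
    have A: "Lq M q (\<lambda>\<omega>. \<Sum>k<min K j. bY_incr2 ((real k - real j) * d) w \<omega>) (K1 * d powr e)"
    proof (rule Lq_bounded)
      show "AE \<omega> in M. \<bar>\<Sum>k<min K j. bY_incr2 ((real k - real j) * d) w \<omega>\<bar> \<le> K1 * d powr e"
        using C1(2)
      proof eventually_elim
        case (elim \<omega>)
        have "\<bar>\<Sum>k<min K j. bY_incr2 ((real k - real j) * d) w \<omega>\<bar> \<le> (\<Sum>k<min K j. C1 * d\<^sup>2)"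
        proof (intro order_trans[OF sum_abs] sum_mono)
          fix k assume k: "k \<in> {..<min K j}"
          \<comment> \<open>As j < n, the left end of the window stays above -\<tau>; as k < j, its
            right end stays at or below 0.\<close>
          have "- (real n * d) \<le> (real k - real j) * d - d"
          proof -
            have "(real j + 1) * d \<le> real n * d" using n(2) d by (intro mult_right_mono) auto
            moreover have "0 \<le> real k * d" using d by simp
            ultimately show ?thesis by (simp add: algebra_simps)
          qed
          moreover have "(real k - real j) * d \<le> - 1 * d" using k d by (intro mult_right_mono) auto
          ultimately have "\<bar>bY_incr2 ((real k - real j) * d) w \<omega>\<bar> \<le> C1 * w\<^sup>2"
            using elim w n by auto
          also have "\<dots> \<le> C1 * d\<^sup>2" using C1(1) w by (intro mult_left_mono power_mono) auto
          finally show "\<bar>bY_incr2 ((real k - real j) * d) w \<omega>\<bar> \<le> C1 * d\<^sup>2" .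
        qed
        also have "\<dots> = real (min K j) * (C1 * d\<^sup>2)" by simp
        also have "\<dots> \<le> T / d * (C1 * d\<^sup>2)" using KT' C1(1) by (intro mult_right_mono) auto
        also have "\<dots> = T * C1 * d powr 1" using d by (simp add: power2_eq_square)
        also have "\<dots> \<le> T * C1 * (\<tau> powr (1 - e) * d powr e)"
          using T C1(1) d dt H by (intro mult_left_mono powr_le_powr_mult) (auto simp: e_def)
        finally show ?case by (simp add: K1_def mult.assoc)
      qed
    qed (use K in auto)
    have Z: "Lq M q (\<lambda>\<omega>. if j < K then bY_incr2 0 w \<omega> else 0) (K2 * d powr e)"
    proof (cases "j < K")
      case False then show ?thesis using q K by (auto intro!: Lq_zero)
    next
      case True
      have "1 * d \<le> real K * d" using True d by (intro mult_right_mono) auto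
      then have wT: "w \<le> T" "w \<le> \<tau>" using KT w dt by auto
      have "Lq M q (\<lambda>\<omega>. (b (Y w \<omega>) - b (Y 0 \<omega>)) + (b (Y (- w) \<omega>) - b (Y 0 \<omega>))) (C2 * \<bar>w - 0\<bar> powr H + C2 * \<bar>- w - 0\<bar> powr H)"
        using wT w \<tau> T by (intro Lq_add q C2(2)) auto
      then have "Lq M q (bY_incr2 0 w) (C2 * \<bar>w - 0\<bar> powr H + C2 * \<bar>- w - 0\<bar> powr H)"
        by (rule Lq_cong_AE) (auto simp: bY_incr2_def)
      moreover have "C2 * \<bar>w - 0\<bar> powr H + C2 * \<bar>- w - 0\<bar> powr H \<le> K2 * d powr e"
      proof -
        have "w powr H \<le> d powr H" using w H by (intro powr_mono2) auto
        also have "\<dots> \<le> \<tau> powr (H - e) * d powr e" using d dt by (intro powr_le_powr_mult) (auto simp: e_def)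
        finally have "2 * C2 * w powr H \<le> 2 * C2 * (\<tau> powr (H - e) * d powr e)" using C2(1) by (intro mult_left_mono) auto
        then show ?thesis using w by (simp add: K2_def mult.assoc)
      qed
      ultimately show ?thesis using True Lq_mono by auto
    qed
    have P: "Lq M q (\<lambda>\<omega>. \<Sum>i\<in>{1..<K - j}. bY_incr2 (real i * d) w \<omega>) ((K3 + C4) * d powr e)"
    proof -
      let ?N = "\<lambda>i \<omega>. b' (Y (real i * d) \<omega>) * (incr2 B (real i * d) w \<omega>)"
      have "real (K - j) * d \<le> real K * d" using d by (intro mult_right_mono) auto
      then have KjT: "real (K - j) * d \<le> T" using KT by simp
      have "Lq M q (\<lambda>\<omega>. \<Sum>i\<in>{1..<K - j}. bY_incr2 (real i * d) w \<omega> - ?N i \<omega>) (\<Sum>i\<in>{1..<K - j}. C3 * w powr (2 * H))"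
      proof (intro Lq_sum q)
        fix i assume i: "i \<in> {1..<K - j}"
        have "1 * d \<le> real i * d" using i d by (intro mult_right_mono) auto
        moreover have "(real i + 1) * d \<le> real (K - j) * d" using i d by (intro mult_right_mono) auto
        ultimately show "Lq M q (\<lambda>\<omega>. bY_incr2 (real i * d) w \<omega> - ?N i \<omega>) (C3 * w powr (2 * H))"
          using w dt KjT by (intro C3(2)) (auto simp: algebra_simps)
      qed auto
      moreover have "(\<Sum>i\<in>{1..<K - j}. C3 * w powr (2 * H)) \<le> K3 * d powr e"
      proof -
        have "(\<Sum>i\<in>{1..<K - j}. C3 * w powr (2 * H)) = real (K - j - 1) * (C3 * w powr (2 * H))" by simp
        also have "\<dots> \<le> T / d * (C3 * d powr (2 * H))"
          using KT' w H C3(1) T d by (intro mult_mono mult_left_mono powr_mono2) auto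
        also have "\<dots> = T * C3 * d powr (2 * H - 1)" using d by (simp add: powr_diff)
        also have "\<dots> \<le> T * C3 * (\<tau> powr (2 * H - 1 - e) * d powr e)"
          using T C3(1) d dt H by (intro mult_left_mono powr_le_powr_mult) (auto simp: e_def)
        finally show ?thesis by (simp add: K3_def mult.assoc)
      qed
      ultimately have "Lq M q (\<lambda>\<omega>. \<Sum>i\<in>{1..<K - j}. bY_incr2 (real i * d) w \<omega> - ?N i \<omega>) (K3 * d powr e)" by (rule Lq_mono)
      from Lq_add[OF this C4(2)[OF d w KjT] q] show ?thesis
        by (simp add: sum_subtractf e_def distrib_right)
    qed
    have "Lq M q (\<lambda>\<omega>. (\<Sum>k<min K j. bY_incr2 ((real k - real j) * d) w \<omega>) + (if j < K then bY_incr2 0 w \<omega> else 0) + (\<Sum>i\<in>{1..<K - j}. bY_incr2 (real i * d) w \<omega>))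
      (K1 * d powr e + K2 * d powr e + (K3 + C4) * d powr e)"
      using A Z P q by (intro Lq_add)
    moreover have "(\<Sum>k<K. bY_incr2 ((real k - real j) * d) w \<omega>) = (\<Sum>k<min K j. bY_incr2 ((real k - real j) * d) w \<omega>)
        + (if j < K then bY_incr2 0 w \<omega> else 0) + (\<Sum>i\<in>{1..<K - j}. bY_incr2 (real i * d) w \<omega>)" for \<omega>
      using sum_shift_split[of "\<lambda>x. bY_incr2 (x * d) w \<omega>" j K] by (simp only: mult_zero_left)
    ultimately show ?thesis by (simp only: distrib_right)
  qed
  \<comment> \<open>The offset x - y of a cell has either sign; symmetry reduces it to w \<ge>
    0.\<close>
  have sym: "bY_incr2 t (- w) = bY_incr2 t w" for t w by (auto simp: bY_incr2_def fun_eq_iff)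
  have "Lq M q (\<lambda>\<omega>. \<Sum>k<K. bY_incr2 ((real k - real j) * d) w \<omega>) (?C * d powr (H - 1/2))"
    if "0 < d" "\<bar>w\<bar> \<le> d" "real n * d = \<tau>" "j < n" "real K * d \<le> T" for d w K j n
  proof (cases "0 \<le> w")
    case True
    then show ?thesis using pos[of d w n j K] that by (simp add: e_def)
  next
    case False
    then show ?thesis using pos[of d "- w" n j K] that by (simp add: e_def sym)
  qed
  moreover have "0 < ?C" using K C4(1) by simp
  ultimately show ?thesis by blast
qed

end

section \<open>Error of the Euler--Maruyama scheme\<close>

lemma grid_floor_bounds:
  assumes "0 < d"
  shows "grid_floor d s \<le> s" "s < grid_floor d s + d" "0 \<le> s \<Longrightarrow> 0 \<le> grid_floor d s"
proof -
  have "real_of_int \<lfloor>s / d\<rfloor> \<le> s / d" "s / d < real_of_int \<lfloor>s / d\<rfloor> + 1" by linarith+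
  from mult_right_mono[OF this(1), of d] mult_strict_right_mono[OF this(2) assms]
  show "grid_floor d s \<le> s" "s < grid_floor d s + d"
    using assms by (auto simp: grid_floor_def distrib_right)
  show "0 \<le> s \<Longrightarrow> 0 \<le> grid_floor d s" using assms by (simp add: grid_floor_def)
qed

context delay_em
begin

text \<open>The consistency error: both terms are evaluated along the exact solution, so only the
  discretisation of time and delay is measured, not the propagation of earlier errors.\<close>

definition path_error :: "real \<Rightarrow> real \<Rightarrow> 'a \<Rightarrow> real" where
  "path_error d t \<omega> = (LINT s:{0..t}|lborel. LINT r:{0..\<tau>}|lborel.
     (b (Y (s - r) \<omega>) - b (Y (grid_floor d s - grid_floor d r) \<omega>)) * g r)"

lemma path_error_measurable [measurable]: "path_error d t \<in> borel_measurable M"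
  unfolding path_error_def[abs_def] by measurable

text \<open>There are about T \<tau> / d^2 cells. The variation of g costs d^(1+H) per cell, in
  total d^(H-1); the symmetrised part costs d^(H-1/2) for each of n = \<tau> / d columns, in total
  d^(H-3/2). Integration over a cell multiplies by d^2, so the symmetrised part determines the
  rate.\<close>

lemma Lq_path_error_grid:
  assumes q: "(q::nat) \<ge> 1"
  shows "\<exists>C>0. \<forall>d n K. 0 < d \<longrightarrow> n \<ge> 1 \<longrightarrow> real n * d = \<tau> \<longrightarrow> real K * d \<le> T \<longrightarrow>
    Lq M q (path_error d (real K * d)) (C * d powr (H + 1/2))"
proof -
  obtain C2 where C2: "C2 > 0" "\<And>s t. s \<in> {-\<tau>..T} \<Longrightarrow> t \<in> {-\<tau>..T} \<Longrightarrow> Lq M q (\<lambda>\<omega>. b (Y t \<omega>) - b (Y s \<omega>)) (C2 * \<bar>t - s\<bar> powr H)"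
    using Lq_bY_incr[OF q] by blast
  obtain C3 where C3: "C3 > 0" "\<And>d w K j n. 0 < d \<Longrightarrow> \<bar>w\<bar> \<le> d \<Longrightarrow> real n * d = \<tau> \<Longrightarrow> j < n \<Longrightarrow> real K * d \<le> T \<Longrightarrow>
    Lq M q (\<lambda>\<omega>. \<Sum>k<K. bY_incr2 ((real k - real j) * d) w \<omega>) (C3 * d powr (H - 1/2))"
    using Lq_sum_bY_incr2[OF q] by blast
  define C where "C = T * \<tau> * C2 * G * \<tau> powr (1/2) + \<tau> * G / 2 * C3"
  have C: "0 < C" unfolding C_def using T \<tau> C2(1) C3(1) G by (intro add_pos_pos) auto
  have "Lq M q (path_error d (real K * d)) (C * d powr (H + 1/2))"
    if d: "0 < d" and n: "n \<ge> 1" "real n * d = \<tau>" and K: "real K * d \<le> T" for d n K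
  proof -
    have "1 * d \<le> real n * d" using n(1) d by (intro mult_right_mono) auto
    then have dt: "d \<le> \<tau>" using n by simp
    define S1 where "S1 x y \<omega> = (\<Sum>k<K. \<Sum>j<n. (b (Y ((real k - real j) * d + (x - y)) \<omega>) - b (Y ((real k - real j) * d) \<omega>)) * (g (real j * d + y) - g (real j * d)))" for x y \<omega>
    define S2 where "S2 x y \<omega> = (\<Sum>j<n. g (real j * d) / 2 * (\<Sum>k<K. b (Y ((real k - real j) * d + (x - y)) \<omega>) + b (Y ((real k - real j) * d - (x - y)) \<omega>) - 2 * b (Y ((real k - real j) * d) \<omega>)))" for x y \<omega>
    have eq: "path_error d (real K * d) \<omega> = (LINT x:{0..d}|lborel. LINT y:{0..d}|lborel. S1 x y \<omega> + S2 x y \<omega>)" if w: "\<omega> \<in> space M" for \<omega>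
    proof -
      obtain c where c: "0 \<le> c" "\<And>t. \<bar>b (Y t \<omega>)\<bar> \<le> c" using bY_bdd[OF w] by blast
      show ?thesis
        unfolding path_error_def S1_def S2_def
      proof (rule delay_integral_decomposition[of "\<lambda>t. b (Y t \<omega>)" c g G])
        show "(\<lambda>t. b (Y t \<omega>)) \<in> borel_measurable borel"
          by (rule measurable_compose[OF Y_path_measurable[OF w] b_measurable])
      qed (use c g_le n d in auto)
    qed
    have L1: "Lq M q (S1 x y) (real K * (real n * (G * d * (C2 * d powr H))))" if xy: "x \<in> {0<..<d}" "y \<in> {0<..<d}" for x y
    proof -
      have "Lq M q (S1 x y) (\<Sum>k<K. \<Sum>j<n. G * d * (C2 * d powr H))"
        unfolding S1_def[abs_def]
      proof (intro Lq_sum q)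
        fix k j assume kj: "k \<in> {..<K}" "j \<in> {..<n}"
        let ?t = "(real k - real j) * d"
        define u v where "u = real k * d" and "v = real j * d"
        have "(real k + 1) * d \<le> real K * d" "(real j + 1) * d \<le> real n * d" using kj d by (auto intro!: mult_right_mono)
        then have "u + d \<le> T" "v + d \<le> \<tau>" using K n(2) by (simp_all add: u_def v_def distrib_right)
        moreover have "0 \<le> u" "0 \<le> v" using d by (auto simp: u_def v_def)
        moreover have "?t = u - v" by (simp add: u_def v_def left_diff_distrib)
        ultimately have t: "?t \<in> {-\<tau>..T}" "?t + (x - y) \<in> {-\<tau>..T}"
          using xy by auto
        have "Lq M q (\<lambda>\<omega>. b (Y (?t + (x - y)) \<omega>) - b (Y ?t \<omega>)) (C2 * d powr H)"
          by (rule Lq_mono[OF C2(2)[OF t]]) (use xy H C2(1) in \<open>auto intro!: mult_left_mono powr_mono2\<close>)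
        moreover have "\<bar>g (real j * d + y) - g (real j * d)\<bar> \<le> G * d"
        proof -
          have "\<bar>g (real j * d + y) - g (real j * d)\<bar> \<le> G * \<bar>y\<bar>" using g_lip[of "real j * d + y" "real j * d"] by simp
          also have "\<dots> \<le> G * d" using xy G by (intro mult_left_mono) auto
          finally show ?thesis .
        qed
        ultimately have "Lq M q (\<lambda>\<omega>. (g (real j * d + y) - g (real j * d)) * (b (Y (?t + (x - y)) \<omega>) - b (Y ?t \<omega>))) (G * d * (C2 * d powr H))"
          by (rule Lq_cmult_le)
        then show "Lq M q (\<lambda>\<omega>. (b (Y (?t + (x - y)) \<omega>) - b (Y ?t \<omega>)) * (g (real j * d + y) - g (real j * d))) (G * d * (C2 * d powr H))"
          by (simp only: mult.commute)
      qed auto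
      then show ?thesis by simp
    qed
    have L2: "Lq M q (S2 x y) (real n * (G / 2 * (C3 * d powr (H - 1/2))))" if xy: "x \<in> {0<..<d}" "y \<in> {0<..<d}" for x y
    proof -
      have "Lq M q (S2 x y) (\<Sum>j<n. G / 2 * (C3 * d powr (H - 1/2)))"
        unfolding S2_def[abs_def]
      proof (intro Lq_sum q)
        fix j assume j: "j \<in> {..<n}"
        have "\<bar>x - y\<bar> \<le> d" using xy by auto
        from C3(2)[OF d this n(2) _ K] j
        have "Lq M q (\<lambda>\<omega>. \<Sum>k<K. bY_incr2 ((real k - real j) * d) (x - y) \<omega>) (C3 * d powr (H - 1/2))" by simp
        moreover have "\<bar>g (real j * d) / 2\<bar> \<le> G / 2" using g_le[of "real j * d"] by simp
        ultimately show "Lq M q (\<lambda>\<omega>. g (real j * d) / 2 * (\<Sum>k<K. b (Y ((real k - real j) * d + (x - y)) \<omega>) + b (Y ((real k - real j) * d - (x - y)) \<omega>) - 2 * b (Y ((real k - real j) * d) \<omega>))) (G / 2 * (C3 * d powr (H - 1/2)))"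
          unfolding bY_incr2_def by (rule Lq_cmult_le)
      qed auto
      then show ?thesis by simp
    qed
    \<comment> \<open>The bound for the integrand before the cell area d^2 raises the exponent to H
      + 1/2.\<close>
    define c where "c = C * d powr (H - 3/2)"
    have c0: "0 < c" using C d by (simp add: c_def)
    have cle: "real K * (real n * (G * d * (C2 * d powr H))) + real n * (G / 2 * (C3 * d powr (H - 1/2))) \<le> c"
    proof -
      have nd: "real n = \<tau> / d" and Kd: "real K \<le> T / d" using n K d by (auto simp: field_simps)
      have "real K * (real n * (G * d * (C2 * d powr H))) \<le> T / d * (\<tau> / d * (G * d * (C2 * d powr H)))"
        unfolding nd using Kd \<tau> G d C2(1) by (intro mult_right_mono) auto
      also have "\<dots> = T * \<tau> * C2 * G * d powr (H - 1)" using d by (simp add: powr_diff)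
      also have "\<dots> \<le> T * \<tau> * C2 * G * (\<tau> powr ((H - 1) - (H - 3/2)) * d powr (H - 3/2))"
        using T \<tau> G d dt C2(1) by (intro mult_left_mono powr_le_powr_mult) auto
      finally have 1: "real K * (real n * (G * d * (C2 * d powr H))) \<le> T * \<tau> * C2 * G * \<tau> powr (1/2) * d powr (H - 3/2)"
        by (simp add: mult.assoc)
      have "d powr (H - 1/2) = d powr (H - 3/2) * d powr 1" by (simp only: powr_add[symmetric]) simp
      then have "real n * (G / 2 * (C3 * d powr (H - 1/2))) = \<tau> * G / 2 * C3 * d powr (H - 3/2)"
        unfolding nd using d by simp
      moreover have "c = T * \<tau> * C2 * G * \<tau> powr (1/2) * d powr (H - 3/2) + \<tau> * G / 2 * C3 * d powr (H - 3/2)"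
        by (simp add: c_def C_def distrib_right)
      ultimately show ?thesis using 1 by linarith
    qed
    have "Lq M q (\<lambda>\<omega>. LINT x:{0..d}|lborel. LINT y:{0..d}|lborel. S1 x y \<omega> + S2 x y \<omega>) (c * (d - 0) * (d - 0))"
    proof (rule Lq_set_integral_const[OF prob_M _ _ _ _ q])
      fix x assume x: "x \<in> {0<..<d}"
      show "Lq M q (\<lambda>\<omega>. LINT y:{0..d}|lborel. S1 x y \<omega> + S2 x y \<omega>) (c * (d - 0))"
      proof (rule Lq_set_integral_const[OF prob_M _ _ c0 _ q])
        show "(\<lambda>(y, \<omega>). S1 x y \<omega> + S2 x y \<omega>) \<in> borel_measurable (borel \<Otimes>\<^sub>M M)"
          unfolding S1_def S2_def by measurable
        show "Lq M q (\<lambda>\<omega>. S1 x y \<omega> + S2 x y \<omega>) c" if y: "y \<in> {0<..<d}" for y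
          by (rule Lq_mono[OF Lq_add[OF L1[OF x y] L2[OF x y] q] cle])
      qed (use d in auto)
    next
      show "(\<lambda>(x, \<omega>). LINT y:{0..d}|lborel. S1 x y \<omega> + S2 x y \<omega>) \<in> borel_measurable (borel \<Otimes>\<^sub>M M)"
        unfolding S1_def S2_def by measurable
    qed (use d c0 in auto)
    moreover have "c * (d - 0) * (d - 0) = C * d powr (H + 1/2)"
    proof -
      have "H + 1/2 = (H - 3/2) + 2" by simp
      then have "d powr (H + 1/2) = d powr (H - 3/2) * d powr 2" by (simp only: powr_add)
      then show ?thesis using d by (simp add: c_def power2_eq_square)
    qed
    ultimately have "Lq M q (\<lambda>\<omega>. LINT x:{0..d}|lborel. LINT y:{0..d}|lborel. S1 x y \<omega> + S2 x y \<omega>) (C * d powr (H + 1/2))" by (simp only:)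
    then show ?thesis by (rule Lq_cong_AE) (auto simp: eq)
  qed
  then show ?thesis using C by blast
qed

text \<open>The last, incomplete cell has length at most d and an integrand of order d^H; its
  contribution d^(1+H) is of higher order, so no symmetrisation is required there.\<close>

lemma Lq_path_error:
  assumes q: "(q::nat) \<ge> 1"
  shows "\<exists>C>0. \<forall>d n. \<forall>t\<in>{0..T}. 0 < d \<longrightarrow> n \<ge> 1 \<longrightarrow> real n * d = \<tau> \<longrightarrow> Lq M q (path_error d t) (C * d powr (H + 1/2))"
proof -
  obtain C1 where C1: "C1 > 0" "\<And>d n K. 0 < d \<Longrightarrow> n \<ge> 1 \<Longrightarrow> real n * d = \<tau> \<Longrightarrow> real K * d \<le> T \<Longrightarrow>
    Lq M q (path_error d (real K * d)) (C1 * d powr (H + 1/2))"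
    using Lq_path_error_grid[OF q] by blast
  obtain C2 where C2: "C2 > 0" "\<And>s t. s \<in> {-\<tau>..T} \<Longrightarrow> t \<in> {-\<tau>..T} \<Longrightarrow> Lq M q (\<lambda>\<omega>. b (Y t \<omega>) - b (Y s \<omega>)) (C2 * \<bar>t - s\<bar> powr H)"
    using Lq_bY_incr[OF q] by blast
  define C where "C = C1 + G * C2 * \<tau> * \<tau> powr (1/2)"
  have "0 < G * C2 * \<tau> * \<tau> powr (1/2)" using C2(1) G \<tau> by simp
  then have C: "0 < C" using C1(1) by (simp add: C_def)
  have "Lq M q (path_error d t) (C * d powr (H + 1/2))"
    if t: "t \<in> {0..T}" and d: "0 < d" and n: "n \<ge> 1" "real n * d = \<tau>" for d n t
  proof -
    have "1 * d \<le> real n * d" using n(1) d by (intro mult_right_mono) auto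
    then have dt: "d \<le> \<tau>" using n by simp
    define K where "K = nat \<lfloor>t / d\<rfloor>"
    have Kt: "real K * d = grid_floor d t" using t d by (simp add: K_def grid_floor_def)
    have K: "0 \<le> real K * d" "real K * d \<le> t" "t \<le> real K * d + d"
      unfolding Kt using grid_floor_bounds[OF d, of t] t by auto
    let ?q = "\<lambda>s r \<omega>. (b (Y (s - r) \<omega>) - b (Y (grid_floor d s - grid_floor d r) \<omega>)) * g r"
    let ?c = "G * (C2 * d powr H)"
    have c0: "0 < ?c" using G C2(1) d by simp
    have rest: "Lq M q (\<lambda>\<omega>. LINT s:{real K * d..t}|lborel. LINT r:{0..\<tau>}|lborel. ?q s r \<omega>) (?c * (\<tau> - 0) * (t - real K * d))"
    proof (rule Lq_set_integral_const[OF prob_M K(2) _ _ _ q])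
      fix s assume s: "s \<in> {real K * d<..<t}"
      show "Lq M q (\<lambda>\<omega>. LINT r:{0..\<tau>}|lborel. ?q s r \<omega>) (?c * (\<tau> - 0))"
      proof (rule Lq_set_integral_const[OF prob_M _ _ c0 _ q])
        fix r assume r: "r \<in> {0<..<\<tau>}"
        have s': "0 \<le> s" "s \<le> T" using s t K(1) by auto
        note b1 = grid_floor_bounds[OF d, of s] and b2 = grid_floor_bounds[OF d, of r]
        have "Lq M q (\<lambda>\<omega>. b (Y (s - r) \<omega>) - b (Y (grid_floor d s - grid_floor d r) \<omega>)) (C2 * \<bar>(s - r) - (grid_floor d s - grid_floor d r)\<bar> powr H)"
          using b1 b2 s' r by (intro C2(2)) auto
        then have "Lq M q (\<lambda>\<omega>. b (Y (s - r) \<omega>) - b (Y (grid_floor d s - grid_floor d r) \<omega>)) (C2 * d powr H)"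
        proof (rule Lq_mono)
          \<comment> \<open>Both rounding errors lie in [0, d) and enter with opposite signs, so
            their difference is at most d in absolute value.\<close>
          have "\<bar>(s - r) - (grid_floor d s - grid_floor d r)\<bar> \<le> d" using b1 b2 by (auto simp: abs_le_iff)
          then show "C2 * \<bar>(s - r) - (grid_floor d s - grid_floor d r)\<bar> powr H \<le> C2 * d powr H"
            using C2(1) H by (intro mult_left_mono powr_mono2) auto
        qed
        from Lq_cmult_le[OF this g_le, of r] show "Lq M q (?q s r) ?c" by (simp only: mult.commute)
      qed (use \<tau> in auto)
    next
      show "(\<lambda>(s, \<omega>). LINT r:{0..\<tau>}|lborel. ?q s r \<omega>) \<in> borel_measurable (borel \<Otimes>\<^sub>M M)" by measurable
    qed (use c0 \<tau> in auto)
    have split: "path_error d t \<omega> = path_error d (real K * d) \<omega> + (LINT s:{real K * d..t}|lborel. LINT r:{0..\<tau>}|lborel. ?q s r \<omega>)"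
      if w [measurable]: "\<omega> \<in> space M" for \<omega>
    proof -
      obtain c where c: "0 \<le> c" "\<And>t. \<bar>b (Y t \<omega>)\<bar> \<le> c" using bY_bdd[OF w] by blast
      have "bdd_meas2 (\<lambda>s r. ?q s r \<omega>)"
      proof (rule bdd_meas2I)
        show "(\<lambda>(s, r). ?q s r \<omega>) \<in> borel_measurable (borel \<Otimes>\<^sub>M borel)" by measurable
        fix s r
        have "\<bar>b (Y (s - r) \<omega>) - b (Y (grid_floor d s - grid_floor d r) \<omega>)\<bar> \<le> 2 * c"
          using c(2)[of "s - r"] c(2)[of "grid_floor d s - grid_floor d r"] by linarith
        then show "\<bar>?q s r \<omega>\<bar> \<le> 2 * c * G" unfolding abs_mult using g_le[of r] c by (intro mult_mono) auto
      qed
      then show ?thesis unfolding path_error_def using K by (intro set_integral_combine bdd_meas2_integrable(2)) auto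
    qed
    have "Lq M q (\<lambda>\<omega>. path_error d (real K * d) \<omega> + (LINT s:{real K * d..t}|lborel. LINT r:{0..\<tau>}|lborel. ?q s r \<omega>))
      (C1 * d powr (H + 1/2) + ?c * (\<tau> - 0) * (t - real K * d))"
      by (rule Lq_add[OF C1(2)[OF d n] rest q]) (use K t in auto)
    then have "Lq M q (path_error d t) (C1 * d powr (H + 1/2) + ?c * (\<tau> - 0) * (t - real K * d))"
      by (rule Lq_cong_AE) (auto simp: split)
    moreover have "?c * (\<tau> - 0) * (t - real K * d) \<le> G * C2 * \<tau> * \<tau> powr (1/2) * d powr (H + 1/2)"
    proof -
      have "?c * (\<tau> - 0) * (t - real K * d) \<le> ?c * (\<tau> - 0) * d" using c0 \<tau> K by (intro mult_left_mono) auto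
      also have "\<dots> = G * C2 * \<tau> * d powr (H + 1)" using d by (simp add: powr_add)
      also have "\<dots> \<le> G * C2 * \<tau> * (\<tau> powr ((H + 1) - (H + 1/2)) * d powr (H + 1/2))"
        using G C2(1) \<tau> d dt by (intro mult_left_mono powr_le_powr_mult) auto
      finally show ?thesis by (simp add: mult.assoc)
    qed
    then have "C1 * d powr (H + 1/2) + ?c * (\<tau> - 0) * (t - real K * d) \<le> C * d powr (H + 1/2)"
      by (simp add: C_def distrib_right)
    ultimately show ?thesis by (rule Lq_mono)
  qed
  then show ?thesis using C by blast
qed

text \<open>The scheme V enters its own equation only through its grid values, represented by Z m at
  time m d and set to 0 outside a finite range. Countably many indices give joint measurability and
  finite support gives boundedness, although nothing is assumed about the paths of V.\<close>

lemma Lq_euler_error: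
  fixes V :: "real \<Rightarrow> 'a \<Rightarrow> real" and Z :: "int \<Rightarrow> 'a \<Rightarrow> real" and n :: nat and N :: int
  assumes q: "(q::nat) \<ge> 1" and d: "0 < d"
    and R: "\<And>t. t \<in> {0..T} \<Longrightarrow> Lq M q (path_error d t) A" and A: "0 < A"
    and V_meas: "\<And>t. t \<in> {0..T} \<Longrightarrow> V t \<in> borel_measurable M" and Z_meas: "\<And>m. Z m \<in> borel_measurable M"
    and Z_supp: "\<And>m \<omega>. N < \<bar>m\<bar> \<Longrightarrow> Z m \<omega> = 0"
    and Z_neg: "AE \<omega> in M. \<forall>m<0. -\<tau> \<le> real_of_int m * d \<longrightarrow> Z m \<omega> = x0 (real_of_int m * d)"
    and Z_pos: "AE \<omega> in M. \<forall>m\<ge>0. real_of_int m * d \<le> T \<longrightarrow> Z m \<omega> = V (real_of_int m * d) \<omega>"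
    and V_eq: "AE \<omega> in M. \<forall>t\<in>{0..T}. V t \<omega> = x0 0 + (LINT s:{0..t}|lborel. LINT r:{0..\<tau>}|lborel. b (Z (\<lfloor>s / d\<rfloor> - \<lfloor>r / d\<rfloor>) \<omega>) * g r) + B t \<omega>"
    and t: "t \<in> {0..T}"
  shows "Lq M q (\<lambda>\<omega>. Y t \<omega> - V t \<omega>) (A * exp (Lb * G * \<tau> * t))"
proof -
  define k where "k = Lb * G * \<tau>"
  have k: "0 < k" using Lb G \<tau> by (simp add: k_def)
  have grid: "grid_floor d s - grid_floor d r = real_of_int (\<lfloor>s / d\<rfloor> - \<lfloor>r / d\<rfloor>) * d" for s r
    by (simp add: grid_floor_def left_diff_distrib)
  let ?m = "\<lambda>s r. \<lfloor>s / d\<rfloor> - \<lfloor>r / d\<rfloor>"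
  let ?f1 = "\<lambda>\<omega> s r. b (Y (s - r) \<omega>) * g r"
  let ?f2 = "\<lambda>\<omega> s r. b (Y (grid_floor d s - grid_floor d r) \<omega>) * g r"
  let ?f3 = "\<lambda>\<omega> s r. b (Z (?m s r) \<omega>) * g r"
  define S where "S t \<omega> = (LINT s:{0..t}|lborel. LINT r:{0..\<tau>}|lborel. ?f2 \<omega> s r - ?f3 \<omega> s r)" for t \<omega>
  \<comment> \<open>The index is an integer-valued measurable function, so measurability of each
    single Z m suffices.\<close>
  have Zm1: "(\<lambda>x. Z (?m s (fst x)) (snd x)) \<in> borel_measurable (borel \<Otimes>\<^sub>M M)" for s
    by (rule measurable_compose_countable[of "\<lambda>m x. Z m (snd x)", OF measurable_compose[OF measurable_snd Z_meas]]) measurable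
  have Zm2: "(\<lambda>x. Z (?m (fst (fst x)) (snd x)) (snd (fst x))) \<in> borel_measurable ((borel \<Otimes>\<^sub>M M) \<Otimes>\<^sub>M borel)"
    by (rule measurable_compose_countable[of "\<lambda>m x. Z m (snd (fst x))"], rule measurable_compose[OF _ Z_meas]) measurable
  have decomp: "AE \<omega> in M. \<forall>t\<in>{0..T}. Y t \<omega> - V t \<omega> = path_error d t \<omega> + S t \<omega>"
    using Y_eq V_eq AE_space
  proof eventually_elim
    case (elim \<omega>)
    note w [measurable] = \<open>\<omega> \<in> space M\<close>
    obtain c where c: "0 \<le> c" "\<And>t. \<bar>b (Y t \<omega>)\<bar> \<le> c" using bY_bdd[OF w] by blast
    \<comment> \<open>Outside the finite range b (Z m) equals b 0; inside it is one of finitely many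
      summands.\<close>
    define c3 where "c3 = \<bar>b 0\<bar> + (\<Sum>m\<in>{-N..N}. \<bar>b (Z m \<omega>)\<bar>)"
    have c3: "\<bar>b (Z m \<omega>)\<bar> \<le> c3" for m
    proof (cases "N < \<bar>m\<bar>")
      case True
      then show ?thesis by (simp add: Z_supp c3_def sum_nonneg)
    next
      case False
      then have "m \<in> {-N..N}" by auto
      then have "\<bar>b (Z m \<omega>)\<bar> \<le> (\<Sum>m\<in>{-N..N}. \<bar>b (Z m \<omega>)\<bar>)" by (intro member_le_sum) auto
      then show ?thesis by (simp add: c3_def)
    qed
    have c30: "0 \<le> c3" using c3[of 0] by linarith
    have f1: "bdd_meas2 (?f1 \<omega>)"
    proof (rule bdd_meas2I)
      show "\<bar>?f1 \<omega> s r\<bar> \<le> c * G" for s r unfolding abs_mult using c g_le by (intro mult_mono) auto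
    qed measurable
    have f2: "bdd_meas2 (?f2 \<omega>)"
    proof (rule bdd_meas2I)
      show "\<bar>?f2 \<omega> s r\<bar> \<le> c * G" for s r unfolding abs_mult using c g_le by (intro mult_mono) auto
    qed measurable
    have f3: "bdd_meas2 (?f3 \<omega>)"
    proof (rule bdd_meas2I)
      show "\<bar>?f3 \<omega> s r\<bar> \<le> c3 * G" for s r unfolding abs_mult using c3 c30 g_le by (intro mult_mono) auto
      have [measurable]: "(\<lambda>m. b (Z m \<omega>)) \<in> measurable (count_space UNIV) borel" by simp
      show "(\<lambda>(s, r). ?f3 \<omega> s r) \<in> borel_measurable (borel \<Otimes>\<^sub>M borel)" by measurable
    qed
    have f12: "bdd_meas2 (\<lambda>s r. ?f1 \<omega> s r + -1 * ?f2 \<omega> s r)" by (intro bdd_meas2_add bdd_meas2_cmult f1 f2)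
    have f23: "bdd_meas2 (\<lambda>s r. ?f2 \<omega> s r + -1 * ?f3 \<omega> s r)" by (intro bdd_meas2_add bdd_meas2_cmult f2 f3)
    show ?case
    proof
      fix t assume t: "t \<in> {0..T}"
      have "(LINT s:{0..t}|lborel. LINT r:{0..\<tau>}|lborel. ?f1 \<omega> s r)
        = (LINT s:{0..t}|lborel. LINT r:{0..\<tau>}|lborel. (?f1 \<omega> s r + -1 * ?f2 \<omega> s r) + ((?f2 \<omega> s r + -1 * ?f3 \<omega> s r) + ?f3 \<omega> s r))"
        by simp
      also have "\<dots> = (LINT s:{0..t}|lborel. LINT r:{0..\<tau>}|lborel. ?f1 \<omega> s r + -1 * ?f2 \<omega> s r)
         + ((LINT s:{0..t}|lborel. LINT r:{0..\<tau>}|lborel. ?f2 \<omega> s r + -1 * ?f3 \<omega> s r) + (LINT s:{0..t}|lborel. LINT r:{0..\<tau>}|lborel. ?f3 \<omega> s r))"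
        by (subst double_integral_add[OF f12 bdd_meas2_add[OF f23 f3]], subst double_integral_add[OF f23 f3]) (rule refl)
      also have "(LINT s:{0..t}|lborel. LINT r:{0..\<tau>}|lborel. ?f1 \<omega> s r + -1 * ?f2 \<omega> s r) = path_error d t \<omega>"
        by (simp add: path_error_def left_diff_distrib)
      finally show "Y t \<omega> - V t \<omega> = path_error d t \<omega> + S t \<omega>"
        using elim t by (simp add: S_def)
    qed
  qed
  \<comment> \<open>One Gronwall step. At time s < t the integrand sees the error only at grid times
    at most s, so bounds at strictly earlier grid times suffice, and finiteness of the error moments
    comes with the bound.\<close>
  have step: "Lq M q (\<lambda>\<omega>. Y t \<omega> - V t \<omega>) (A * exp (k * t))"
    if t: "t \<in> {0..T}" and IH: "\<And>m::int. 0 \<le> m \<Longrightarrow> real_of_int m * d < t \<Longrightarrow>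
      Lq M q (\<lambda>\<omega>. Y (real_of_int m * d) \<omega> - V (real_of_int m * d) \<omega>) (A * exp (k * (real_of_int m * d)))" for t
  proof -
    have "Lq M q (S t) (LINT s:{0..t}|lborel. (k * A) * exp (k * s))"
      unfolding S_def[abs_def]
    proof (rule Lq_set_integral[OF prob_M _ _ _ _ _ q])
      show "0 \<le> t" using t by simp
      show "continuous_on {0..t} (\<lambda>s. k * A * exp (k * s))" by (intro continuous_intros)
      show "0 < k * A * exp (k * s)" for s using k A by simp
      have "(\<lambda>x. b (Z (?m (fst (fst x)) (snd x)) (snd (fst x)))) \<in> borel_measurable ((borel \<Otimes>\<^sub>M M) \<Otimes>\<^sub>M borel)"
        by (rule measurable_compose[OF Zm2 b_measurable])
      then have [measurable]: "(\<lambda>x. ?f2 (snd (fst x)) (fst (fst x)) (snd x) - ?f3 (snd (fst x)) (fst (fst x)) (snd x)) \<in> borel_measurable ((borel \<Otimes>\<^sub>M M) \<Otimes>\<^sub>M borel)"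
        by measurable
      show "(\<lambda>(s, \<omega>). LINT r:{0..\<tau>}|lborel. ?f2 \<omega> s r - ?f3 \<omega> s r) \<in> borel_measurable (borel \<Otimes>\<^sub>M M)"
        unfolding case_prod_unfold by (rule set_integral_measurable_param) (simp add: case_prod_unfold)
      fix s assume s: "s \<in> {0<..<t}"
      have c0: "0 < G * (Lb * (A * exp (k * s)))" using G Lb A by simp
      have "Lq M q (\<lambda>\<omega>. LINT r:{0..\<tau>}|lborel. ?f2 \<omega> s r - ?f3 \<omega> s r) (G * (Lb * (A * exp (k * s))) * (\<tau> - 0))"
      proof (rule Lq_set_integral_const[OF prob_M _ _ c0 _ q])
        have "(\<lambda>x. b (Z (?m s (fst x)) (snd x))) \<in> borel_measurable (borel \<Otimes>\<^sub>M M)"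
          by (rule measurable_compose[OF Zm1 b_measurable])
        then show "(\<lambda>(r, \<omega>). ?f2 \<omega> s r - ?f3 \<omega> s r) \<in> borel_measurable (borel \<Otimes>\<^sub>M M)"
          unfolding case_prod_unfold by measurable
        fix r assume r: "r \<in> {0<..<\<tau>}"
        note b1 = grid_floor_bounds[OF d, of s] and b2 = grid_floor_bounds[OF d, of r]
        let ?u = "real_of_int (?m s r) * d"
        have u: "?u = grid_floor d s - grid_floor d r" by (simp add: grid)
        have u_le: "?u \<le> s" "- \<tau> \<le> ?u" unfolding u using b1 b2 s r by auto
        have bm: "(\<lambda>\<omega>. b (Y ?u \<omega>) - b (Z (?m s r) \<omega>)) \<in> borel_measurable M"
          by (intro borel_measurable_diff measurable_compose[OF Y_meas b_measurable] measurable_compose[OF Z_meas b_measurable])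
        have "Lq M q (\<lambda>\<omega>. b (Y ?u \<omega>) - b (Z (?m s r) \<omega>)) (Lb * (A * exp (k * s)))"
        proof (cases "0 \<le> ?m s r")
          case True
          have "Lq M q (\<lambda>\<omega>. Lb * (Y ?u \<omega> - V ?u \<omega>)) (Lb * (A * exp (k * ?u)))"
            using True u_le s Lb by (intro Lq_cmult_le IH) auto
          then show ?thesis
          proof (rule Lq_mono_AE[OF _ bm])
            show "AE \<omega> in M. \<bar>b (Y ?u \<omega>) - b (Z (?m s r) \<omega>)\<bar> \<le> \<bar>Lb * (Y ?u \<omega> - V ?u \<omega>)\<bar>"
              using Z_pos
            proof eventually_elim
              case (elim \<omega>)
              then have "Z (?m s r) \<omega> = V ?u \<omega>" using True u_le s t by auto
              then show ?case using b_lip[of "Y ?u \<omega>" "V ?u \<omega>"] Lb by (simp add: abs_mult)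
            qed
            have "k * ?u \<le> k * s" using u_le k by (intro mult_left_mono) auto
            then show "Lb * (A * exp (k * ?u)) \<le> Lb * (A * exp (k * s))" using Lb A by (intro mult_left_mono) auto
          qed
        next
          case False
          \<comment> \<open>Before time 0 solution and scheme both equal the initial function, so
            there is no error to propagate.\<close>
          then have "?u \<le> 0" using d by (intro mult_nonpos_nonneg) auto
          have "Lq M q (\<lambda>_. 0) (Lb * (A * exp (k * s)))" using Lb A q by (intro Lq_zero) auto
          then show ?thesis
          proof (rule Lq_cong_AE[OF _ bm])
            show "AE \<omega> in M. b (Y ?u \<omega>) - b (Z (?m s r) \<omega>) = 0"
              using Z_neg Y_init
            proof eventually_elim
              case (elim \<omega>)
              have "Z (?m s r) \<omega> = x0 ?u" using elim(1) False u_le by auto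
              moreover have "Y ?u \<omega> = x0 ?u" using elim(2) u_le \<open>?u \<le> 0\<close> by auto
              ultimately show ?case by simp
            qed
          qed
        qed
        moreover have "(\<lambda>\<omega>. ?f2 \<omega> s r - ?f3 \<omega> s r) = (\<lambda>\<omega>. g r * (b (Y ?u \<omega>) - b (Z (?m s r) \<omega>)))"
          unfolding u by (simp only: left_diff_distrib mult.commute[of "g r"])
        ultimately show "Lq M q (\<lambda>\<omega>. ?f2 \<omega> s r - ?f3 \<omega> s r) (G * (Lb * (A * exp (k * s))))"
          using Lq_cmult_le[OF \<open>Lq M q (\<lambda>\<omega>. b (Y ?u \<omega>) - b (Z (?m s r) \<omega>)) _\<close> g_le, of r] by (simp only:)
      qed (use \<tau> in auto)
      then show "Lq M q (\<lambda>\<omega>. LINT r:{0..\<tau>}|lborel. ?f2 \<omega> s r - ?f3 \<omega> s r) (k * A * exp (k * s))"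
        by (simp add: k_def mult_ac)
    qed
    \<comment> \<open>The exponential profile reproduces itself: A plus this integral equals A
      e^(kt).\<close>
    moreover have "(LINT s:{0..t}|lborel. (k * A) * exp (k * s)) = A * (exp (k * t) - 1)"
      using t k by (subst set_integral_exp) auto
    ultimately have "Lq M q (S t) (A * (exp (k * t) - 1))" by (simp only:)
    from Lq_add[OF R[OF t] this q] have "Lq M q (\<lambda>\<omega>. path_error d t \<omega> + S t \<omega>) (A * exp (k * t))"
      by (simp add: right_diff_distrib)
    then show ?thesis
    proof (rule Lq_cong_AE)
      show "AE \<omega> in M. Y t \<omega> - V t \<omega> = path_error d t \<omega> + S t \<omega>"
        using decomp by eventually_elim (use t in auto)
      show "(\<lambda>\<omega>. Y t \<omega> - V t \<omega>) \<in> borel_measurable M" using V_meas[OF t] Y_meas[of t] by simp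
    qed
  qed
  \<comment> \<open>Strong induction along the grid; afterwards one more step reaches an arbitrary
    t.\<close>
  have grid_bound: "real m * d \<le> T \<Longrightarrow> Lq M q (\<lambda>\<omega>. Y (real m * d) \<omega> - V (real m * d) \<omega>) (A * exp (k * (real m * d)))" for m
  proof (induction m rule: less_induct)
    case (less m)
    show ?case
    proof (rule step)
      show "real m * d \<in> {0..T}" using less.prems d by auto
      fix i :: int assume i: "0 \<le> i" "real_of_int i * d < real m * d"
      define j where "j = nat i"
      have ij: "real_of_int i = real j" using i by (simp add: j_def)
      then have "j < m" using i d by auto
      moreover have "real j * d \<le> T" using i less.prems ij by simp
      ultimately show "Lq M q (\<lambda>\<omega>. Y (real_of_int i * d) \<omega> - V (real_of_int i * d) \<omega>) (A * exp (k * (real_of_int i * d)))"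
        using less.IH[of j] ij by simp
    qed
  qed
  have "Lq M q (\<lambda>\<omega>. Y t \<omega> - V t \<omega>) (A * exp (k * t))"
  proof (rule step[OF t])
    fix i :: int assume i: "0 \<le> i" "real_of_int i * d < t"
    then show "Lq M q (\<lambda>\<omega>. Y (real_of_int i * d) \<omega> - V (real_of_int i * d) \<omega>) (A * exp (k * (real_of_int i * d)))"
      using grid_bound[of "nat i"] t by simp
  qed
  then show ?thesis by (simp add: k_def)
qed

end

section \<open>Constants and extensions extracted from the hypotheses\<close>

lemma smooth_drift_bounds:
  assumes "Ck_on 2 UNIV b" "Cbk 1 (deriv b)"
  obtains b' L where "0 < L" "\<And>x. (b has_real_derivative b' x) (at x)" "\<And>x. \<bar>b' x\<bar> \<le> L" "\<And>x y. \<bar>b' x - b' y\<bar> \<le> L * \<bar>x - y\<bar>"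
proof -
  obtain b' where b': "\<And>x. (b has_real_derivative b' x) (at x)"
    using assms(1) by (auto simp: numeral_2_eq_2)
  have db: "deriv b = b'" using b' by (auto intro: DERIV_imp_deriv)
  obtain b'' where b'': "\<And>x. (b' has_real_derivative b'' x) (at x)" and "bounded (range b')" "bounded (range b'')"
    using assms(2) by (auto simp: db)
  then obtain L1 L2 where L: "\<And>x. \<bar>b' x\<bar> \<le> L1" "\<And>x. \<bar>b'' x\<bar> \<le> L2"
    by (auto simp: bounded_iff)
  have L0: "0 \<le> L1" "0 \<le> L2" using L(1)[of 0] L(2)[of 0] by linarith+
  show thesis
  proof (rule that[of "L1 + L2 + 1" b'])
    show "\<bar>b' x\<bar> \<le> L1 + L2 + 1" for x using L(1)[of x] L0 by linarith
    fix x y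
    have "\<bar>b' x - b' y\<bar> \<le> L2 * \<bar>x - y\<bar>"
      using field_differentiable_bound[of UNIV b' b'' L2 x y] b'' L(2) by simp
    also have "\<dots> \<le> (L1 + L2 + 1) * \<bar>x - y\<bar>" using L0 by (intro mult_right_mono) auto
    finally show "\<bar>b' x - b' y\<bar> \<le> (L1 + L2 + 1) * \<bar>x - y\<bar>" .
  qed (use L0 b' in auto)
qed

text \<open>Compactness bounds the function and its two derivatives, one-sided at the ends. For the
  second difference the tangent at t is subtracted; each side then deviates by at most |k2| w^2,
  hence the summand 2 |k2| in K.\<close>

lemma smooth_initial_bounds:
  assumes "Ck_on 2 {-\<tau>..0} x0"
  obtains K where "0 < K" "\<And>t. t \<in> {-\<tau>..0} \<Longrightarrow> \<bar>x0 t\<bar> \<le> K"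
    "\<And>s t. s \<in> {-\<tau>..0} \<Longrightarrow> t \<in> {-\<tau>..0} \<Longrightarrow> \<bar>x0 t - x0 s\<bar> \<le> K * \<bar>t - s\<bar>"
    "\<And>t w. 0 \<le> w \<Longrightarrow> - \<tau> \<le> t - w \<Longrightarrow> t + w \<le> 0 \<Longrightarrow> \<bar>x0 (t + w) + x0 (t - w) - 2 * x0 t\<bar> \<le> K * w\<^sup>2"
    "continuous_on {-\<tau>..0} x0"
proof -
  let ?I = "{-\<tau>..0}"
  have "Ck_on (Suc (Suc 0)) ?I x0" using assms by (simp only: numeral_2_eq_2)
  then obtain x1 where x1: "\<forall>t\<in>?I. (x0 has_real_derivative x1 t) (at t within ?I)" and "Ck_on (Suc 0) ?I x1"
    unfolding Ck_on.simps(2)[of "Suc 0"] by blast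
  then obtain x2 where x2: "\<forall>t\<in>?I. (x1 has_real_derivative x2 t) (at t within ?I)" and c2: "continuous_on ?I x2"
    unfolding Ck_on.simps by blast
  have c0: "continuous_on ?I x0" and c1: "continuous_on ?I x1"
    using x1 x2 by (blast intro: DERIV_continuous_on)+
  have bd: "\<exists>k. \<forall>t\<in>?I. \<bar>f t\<bar> \<le> k" if "continuous_on ?I f" for f :: "real \<Rightarrow> real"
    using compact_imp_bounded[OF compact_continuous_image[OF that compact_Icc]] by (simp add: bounded_iff)
  obtain k0 k1 k2 where k: "\<And>t. t \<in> ?I \<Longrightarrow> \<bar>x0 t\<bar> \<le> k0" "\<And>t. t \<in> ?I \<Longrightarrow> \<bar>x1 t\<bar> \<le> k1" "\<And>t. t \<in> ?I \<Longrightarrow> \<bar>x2 t\<bar> \<le> k2"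
    using bd[OF c0] bd[OF c1] bd[OF c2] by blast
  define K where "K = \<bar>k0\<bar> + \<bar>k1\<bar> + 2 * \<bar>k2\<bar> + 1"
  show thesis
  proof (rule that[of K])
    show "0 < K" by (simp add: K_def add_nonneg_pos)
    show "\<bar>x0 t\<bar> \<le> K" if "t \<in> ?I" for t using k(1)[OF that] by (simp add: K_def)
    show "continuous_on ?I x0" by fact
    show "\<bar>x0 t - x0 s\<bar> \<le> K * \<bar>t - s\<bar>" if "s \<in> ?I" "t \<in> ?I" for s t
    proof -
      have "\<bar>x0 t - x0 s\<bar> \<le> k1 * \<bar>t - s\<bar>"
        using field_differentiable_bound[of ?I x0 x1 k1 t s] x1 k(2) that by auto
      also have "\<dots> \<le> K * \<bar>t - s\<bar>" by (intro mult_right_mono) (auto simp: K_def)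
      finally show ?thesis .
    qed
    fix t w :: real assume tw: "0 \<le> w" "- \<tau> \<le> t - w" "t + w \<le> 0"
    have t: "t \<in> ?I" and sub: "{t - w..t + w} \<subseteq> ?I" using tw by auto
    have tangent: "\<bar>(x0 u - x1 t * u) - (x0 t - x1 t * t)\<bar> \<le> (\<bar>k2\<bar> * w) * \<bar>u - t\<bar>" if u: "u \<in> {t - w..t + w}" for u
    proof -
      have "norm ((\<lambda>v. x0 v - x1 t * v) u - (\<lambda>v. x0 v - x1 t * v) t) \<le> (\<bar>k2\<bar> * w) * norm (u - t)"
      proof (rule field_differentiable_bound[of "{t - w..t + w}" _ "\<lambda>v. x1 v - x1 t"])
        fix v assume v: "v \<in> {t - w..t + w}"
        show "((\<lambda>v. x0 v - x1 t * v) has_field_derivative x1 v - x1 t) (at v within {t - w..t + w})"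
        proof -
          have "(x0 has_field_derivative x1 v) (at v within {t - w..t + w})"
            using v sub x1 by (blast intro: has_field_derivative_subset)
          then show ?thesis by (auto intro!: derivative_eq_intros)
        qed
        have "\<bar>x1 v - x1 t\<bar> \<le> k2 * \<bar>v - t\<bar>"
          using field_differentiable_bound[of ?I x1 x2 k2 v t] x2 k(3) t v sub by auto
        also have "\<dots> \<le> \<bar>k2\<bar> * w" using v by (intro mult_mono) auto
        finally show "norm (x1 v - x1 t) \<le> \<bar>k2\<bar> * w" by simp
      qed (use u tw in auto)
      then show ?thesis by simp
    qed
    have "\<bar>(x0 (t + w) - x1 t * (t + w)) - (x0 t - x1 t * t)\<bar> \<le> \<bar>k2\<bar> * w * w"
      "\<bar>(x0 (t - w) - x1 t * (t - w)) - (x0 t - x1 t * t)\<bar> \<le> \<bar>k2\<bar> * w * w"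
      using tangent[of "t + w"] tangent[of "t - w"] tw(1) by auto
    then have "\<bar>x0 (t + w) + x0 (t - w) - 2 * x0 t\<bar> \<le> 2 * (\<bar>k2\<bar> * w * w)"
      by (simp add: algebra_simps abs_le_iff)
    also have "\<dots> = 2 * \<bar>k2\<bar> * w\<^sup>2" by (simp add: power2_eq_square)
    also have "\<dots> \<le> K * w\<^sup>2" by (intro mult_right_mono) (auto simp: K_def)
    finally show "\<bar>x0 (t + w) + x0 (t - w) - 2 * x0 t\<bar> \<le> K * w\<^sup>2" .
  qed
qed

text \<open>Composing with the projection onto [0, \<tau>] extends the density to the line without
  increasing its Lipschitz constant, and it makes the density bounded there.\<close>

lemma lipschitz_density_extension:
  assumes "has_lipschitz_density \<tau> \<eta>" "0 < \<tau>"
  obtains g G where "0 < G" "\<And>r. \<bar>g r\<bar> \<le> G" "\<And>r s. \<bar>g r - g s\<bar> \<le> G * \<bar>r - s\<bar>"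
    "\<And>A. A \<in> sets (delay_space \<tau>) \<Longrightarrow> \<eta> A = (LINT r:A|lborel. g r)"
proof -
  obtain h L where L: "L-lipschitz_on {0..\<tau>} h" and \<eta>: "\<And>A. A \<in> sets (delay_space \<tau>) \<Longrightarrow> \<eta> A = (LINT r:A|lborel. h r)"
    using assms(1) by (auto simp: has_lipschitz_density_def)
  have L0: "0 \<le> L" using lipschitz_on_nonneg[OF L] .
  define g where "g r = h (max 0 (min \<tau> r))" for r
  have cl: "max 0 (min \<tau> r) \<in> {0..\<tau>}" for r using assms(2) by auto
  have lip: "\<bar>g r - g s\<bar> \<le> L * \<bar>r - s\<bar>" for r s
  proof -
    have "\<bar>g r - g s\<bar> \<le> L * \<bar>max 0 (min \<tau> r) - max 0 (min \<tau> s)\<bar>"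
      using lipschitz_onD[OF L cl cl] by (simp add: g_def dist_real_def)
    also have "\<dots> \<le> L * \<bar>r - s\<bar>" using L0 by (intro mult_left_mono) auto
    finally show ?thesis .
  qed
  have bd: "\<bar>g r\<bar> \<le> \<bar>h 0\<bar> + L * \<tau>" for r
  proof -
    have "\<bar>g r - h 0\<bar> \<le> L * \<bar>max 0 (min \<tau> r) - 0\<bar>"
      using lipschitz_onD[OF L cl, of 0] assms(2) by (simp add: g_def dist_real_def)
    also have "\<dots> \<le> L * \<tau>" using L0 assms(2) by (intro mult_left_mono) auto
    finally show ?thesis by linarith
  qed
  let ?G = "\<bar>h 0\<bar> + L * \<tau> + L + 1"
  have pos: "0 \<le> L * \<tau>" using L0 assms(2) by simp
  show thesis
  proof (rule that[of ?G g])
    show "0 < ?G" using L0 pos by linarith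
    show "\<bar>g r\<bar> \<le> ?G" for r using bd[of r] L0 by linarith
    show "\<bar>g r - g s\<bar> \<le> ?G * \<bar>r - s\<bar>" for r s
      by (rule order_trans[OF lip]) (use L0 pos in \<open>auto intro!: mult_right_mono\<close>)
    fix A assume A: "A \<in> sets (delay_space \<tau>)"
    then have sub: "A \<subseteq> {0..\<tau>}" "A \<in> sets lborel" by (auto simp: sets_restrict_space_iff)
    have "(LINT r:A|lborel. h r) = (LINT r:A|lborel. g r)"
      using sub by (intro set_lebesgue_integral_cong) (auto simp: g_def min_def max_def)
    with \<eta>[OF A] show "\<eta> A = (LINT r:A|lborel. g r)" by simp
  qed
qed

theorem theorem2:
  fixes M :: "'a measure"
    and W B X :: "real \<Rightarrow> 'a \<Rightarrow> real"
    and Xn :: "nat \<Rightarrow> real \<Rightarrow> 'a \<Rightarrow> real"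
    and H \<tau> :: real
    and b x\<^sub>0 :: "real \<Rightarrow> real"
    and \<eta> :: "real set \<Rightarrow> real"
  assumes "prob_space M" and "complete_measure M"
    and "two_sided_wiener M W"
    and "1/2 < H" and "H < 1"
    and "fractional_BM M W H B"
    and "0 < \<tau>"
    and "Ck_on 2 UNIV b" and "linear_growth b" and "Cbk 1 (deriv b)"
    and "finite_signed_measure (delay_space \<tau>) \<eta>" and "has_lipschitz_density \<tau> \<eta>"
    and "Ck_on 2 {-\<tau>..0} x\<^sub>0" and "\<And>t. t \<notin> {-\<tau>..0} \<Longrightarrow> x\<^sub>0 t = 0"
    and "sdde_solution M \<tau> b \<eta> x\<^sub>0 B X"
    and "\<And>n. 1 \<le> n \<Longrightarrow> euler_maruyama M \<tau> b \<eta> x\<^sub>0 B (\<tau> / real n) (Xn n)"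
  shows "\<forall>T>0. \<forall>p\<ge>1. \<exists>C>0. \<forall>n\<ge>1.
    (SUP t\<in>{0..T}. Lp_norm M p (\<lambda>\<omega>. X t \<omega> - Xn n t \<omega>))
      \<le> ennreal (C * (\<tau> / real n) powr (H + 1/2))"
proof (intro allI impI)
  fix T p :: real assume T: "T > 0" and p: "p \<ge> 1"
  interpret prob_space M by fact
  note fbm = \<open>prob_space M\<close> \<open>two_sided_wiener M W\<close> \<open>fractional_BM M W H B\<close> \<open>1/2 < H\<close> \<open>H < 1\<close>
  note \<tau> = \<open>0 < \<tau>\<close>
  obtain b' Lb where b': "0 < Lb" "\<And>x. (b has_real_derivative b' x) (at x)" "\<And>x. \<bar>b' x\<bar> \<le> Lb" "\<And>x y. \<bar>b' x - b' y\<bar> \<le> Lb * \<bar>x - y\<bar>"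
    by (rule smooth_drift_bounds[OF \<open>Ck_on 2 UNIV b\<close> \<open>Cbk 1 (deriv b)\<close>]) (rule that)
  have b_cont: "continuous_on UNIV b"
    by (rule continuous_at_imp_continuous_on) (blast intro: DERIV_isCont b'(2))
  have b_meas [measurable]: "b \<in> borel_measurable borel" by (rule borel_measurable_continuous_onI[OF b_cont])
  obtain K0 where x0: "0 < K0" "\<And>t. t \<in> {-\<tau>..0} \<Longrightarrow> \<bar>x\<^sub>0 t\<bar> \<le> K0"
    "\<And>s t. s \<in> {-\<tau>..0} \<Longrightarrow> t \<in> {-\<tau>..0} \<Longrightarrow> \<bar>x\<^sub>0 t - x\<^sub>0 s\<bar> \<le> K0 * \<bar>t - s\<bar>"
    "\<And>t w. 0 \<le> w \<Longrightarrow> - \<tau> \<le> t - w \<Longrightarrow> t + w \<le> 0 \<Longrightarrow> \<bar>x\<^sub>0 (t + w) + x\<^sub>0 (t - w) - 2 * x\<^sub>0 t\<bar> \<le> K0 * w\<^sup>2"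
    and x0_cont: "continuous_on {-\<tau>..0} x\<^sub>0"
    by (rule smooth_initial_bounds[OF \<open>Ck_on 2 {-\<tau>..0} x\<^sub>0\<close>]) (rule that)
  obtain g G where g: "0 < G" "\<And>r. \<bar>g r\<bar> \<le> G" "\<And>r s. \<bar>g r - g s\<bar> \<le> G * \<bar>r - s\<bar>"
    and g_dens: "\<And>A. A \<in> sets (delay_space \<tau>) \<Longrightarrow> \<eta> A = (LINT r:A|lborel. g r)"
    by (rule lipschitz_density_extension[OF \<open>has_lipschitz_density \<tau> \<eta>\<close> \<tau>]) (rule that)
  have g_meas [measurable]: "g \<in> borel_measurable borel"
  proof -
    have "G-lipschitz_on UNIV g" using g by (intro lipschitz_onI) (simp_all add: dist_real_def)
    then show ?thesis by (rule borel_measurable_continuous_onI[OF lipschitz_on_continuous_on])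
  qed
  have X_meas: "X t \<in> borel_measurable M" if "- \<tau> \<le> t" for t
    using \<open>sdde_solution M \<tau> b \<eta> x\<^sub>0 B X\<close> that by (simp add: sdde_solution_def)
  have B_meas: "B t \<in> borel_measurable M" if "0 \<le> t" for t by (rule fBm_measurable[OF fbm that])
  let ?sol = "\<lambda>\<omega>. continuous_on {0..} (\<lambda>t. X t \<omega>) \<and> (\<forall>t. -\<tau> \<le> t \<and> t < 0 \<longrightarrow> X t \<omega> = x\<^sub>0 t) \<and>
        (\<forall>t\<ge>0. X t \<omega> = x\<^sub>0 0 + (LINT s:{0..t}|lborel. signed_integral (delay_space \<tau>) \<eta> (\<lambda>r. b (X (s - r) \<omega>))) + B t \<omega>)"
  have "AE \<omega> in M. ?sol \<omega>" "AE \<omega> in M. continuous_on {0..} (\<lambda>t. B t \<omega>)" "AE \<omega> in M. B 0 \<omega> = 0"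
    using \<open>sdde_solution M \<tau> b \<eta> x\<^sub>0 B X\<close> \<open>fractional_BM M W H B\<close> fBm_0[OF fbm]
    by (simp_all add: sdde_solution_def fractional_BM_def)
  then have "AE \<omega> in M. ?sol \<omega> \<and> continuous_on {0..} (\<lambda>t. B t \<omega>) \<and> B 0 \<omega> = 0" by eventually_elim blast
  \<comment> \<open>A single measurable null set carries all exceptional outcomes.\<close>
  then obtain N where N: "{\<omega> \<in> space M. \<not> (?sol \<omega> \<and> continuous_on {0..} (\<lambda>t. B t \<omega>) \<and> B 0 \<omega> = 0)} \<subseteq> N"
    "emeasure M N = 0" "N \<in> sets M" by (rule AE_E)
  have good: "?sol \<omega>" "continuous_on {0..} (\<lambda>t. B t \<omega>)" "B 0 \<omega> = 0" if "\<omega> \<in> space M" "\<omega> \<notin> N" for \<omega>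
    using N(1) that by blast+
  have AEN: "AE \<omega> in M. \<omega> \<notin> N" using N by (intro AE_not_in) (simp add: null_sets_def)
  \<comment> \<open>Versions with bounded continuous paths on the whole line for every outcome, hence jointly measurable.\<close>
  define Y where "Y t \<omega> = (if \<omega> \<in> N then 0 else X (max (- \<tau>) (min T t)) \<omega>)" for t \<omega>
  define B' where "B' t \<omega> = (if \<omega> \<in> N then 0 else B (max 0 (min T t)) \<omega>)" for t \<omega>
  have YX: "Y t \<omega> = X t \<omega>" if "\<omega> \<notin> N" "t \<in> {-\<tau>..T}" for t \<omega> using that by (simp add: Y_def)
  have BB: "B' t \<omega> = B t \<omega>" if "\<omega> \<notin> N" "t \<in> {0..T}" for t \<omega> using that by (simp add: B'_def)
  \<comment> \<open>The solution is prescribed for t < 0 only. At t = 0 the equation gives the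
    initial value because the integral is over a point and B 0 = 0 outside N; this makes the path
    continuous across 0.\<close>
  have X_init: "X t \<omega> = x\<^sub>0 t" if "\<omega> \<in> space M" "\<omega> \<notin> N" "t \<in> {-\<tau>..0}" for t \<omega>
  proof (cases "t < 0")
    case True
    then show ?thesis using good(1)[OF that(1,2)] that by auto
  next
    case False
    then have t: "t = 0" using that by auto
    have "AE s in lborel. indicator {0..0::real} s *\<^sub>R signed_integral (delay_space \<tau>) \<eta> (\<lambda>r. b (X (s - r) \<omega>)) = 0"
      using AE_lborel_singleton[of "0::real"] by eventually_elim auto
    then have "(LINT s:{0..0}|lborel. signed_integral (delay_space \<tau>) \<eta> (\<lambda>r. b (X (s - r) \<omega>))) = 0"
      unfolding set_lebesgue_integral_def by (rule integral_eq_zero_AE)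
    then show ?thesis using good[OF that(1,2)] t by auto
  qed
  have X_path: "continuous_on {-\<tau>..T} (\<lambda>t. X t \<omega>)" if "\<omega> \<in> space M" "\<omega> \<notin> N" for \<omega>
  proof -
    have "continuous_on {-\<tau>..0} (\<lambda>t. X t \<omega>)"
      using x0_cont by (rule continuous_on_eq) (use X_init[OF that] in auto)
    moreover have "continuous_on {0..T} (\<lambda>t. X t \<omega>)"
      using good(1)[OF that] by (auto intro: continuous_on_subset)
    ultimately have "continuous_on ({-\<tau>..0} \<union> {0..T}) (\<lambda>t. X t \<omega>)"
      by (intro continuous_on_closed_Un) auto
    moreover have "{-\<tau>..0} \<union> {0..T} = {-\<tau>..T}" using \<tau> T by auto
    ultimately show ?thesis by simp
  qed
  have Y_cont: "continuous_on UNIV (\<lambda>t. Y t \<omega>)" if "\<omega> \<in> space M" for \<omega>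
  proof (cases "\<omega> \<in> N")
    case False
    have "continuous_on UNIV (\<lambda>t. X (max (- \<tau>) (min T t)) \<omega>)"
      by (rule continuous_on_compose2[OF X_path[OF that False]]) (use \<tau> T in \<open>auto intro!: continuous_intros\<close>)
    with False show ?thesis by (simp add: Y_def)
  qed (simp add: Y_def)
  have B_cont: "continuous_on UNIV (\<lambda>t. B' t \<omega>)" if "\<omega> \<in> space M" for \<omega>
  proof (cases "\<omega> \<in> N")
    case False
    have "continuous_on UNIV (\<lambda>t. B (max 0 (min T t)) \<omega>)"
      by (rule continuous_on_compose2[OF good(2)[OF that False]]) (auto intro!: continuous_intros)
    with False show ?thesis by (simp add: B'_def)
  qed (simp add: B'_def)
  have Y_bdd: "\<exists>c. \<forall>t. \<bar>Y t \<omega>\<bar> \<le> c" if "\<omega> \<in> space M" for \<omega>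
  proof (cases "\<omega> \<in> N")
    case False
    have "bounded ((\<lambda>t. X t \<omega>) ` {-\<tau>..T})"
      by (intro compact_imp_bounded compact_continuous_image X_path that False) auto
    then obtain c where "\<And>t. t \<in> {-\<tau>..T} \<Longrightarrow> \<bar>X t \<omega>\<bar> \<le> c"
      unfolding bounded_iff real_norm_def by blast
    then show ?thesis using False \<tau> T by (auto simp: Y_def intro!: exI[of _ c])
  qed (auto simp: Y_def)
  have B_bdd: "\<exists>c. \<forall>t. \<bar>B' t \<omega>\<bar> \<le> c" if "\<omega> \<in> space M" for \<omega>
  proof (cases "\<omega> \<in> N")
    case False
    have "bounded ((\<lambda>t. B t \<omega>) ` {0..T})"
      by (intro compact_imp_bounded compact_continuous_image continuous_on_subset[OF good(2)[OF that False]]) auto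
    then obtain c where "\<And>t. t \<in> {0..T} \<Longrightarrow> \<bar>B t \<omega>\<bar> \<le> c"
      unfolding bounded_iff real_norm_def by blast
    then show ?thesis using False T by (auto simp: B'_def intro!: exI[of _ c])
  qed (auto simp: B'_def)
  have Y_measM: "Y t \<in> borel_measurable M" for t
    unfolding Y_def[abs_def] using N(3) X_meas by (intro measurable_If_set) auto
  have B_measM: "B' t \<in> borel_measurable M" for t
    unfolding B'_def[abs_def] using N(3) B_meas by (intro measurable_If_set) auto
  have density: "signed_integral (delay_space \<tau>) \<eta> f' = (LINT r:{0..\<tau>}|lborel. f r * g r)"
    if "f \<in> borel_measurable borel" "\<And>r. \<bar>f r\<bar> \<le> c" "\<And>r. r \<in> {0..\<tau>} \<Longrightarrow> f' r = f r" for f f' c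
    by (rule signed_integral_density[OF g_meas g(2) g_dens that])
  have Y_eq: "Y t \<omega> = x\<^sub>0 0 + (LINT s:{0..t}|lborel. LINT r:{0..\<tau>}|lborel. b (Y (s - r) \<omega>) * g r) + B' t \<omega>"
    if w: "\<omega> \<in> space M" "\<omega> \<notin> N" and t: "t \<in> {0..T}" for \<omega> t
  proof -
    obtain c where c: "\<And>t. \<bar>Y t \<omega>\<bar> \<le> c" using Y_bdd[OF w(1)] by blast
    have "bounded (b ` {-c..c})" by (intro compact_imp_bounded compact_continuous_image continuous_on_subset[OF b_cont]) auto
    then obtain c' where c': "\<And>x. x \<in> {-c..c} \<Longrightarrow> \<bar>b x\<bar> \<le> c'"
      unfolding bounded_iff real_norm_def by blast
    have bY: "\<bar>b (Y u \<omega>)\<bar> \<le> c'" for u using c[of u] by (intro c') (auto simp: abs_le_iff)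
    have "(LINT s:{0..t}|lborel. signed_integral (delay_space \<tau>) \<eta> (\<lambda>r. b (X (s - r) \<omega>)))
      = (LINT s:{0..t}|lborel. LINT r:{0..\<tau>}|lborel. b (Y (s - r) \<omega>) * g r)"
    proof (rule set_lebesgue_integral_cong)
      show "\<forall>s. s \<in> {0..t} \<longrightarrow> signed_integral (delay_space \<tau>) \<eta> (\<lambda>r. b (X (s - r) \<omega>)) = (LINT r:{0..\<tau>}|lborel. b (Y (s - r) \<omega>) * g r)"
      proof (intro allI impI density[of _ c'])
        fix s assume s: "s \<in> {0..t}"
        have "continuous_on UNIV (\<lambda>r. Y (s - r) \<omega>)"
          by (rule continuous_on_compose2[OF Y_cont[OF w(1)]]) (auto intro!: continuous_intros)
        then show "(\<lambda>r. b (Y (s - r) \<omega>)) \<in> borel_measurable borel"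
          by (intro measurable_compose[OF borel_measurable_continuous_onI b_meas])
        show "b (X (s - r) \<omega>) = b (Y (s - r) \<omega>)" if "r \<in> {0..\<tau>}" for r
          using that s t w by (subst YX) auto
      qed (rule bY)
    qed auto
    then show ?thesis using good(1)[OF w] t \<tau> by (simp add: YX[OF w(2)] BB[OF w(2)])
  qed
  interpret delay_em M H \<tau> T G Lb K0 b b' g x\<^sub>0 Y B'
  proof unfold_locales
    show "B' t \<omega> = 0" if "t \<le> 0" "\<omega> \<in> space M" for t \<omega>
      using good(3)[OF that(2)] that T by (auto simp: B'_def min_def max_def)
    show "AE \<omega> in M. \<forall>t\<in>{0..T}. Y t \<omega> = x\<^sub>0 0 + (LINT s:{0..t}|lborel. LINT r:{0..\<tau>}|lborel. b (Y (s - r) \<omega>) * g r) + B' t \<omega>"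
      using AEN AE_space by eventually_elim (use Y_eq in blast)
    show "AE \<omega> in M. \<forall>t\<in>{-\<tau>..0}. Y t \<omega> = x\<^sub>0 t"
      using AEN AE_space by eventually_elim (use T X_init YX in auto)
    show "\<exists>C>0. \<forall>s t. 0 \<le> s \<longrightarrow> s \<le> t \<longrightarrow> t \<le> T \<longrightarrow> Lq M q (\<lambda>\<omega>. B' t \<omega> - B' s \<omega>) (C * (t - s) powr H)" if q: "q \<ge> 1" for q :: nat
    proof -
      obtain C where C: "C > 0" "\<And>s t. 0 \<le> s \<Longrightarrow> s \<le> t \<Longrightarrow> Lq M q (\<lambda>\<omega>. B t \<omega> - B s \<omega>) (C * (t - s) powr H)"
        using Lq_fBm_incr[OF fbm q] by blast
      have "Lq M q (\<lambda>\<omega>. B' t \<omega> - B' s \<omega>) (C * (t - s) powr H)" if "0 \<le> s" "s \<le> t" "t \<le> T" for s t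
      proof (rule Lq_cong_AE[OF C(2)[OF that(1,2)]])
        show "AE \<omega> in M. B' t \<omega> - B' s \<omega> = B t \<omega> - B s \<omega>"
          using AEN by eventually_elim (use that BB in auto)
      qed (intro borel_measurable_diff B_measM)
      then show ?thesis using C(1) by blast
    qed
    show "\<exists>C>0. \<forall>w D l m. 0 \<le> w \<longrightarrow> w \<le> D \<longrightarrow> 1 \<le> l \<longrightarrow> real m * D \<le> T \<longrightarrow>
       Lq M q (\<lambda>\<omega>. \<Sum>i\<in>{l..<m}. incr2 B' (real i * D) w \<omega>) (C * D powr H * sqrt (real (m - l)))"
      if q: "q \<ge> 1" for q :: nat
    proof (intro exI[of _ "6 * gauss_const q"] conjI allI impI)
      show "0 < 6 * gauss_const q" using gauss_const_ge_1[of q] by simp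
      fix w D :: real and l m :: nat assume h: "0 \<le> w" "w \<le> D" "1 \<le> l" "real m * D \<le> T"
      show "Lq M q (\<lambda>\<omega>. \<Sum>i\<in>{l..<m}. incr2 B' (real i * D) w \<omega>) (6 * gauss_const q * D powr H * sqrt (real (m - l)))"
      proof (rule Lq_cong_AE[OF Lq_fBm_sum_incr2[OF fbm q h(1-3)]])
        show "AE \<omega> in M. (\<Sum>i\<in>{l..<m}. incr2 B' (real i * D) w \<omega>)
           = (\<Sum>i\<in>{l..<m}. incr2 B (real i * D) w \<omega>)"
          using AEN
        proof eventually_elim
          case (elim \<omega>)
          show ?case
          proof (intro sum.cong refl)
            fix i assume i: "i \<in> {l..<m}"
            have D: "0 \<le> D" using h by simp
            define u where "u = real i * D"
            \<comment> \<open>The indices 1 \<le> l \<le> i < m and w \<le> D keep all three times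
              inside [0, T], where the truncated noise agrees with the original one.\<close>
            have "1 * D \<le> real i * D" by (rule mult_right_mono[OF _ D]) (use i h in auto)
            moreover have "(real i + 1) * D \<le> real m * D" by (rule mult_right_mono[OF _ D]) (use i in auto)
            ultimately have "D \<le> u" "u + D \<le> T" using h(4) by (simp_all add: u_def distrib_right)
            then have "u \<in> {0..T}" "u + w \<in> {0..T}" "u - w \<in> {0..T}" using h D by auto
            then show "incr2 B' (real i * D) w \<omega> = incr2 B (real i * D) w \<omega>"
              unfolding u_def[symmetric] using BB[OF elim] by simp
          qed
        qed
      qed (intro borel_measurable_sum borel_measurable_add borel_measurable_diff borel_measurable_times borel_measurable_const B_measM)
    qed
  qed (use \<tau> T b' g x0 fbm Y_measM B_measM Y_cont B_cont Y_bdd B_bdd in auto)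
  \<comment> \<open>\<open>Lq\<close> admits natural powers only; the ceiling of p dominates
    p.\<close>
  define q where "q = nat \<lceil>p\<rceil>"
  have q: "q \<ge> 1" "p \<le> real q" using p by (auto simp: q_def le_nat_iff)
  obtain A where A: "A > 0" "\<And>d n t. t \<in> {0..T} \<Longrightarrow> 0 < d \<Longrightarrow> n \<ge> 1 \<Longrightarrow> real n * d = \<tau> \<Longrightarrow> Lq M q (path_error d t) (A * d powr (H + 1/2))"
    using Lq_path_error[OF q(1)] by blast
  define C where "C = A * exp (Lb * G * \<tau> * T)"
  have C: "0 < C" using A by (simp add: C_def)
  have main: "Lp_norm M p (\<lambda>\<omega>. X t \<omega> - Xn n t \<omega>) \<le> ennreal (2 * C * (\<tau> / real n) powr (H + 1/2))"
    if n: "n \<ge> 1" and t: "t \<in> {0..T}" for n t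
  proof -
    define d where "d = \<tau> / real n"
    have d: "0 < d" "real n * d = \<tau>" using n \<tau> by (auto simp: d_def)
    have em: "euler_maruyama M \<tau> b \<eta> x\<^sub>0 B d (Xn n)" unfolding d_def by (rule assms(16)[OF n])
    have V_meas: "Xn n t \<in> borel_measurable M" if "- \<tau> \<le> t" for t
      using em that by (simp add: euler_maruyama_def)
    \<comment> \<open>The scheme enters its own equation through finitely many grid values only.\<close>
    define Z where "Z m \<omega> = (if - int n \<le> m \<and> real_of_int m * d \<le> T then Xn n (real_of_int m * d) \<omega> else 0)" for m :: int and \<omega>
    have m_ge: "- \<tau> \<le> real_of_int m * d \<longleftrightarrow> - int n \<le> m" for m
    proof -
      have "- \<tau> \<le> real_of_int m * d \<longleftrightarrow> real_of_int (- int n) * d \<le> real_of_int m * d" using d by simp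
      also have "\<dots> \<longleftrightarrow> - int n \<le> m" using d(1) by (simp only: mult_le_cancel_right_pos of_int_le_iff)
      finally show ?thesis .
    qed
    have Z_meas: "Z m \<in> borel_measurable M" for m
      unfolding Z_def[abs_def] using V_meas m_ge by (cases "- int n \<le> m \<and> real_of_int m * d \<le> T") auto
    \<comment> \<open>Indices below -n lie before time -\<tau>, and indices above the ceiling of T /
      d lie after time T.\<close>
    have Z_supp: "Z m \<omega> = 0" if "max (int n) \<lceil>T / d\<rceil> < \<bar>m\<bar>" for m \<omega>
    proof (cases "- int n \<le> m")
      case True
      then have "\<lceil>T / d\<rceil> < m" using that n by auto
      then have "T / d < real_of_int m" by linarith
      then have "T < real_of_int m * d" using d(1) by (simp add: pos_divide_less_eq)
      then show ?thesis by (simp add: Z_def)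
    qed (simp add: Z_def)
    let ?em = "\<lambda>\<omega>. (\<forall>t. -\<tau> \<le> t \<and> t < 0 \<longrightarrow> Xn n t \<omega> = x\<^sub>0 t) \<and>
        (\<forall>t\<ge>0. Xn n t \<omega> = x\<^sub>0 0 + (LINT s:{0..t}|lborel. signed_integral (delay_space \<tau>) \<eta>
              (\<lambda>r. b (Xn n (grid_floor d s - grid_floor d r) \<omega>))) + B t \<omega>)"
    have AEem: "AE \<omega> in M. ?em \<omega>" using em by (simp add: euler_maruyama_def)
    have "Lq M q (\<lambda>\<omega>. Y t \<omega> - Xn n t \<omega>) (A * d powr (H + 1/2) * exp (Lb * G * \<tau> * t))"
    proof (rule Lq_euler_error[OF q(1) d(1) A(2)[OF _ d(1) n d(2)] _ _ Z_meas Z_supp _ _ _ t])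
      show "0 < A * d powr (H + 1/2)" using A d by simp
      show "Xn n t \<in> borel_measurable M" if "t \<in> {0..T}" for t using that \<tau> by (intro V_meas) auto
      show "AE \<omega> in M. \<forall>m<0. - \<tau> \<le> real_of_int m * d \<longrightarrow> Z m \<omega> = x\<^sub>0 (real_of_int m * d)"
        using AEem
      proof eventually_elim
        case (elim \<omega>)
        show ?case
        proof (intro allI impI)
          fix m :: int assume m: "m < 0" "- \<tau> \<le> real_of_int m * d"
          then have "real_of_int m * d < 0" using d by (simp add: mult_neg_pos)
          then show "Z m \<omega> = x\<^sub>0 (real_of_int m * d)" using elim m m_ge[of m] T by (auto simp: Z_def)
        qed
      qed
      show "AE \<omega> in M. \<forall>m\<ge>0. real_of_int m * d \<le> T \<longrightarrow> Z m \<omega> = Xn n (real_of_int m * d) \<omega>"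
        by (auto simp: Z_def)
      show "AE \<omega> in M. \<forall>t\<in>{0..T}. Xn n t \<omega> = x\<^sub>0 0 + (LINT s:{0..t}|lborel. LINT r:{0..\<tau>}|lborel. b (Z (\<lfloor>s / d\<rfloor> - \<lfloor>r / d\<rfloor>) \<omega>) * g r) + B' t \<omega>"
        using AEem AEN
      proof eventually_elim
        case (elim \<omega>)
        define N' where "N' = max (int n) \<lceil>T / d\<rceil>"
        define c where "c = \<bar>b 0\<bar> + (\<Sum>m\<in>{-N'..N'}. \<bar>b (Z m \<omega>)\<bar>)"
        have c: "\<bar>b (Z m \<omega>)\<bar> \<le> c" for m
        proof (cases "N' < \<bar>m\<bar>")
          case True
          then show ?thesis using Z_supp[of m \<omega>] by (simp add: N'_def c_def sum_nonneg)
        next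
          case False
          then have "m \<in> {-N'..N'}" by auto
          then have "\<bar>b (Z m \<omega>)\<bar> \<le> (\<Sum>m\<in>{-N'..N'}. \<bar>b (Z m \<omega>)\<bar>)" by (intro member_le_sum) auto
          then show ?thesis by (simp add: c_def)
        qed
        show ?case
        proof
          fix t assume t: "t \<in> {0..T}"
          have "(LINT s:{0..t}|lborel. signed_integral (delay_space \<tau>) \<eta> (\<lambda>r. b (Xn n (grid_floor d s - grid_floor d r) \<omega>)))
            = (LINT s:{0..t}|lborel. LINT r:{0..\<tau>}|lborel. b (Z (\<lfloor>s / d\<rfloor> - \<lfloor>r / d\<rfloor>) \<omega>) * g r)"
          proof (rule set_lebesgue_integral_cong)
            show "\<forall>s. s \<in> {0..t} \<longrightarrow> signed_integral (delay_space \<tau>) \<eta> (\<lambda>r. b (Xn n (grid_floor d s - grid_floor d r) \<omega>))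
              = (LINT r:{0..\<tau>}|lborel. b (Z (\<lfloor>s / d\<rfloor> - \<lfloor>r / d\<rfloor>) \<omega>) * g r)"
            proof (intro allI impI density[of _ c])
              fix s assume s: "s \<in> {0..t}"
              have [measurable]: "(\<lambda>m. b (Z m \<omega>)) \<in> measurable (count_space UNIV) borel" by simp
              show "(\<lambda>r. b (Z (\<lfloor>s / d\<rfloor> - \<lfloor>r / d\<rfloor>) \<omega>)) \<in> borel_measurable borel" by measurable
              fix r assume r: "r \<in> {0..\<tau>}"
              let ?u = "real_of_int (\<lfloor>s / d\<rfloor> - \<lfloor>r / d\<rfloor>) * d"
              have u: "grid_floor d s - grid_floor d r = ?u" by (simp add: grid_floor_def left_diff_distrib)
              \<comment> \<open>Both projections round down, and that of s is nonnegative, so the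
                difference lies between -r and s.\<close>
              have "- \<tau> \<le> ?u" "?u \<le> T"
                unfolding u[symmetric] using grid_floor_bounds[OF d(1), of s] grid_floor_bounds[OF d(1), of r] r s t by auto
              then show "b (Xn n (grid_floor d s - grid_floor d r) \<omega>) = b (Z (\<lfloor>s / d\<rfloor> - \<lfloor>r / d\<rfloor>) \<omega>)"
                unfolding u by (simp add: Z_def m_ge[symmetric] del: of_int_diff)
            qed (rule c)
          qed auto
          then show "Xn n t \<omega> = x\<^sub>0 0 + (LINT s:{0..t}|lborel. LINT r:{0..\<tau>}|lborel. b (Z (\<lfloor>s / d\<rfloor> - \<lfloor>r / d\<rfloor>) \<omega>) * g r) + B' t \<omega>"
            using elim t BB by auto
        qed
      qed
    qed
    then have "Lq M q (\<lambda>\<omega>. Y t \<omega> - Xn n t \<omega>) (C * d powr (H + 1/2))"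
    proof (rule Lq_mono)
      have "Lb * G * \<tau> * t \<le> Lb * G * \<tau> * T" using b'(1) g(1) \<tau> t by (intro mult_left_mono) auto
      then have "A * d powr (H + 1/2) * exp (Lb * G * \<tau> * t) \<le> A * d powr (H + 1/2) * exp (Lb * G * \<tau> * T)"
        using A(1) by (intro mult_left_mono) auto
      then show "A * d powr (H + 1/2) * exp (Lb * G * \<tau> * t) \<le> C * d powr (H + 1/2)"
        by (simp add: C_def mult_ac)
    qed
    then have "Lq M q (\<lambda>\<omega>. X t \<omega> - Xn n t \<omega>) (C * d powr (H + 1/2))"
    proof (rule Lq_cong_AE)
      show "(\<lambda>\<omega>. X t \<omega> - Xn n t \<omega>) \<in> borel_measurable M"
        using t \<tau> by (intro borel_measurable_diff X_meas V_meas) auto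
      show "AE \<omega> in M. X t \<omega> - Xn n t \<omega> = Y t \<omega> - Xn n t \<omega>"
        using AEN by eventually_elim (use YX t \<tau> in auto)
    qed
    moreover have "0 < C * d powr (H + 1/2)" using C d(1) by simp
    \<comment> \<open>The factor 2 in the final constant is the price of passing from the natural
      power q to the real power p.\<close>
    ultimately show ?thesis using Lq_Lp_norm[OF _ \<open>prob_space M\<close> _ p q(2)]
      by (simp only: d_def mult.assoc)
  qed
  show "\<exists>C>0. \<forall>n\<ge>1. (SUP t\<in>{0..T}. Lp_norm M p (\<lambda>\<omega>. X t \<omega> - Xn n t \<omega>)) \<le> ennreal (C * (\<tau> / real n) powr (H + 1/2))"
    using C main by (intro exI[of _ "2 * C"] conjI allI impI SUP_least) auto
qed

end
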